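(* Let $\xi=(\xi_t),\eta=(\eta_t)\in M_G^2(0,T;\mathbb{R})$ satisfy, for some constant $C\ge0$, $$\hat{\mathbb{E}}\big[|\xi_t-\xi_s|^2+|\eta_t-\eta_s|^2\big]\le C|t-s|,\qquad t,s\in[0,T].$$ Then the mapping $[0,T]\ni t\mapsto\mathcal{P}_{\{\xi_t|\eta_t\}}:=\{R\in\mathcal{P}_{\{\xi_t\}}:E_R[\eta_t]=\hat{\mathbb{E}}_{\{\xi_t\}}[\eta_t]\}\subset\mathcal{P}$ admits a $\mathcal{B}([0,T])$-$\mathcal{B}(\mathcal{P})$-measurable selection, i.e. there is a selection $R_t\in\mathcal{P}_{\{\xi_t|\eta_t\}}$, $t\in[0,T]$, such that the mapping $t\mapsto R_t$ is $\mathcal{B}([0,T])$-$\mathcal{B}(\mathcal{P})$-measurable.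
   Context: Fix $T>0$ and $0<\underline\sigma^2\le\overline\sigma^2<\infty$; $G(a)=\frac12(\overline\sigma^2a^+-\underline\sigma^2a^-)$. $\Omega=C([0,T];\mathbb{R})$ with the uniform distance and Borel $\sigma$-field $\mathcal{B}(\Omega)$; $B$ is the coordinate process; $L_{ip}(\Omega)$ is the set of random variables $\varphi(B_{t_1},B_{t_2}-B_{t_1},\dots,B_{t_n}-B_{t_{n-1}})$ with $n\ge1$, $0\le t_1<\dots<t_n\le T$, $\varphi$ bounded Lipschitz. $\hat{\mathbb{E}}$ is the $G$-expectation, i.e. the sublinear expectation on $L_{ip}(\Omega)$ under which $B$ is a one-dimensional $G$-Brownian motion: $\hat{\mathbb{E}}[\varphi(B_{t_1},\dots,B_{t_n}-B_{t_{n-1}})]=\widetilde{\mathbb{E}}[\varphi(\sqrt{t_1}\xi_1,\dots,\sqrt{t_n-t_{n-1}}\xi_n)]$, where on some sublinear expectation space the $\xi_i$ are identically distributed and $G$-normal (with $\widetilde{\mathbb{E}}[\xi_i^2]=\overline\sigma^2$, $-\widetilde{\mathbb{E}}[-\xi_i^2]=\underline\sigma^2$), each $\xi_i$ independent of $(\xi_1,\dots,\xi_{i-1})$ in Peng's sense. $L_G^p(\Omega)$ is the completion of $L_{ip}(\Omega)$ under $(\hat{\mathbb{E}}[|\cdot|^p])^{1/p}$ (similarly $L_G^p(\Omega_t)$, using only times $t_i\le t$). $M_G^2(0,T;\mathbb{R})$ is the completion of the step processes $\sum_i\zeta_iI_{(s_i,s_{i+1}]}$, $\zeta_i\in L_G^2(\Omega_{s_i})$,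 under $(\hat{\mathbb{E}}[\int_0^T|\cdot|^2ds])^{1/2}$; implicitly the processes considered satisfy $\xi_t,\eta_t\in L_G^2(\Omega)$ for every $t\in[0,T]$. $\mathcal{P}=\{P\text{ probability on }(\Omega,\mathcal{B}(\Omega)):E_P[X]\le\hat{\mathbb{E}}[X]\ \forall X\in L_G^1(\Omega)\}$; it is known to be nonempty, convex, weakly compact, with $\hat{\mathbb{E}}[\zeta]=\max_{P\in\mathcal{P}}E_P[\zeta]$ for $\zeta\in L_G^1(\Omega)$. For $\zeta,\zeta'\in L_G^1(\Omega)$: $\mathcal{P}_{\{\zeta\}}:=\{P\in\mathcal{P}:E_P[\zeta]=\hat{\mathbb{E}}[\zeta]\}$ and $\hat{\mathbb{E}}_{\{\zeta\}}[\zeta']:=\sup_{P\in\mathcal{P}_{\{\zeta\}}}E_P[\zeta']$. $d$ is a metric on $\mathcal{P}$ compatible with weak convergence: $d(P,Q)=\sup\{\int_\Omega f\,d(P-Q):|f|_{BL}\le1\}$, $|f|_{BL}=\sup_\omega|f(\omega)|+\sup_{\omega\ne\omega'}\frac{|f(\omega)-f(\omega')|}{|\omega-\omega'|_{C([0,T])}}$. $\mathcal{B}([0,T])$ and $\mathcal{B}(\mathcal{P})$ are the Borel $\sigma$-fields over $[0,T]$ and $(\mathcal{P},d)$. *)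

theory Defs
  imports "HOL-Probability.Probability"
begin

section \<open>The path space and Borel fields of metric spaces\<close>

text \<open>
  Paths are extensional functions (\<^term>\<open>undefined\<close> outside the interval), so that
  equality of paths is equality on \<open>[0,T]\<close>.
\<close>

definition path_metric :: "real \<Rightarrow> (real \<Rightarrow> real) metric" where
  "path_metric T = cfunspace (top_of_set {0..T}) euclidean_metric"

text \<open>
  The Borel field of the metric space \<open>(M, d)\<close>. The open sets are spelled out because
  the library topology is only accessible once \<open>d\<close> is known to be nonnegative and symmetric on
  the whole type.
\<close>

definition metric_borel :: "'a set \<Rightarrow> ('a \<Rightarrow> 'a \<Rightarrow> real) \<Rightarrow> 'a measure" where
  "metric_borel M d =
     sigma M {U. U \<subseteq> M \<and> (\<forall>x\<in>U. \<exists>r>0. \<forall>y\<in>M. d x y < r \<longrightarrow> y \<in> U)}"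

definition path_borel :: "real \<Rightarrow> (real \<Rightarrow> real) measure" where
  "path_borel T = metric_borel (mspace (path_metric T)) (mdist (path_metric T))"

lemma mspace_path_metric:
  "mspace (path_metric T) = {\<omega> \<in> extensional {0..T}. continuous_on {0..T} \<omega>}"
proof -
  have "Metric_space.mbounded UNIV dist (\<omega> ` {0..T})"
    if "continuous_on {0..T} \<omega>" for \<omega> :: "real \<Rightarrow> real"
    using compact_imp_bounded[OF compact_continuous_image[OF that compact_Icc]] by simp
  then show ?thesis by (auto simp: path_metric_def)
qed

lemma mdist_path_metric:
  assumes "0 \<le> T" "\<omega> \<in> mspace (path_metric T)" "\<omega>' \<in> mspace (path_metric T)"
  shows "mdist (path_metric T) \<omega> \<omega>' = (SUP t\<in>{0..T}. \<bar>\<omega> t - \<omega>' t\<bar>)"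
proof -
  have "\<omega> \<in> Metric_space.fspace UNIV dist {0..T}" "\<omega>' \<in> Metric_space.fspace UNIV dist {0..T}"
    using assms(2,3) cfunspace_subset_funspace[of "top_of_set {0..T}" "euclidean_metric"]
    by (auto simp: path_metric_def Met_TC.fspace_def)
  then show ?thesis
    using assms(1)
    by (simp add: path_metric_def mdist_cfunspace_eq_mdist_funspace Met_TC.fdist_def dist_real_def)
qed

lemma metric_borel_eq:
  assumes "Metric_space M d"
  shows "metric_borel M d = sigma M {U. openin (Metric_space.mtopology M d) U}"
proof -
  interpret Metric_space M d by fact
  have "(\<forall>x\<in>U. \<exists>r>0. \<forall>y\<in>M. d x y < r \<longrightarrow> y \<in> U) \<longleftrightarrow> (\<forall>x. x \<in> U \<longrightarrow> (\<exists>r>0. mball x r \<subseteq> U))"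
    if "U \<subseteq> M" for U
  proof -
    have "(\<forall>y\<in>M. d x y < r \<longrightarrow> y \<in> U) \<longleftrightarrow> mball x r \<subseteq> U" if "x \<in> U" for x r
      using that \<open>U \<subseteq> M\<close> by (auto simp: mball_def)
    then show ?thesis by auto
  qed
  then have "{U. U \<subseteq> M \<and> (\<forall>x\<in>U. \<exists>r>0. \<forall>y\<in>M. d x y < r \<longrightarrow> y \<in> U)} = {U. openin mtopology U}"
    unfolding openin_mtopology by blast
  then show ?thesis by (simp add: metric_borel_def)
qed


section \<open>Test functions\<close>

text \<open>
  Vectors in \<open>\<real>\<^sup>n\<close> are encoded as \<^typ>\<open>nat \<Rightarrow> real\<close>, of which only the coordinates below
  \<open>n\<close> count: \<open>L2_set x {..<n}\<close> is the Euclidean norm. Both conditions below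
  force \<open>\<phi> x = \<phi> y\<close> whenever \<open>x\<close> and \<open>y\<close> agree below \<open>n\<close>.
\<close>

definition bdd_lipschitz :: "nat \<Rightarrow> ((nat \<Rightarrow> real) \<Rightarrow> real) \<Rightarrow> bool" where
  "bdd_lipschitz n \<phi> \<longleftrightarrow>
     (\<exists>K. \<forall>x. \<bar>\<phi> x\<bar> \<le> K) \<and>
     (\<exists>L. \<forall>x y. \<bar>\<phi> x - \<phi> y\<bar> \<le> L * L2_set (\<lambda>i. x i - y i) {..<n})"

text \<open>Peng's class \<open>C_{l,Lip}(\<real>\<^sup>n)\<close>: the Lipschitz constant may grow polynomially.\<close>

definition loc_lipschitz :: "nat \<Rightarrow> ((nat \<Rightarrow> real) \<Rightarrow> real) \<Rightarrow> bool" where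
  "loc_lipschitz n \<phi> \<longleftrightarrow>
     (\<exists>L (m::nat). \<forall>x y. \<bar>\<phi> x - \<phi> y\<bar>
        \<le> L * (1 + L2_set x {..<n} ^ m + L2_set y {..<n} ^ m) * L2_set (\<lambda>i. x i - y i) {..<n})"


section \<open>Sublinear expectations and the G-normal distribution\<close>

definition sublinear_on :: "('w \<Rightarrow> real) set \<Rightarrow> (('w \<Rightarrow> real) \<Rightarrow> real) \<Rightarrow> bool" where
  "sublinear_on H E \<longleftrightarrow>
     (\<forall>X\<in>H. \<forall>Y\<in>H. (\<forall>w. X w \<le> Y w) \<longrightarrow> E X \<le> E Y) \<and>
     (\<forall>c. E (\<lambda>_. c) = c) \<and>
     (\<forall>X\<in>H. \<forall>Y\<in>H. E (\<lambda>w. X w + Y w) \<le> E X + E Y) \<and>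
     (\<forall>X\<in>H. \<forall>c\<ge>0. E (\<lambda>w. c * X w) = c * E X)"

text \<open>
  The closure condition subsumes that \<open>H\<close> is a vector lattice containing the constants.
\<close>

definition sublinear_space :: "('w \<Rightarrow> real) set \<Rightarrow> (('w \<Rightarrow> real) \<Rightarrow> real) \<Rightarrow> bool" where
  "sublinear_space H E \<longleftrightarrow>
     (\<forall>n \<phi> X. loc_lipschitz n \<phi> \<and> (\<forall>i<n. X i \<in> H) \<longrightarrow> (\<lambda>w. \<phi> (\<lambda>i. X i w)) \<in> H) \<and>
     sublinear_on H E"

definition same_distribution :: "(('w \<Rightarrow> real) \<Rightarrow> real) \<Rightarrow> ('w \<Rightarrow> real) \<Rightarrow> ('w \<Rightarrow> real) \<Rightarrow> bool" where
  "same_distribution E X Y \<longleftrightarrow>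
     (\<forall>\<phi>. loc_lipschitz 1 \<phi> \<longrightarrow> E (\<lambda>w. \<phi> (\<lambda>_. X w)) = E (\<lambda>w. \<phi> (\<lambda>_. Y w)))"

text \<open>
  Peng independence of \<open>Y\<close> from the vector \<open>(X 0, \<dots>, X (n - 1))\<close>; this relation is not symmetric.
\<close>

definition independent_from ::
    "(('w \<Rightarrow> real) \<Rightarrow> real) \<Rightarrow> nat \<Rightarrow> (nat \<Rightarrow> 'w \<Rightarrow> real) \<Rightarrow> ('w \<Rightarrow> real) \<Rightarrow> bool" where
  "independent_from E n X Y \<longleftrightarrow>
     (\<forall>\<phi>. loc_lipschitz (Suc n) \<phi> \<longrightarrow>
        E (\<lambda>w. \<phi> ((\<lambda>i. X i w)(n := Y w))) =
        E (\<lambda>w. E (\<lambda>w'. \<phi> ((\<lambda>i. X i w)(n := Y w')))))"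

definition G_fun :: "real \<Rightarrow> real \<Rightarrow> real \<Rightarrow> real" where
  "G_fun \<sigma>l \<sigma>u a = (\<sigma>u\<^sup>2 * max a 0 - \<sigma>l\<^sup>2 * max (- a) 0) / 2"

text \<open>
  Stability under sums with an independent copy, normalised by \<open>G a = E[a X\<^sup>2] / 2\<close>. Taking
  \<open>a = 1\<close> and \<open>a = -1\<close> gives \<open>E[X\<^sup>2] = \<sigma>u\<^sup>2\<close> and \<open>- E[- X\<^sup>2] = \<sigma>l\<^sup>2\<close>.
\<close>

definition G_normal ::
    "real \<Rightarrow> real \<Rightarrow> ('w \<Rightarrow> real) set \<Rightarrow> (('w \<Rightarrow> real) \<Rightarrow> real) \<Rightarrow> ('w \<Rightarrow> real) \<Rightarrow> bool" where
  "G_normal \<sigma>l \<sigma>u H E X \<longleftrightarrow>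
     X \<in> H \<and>
     (\<exists>Y\<in>H. same_distribution E Y X \<and> independent_from E 1 (\<lambda>_. X) Y \<and>
        (\<forall>a\<ge>0. \<forall>b\<ge>0. same_distribution E
            (\<lambda>w. a * X w + b * Y w) (\<lambda>w. sqrt (a\<^sup>2 + b\<^sup>2) * X w))) \<and>
     (\<forall>a. E (\<lambda>w. a * (X w)\<^sup>2) / 2 = G_fun \<sigma>l \<sigma>u a)"


section \<open>The G-expectation on the path space\<close>

text \<open>
  With \<open>B \<omega> = \<omega>\<close>, the vector \<open>(B(t 0), B(t 1) - B(t 0), \<dots>)\<close> along the times \<open>t 0 < t 1 < \<dots>\<close>.
\<close>

fun increments :: "(nat \<Rightarrow> real) \<Rightarrow> (real \<Rightarrow> real) \<Rightarrow> nat \<Rightarrow> real" where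
  "increments t \<omega> 0 = \<omega> (t 0)"
| "increments t \<omega> (Suc i) = \<omega> (t (Suc i)) - \<omega> (t i)"

definition time_grid :: "real \<Rightarrow> nat \<Rightarrow> (nat \<Rightarrow> real) \<Rightarrow> bool" where
  "time_grid s n t \<longleftrightarrow> 1 \<le> n \<and> 0 \<le> t 0 \<and> strict_mono_on {..<n} t \<and> t (n - 1) \<le> s"

text \<open>
  \<open>Lip s\<close> is \<open>L\<^sub>i\<^sub>p(\<Omega>\<^sub>s)\<close>. Its members are functions on the whole type \<^typ>\<open>real \<Rightarrow> real\<close>,
  but only read the path at times in \<open>[0,s]\<close>; since a path attains arbitrary values at finitely
  many times, two members that agree on \<open>\<Omega>\<close> are equal.
\<close>

definition Lip :: "real \<Rightarrow> ((real \<Rightarrow> real) \<Rightarrow> real) set" where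
  "Lip s = {X. \<exists>n t \<phi>. time_grid s n t \<and> bdd_lipschitz n \<phi> \<and> X = (\<lambda>\<omega>. \<phi> (increments t \<omega>))}"

definition is_G_expectation ::
    "real \<Rightarrow> real \<Rightarrow> real \<Rightarrow> ('w \<Rightarrow> real) set \<Rightarrow> (('w \<Rightarrow> real) \<Rightarrow> real) \<Rightarrow> (nat \<Rightarrow> 'w \<Rightarrow> real)
      \<Rightarrow> (((real \<Rightarrow> real) \<Rightarrow> real) \<Rightarrow> real) \<Rightarrow> bool" where
  "is_G_expectation T \<sigma>l \<sigma>u H E' \<zeta> E \<longleftrightarrow>
     sublinear_space H E' \<and>
     (\<forall>i. G_normal \<sigma>l \<sigma>u H E' (\<zeta> i)) \<and>
     (\<forall>i j. same_distribution E' (\<zeta> i) (\<zeta> j)) \<and>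
     (\<forall>i. independent_from E' i \<zeta> (\<zeta> i)) \<and>
     sublinear_on (Lip T) E \<and>
     (\<forall>n t \<phi>. time_grid T n t \<and> bdd_lipschitz n \<phi> \<longrightarrow>
        E (\<lambda>\<omega>. \<phi> (increments t \<omega>)) =
        E' (\<lambda>w. \<phi> (\<lambda>i. sqrt (increments t (\<lambda>s. s) i) * \<zeta> i w)))"


section \<open>The completions\<close>

text \<open>
  Elements of the completions are realised as Borel functions on \<open>\<Omega>\<close>. Each probability \<open>P\<close>
  dominated by \<open>E\<close> on \<open>Lip T\<close> makes \<open>(Lip T, (E \<bar>\<cdot>\<bar>\<^sup>p)\<^sup>1\<^sup>/\<^sup>p) \<rightarrow> L\<^sup>p(P)\<close> a contraction, which extends
  to the completion; a function represents the abstract limit of an \<open>E\<close>-Cauchy sequence if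
  it is the image of that limit in \<open>L\<^sup>p(P)\<close> for every such \<open>P\<close>.
\<close>

definition dominated :: "real \<Rightarrow> (((real \<Rightarrow> real) \<Rightarrow> real) \<Rightarrow> real) \<Rightarrow> (real \<Rightarrow> real) measure set" where
  "dominated T E = {P. prob_space P \<and> sets P = sets (path_borel T) \<and>
     (\<forall>X\<in>Lip T. (\<integral>\<omega>. X \<omega> \<partial>P) \<le> E X)}"

definition represents ::
    "real \<Rightarrow> (((real \<Rightarrow> real) \<Rightarrow> real) \<Rightarrow> real) \<Rightarrow> nat
      \<Rightarrow> (nat \<Rightarrow> (real \<Rightarrow> real) \<Rightarrow> real) \<Rightarrow> ((real \<Rightarrow> real) \<Rightarrow> real) \<Rightarrow> bool" where
  "represents T E p X f \<longleftrightarrow>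
     (\<forall>n. X n \<in> Lip T) \<and>
     (\<forall>e>0. \<exists>N. \<forall>m\<ge>N. \<forall>n\<ge>N. root p (E (\<lambda>\<omega>. \<bar>X m \<omega> - X n \<omega>\<bar> ^ p)) < e) \<and>
     f \<in> borel_measurable (path_borel T) \<and>
     (\<forall>P\<in>dominated T E. (\<lambda>n. \<integral>\<^sup>+\<omega>. ennreal (\<bar>X n \<omega> - f \<omega>\<bar> ^ p) \<partial>P) \<longlonglongrightarrow> 0)"

text \<open>\<open>LG T E p s\<close> is \<open>L\<^sub>G\<^sup>p(\<Omega>\<^sub>s)\<close>, with \<open>s = T\<close> giving \<open>L\<^sub>G\<^sup>p(\<Omega>)\<close>.\<close>

definition LG ::
    "real \<Rightarrow> (((real \<Rightarrow> real) \<Rightarrow> real) \<Rightarrow> real) \<Rightarrow> nat \<Rightarrow> real \<Rightarrow> ((real \<Rightarrow> real) \<Rightarrow> real) set" where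
  "LG T E p s = {f. \<exists>X. (\<forall>n. X n \<in> Lip s) \<and> represents T E p X f}"

text \<open>The extension of \<open>E\<close> from \<open>Lip T\<close> to \<open>LG T E 1 T\<close> by continuity.\<close>

definition Ehat ::
    "real \<Rightarrow> (((real \<Rightarrow> real) \<Rightarrow> real) \<Rightarrow> real) \<Rightarrow> ((real \<Rightarrow> real) \<Rightarrow> real) \<Rightarrow> real" where
  "Ehat T E f = (THE c. \<exists>X. represents T E 1 X f \<and> (\<lambda>n. E (X n)) \<longlonglongrightarrow> c)"

text \<open>For a process \<open>Y\<close>, \<open>Y t \<omega>\<close> is its value at time \<open>t\<close> along the path \<open>\<omega>\<close>.\<close>

definition step_processes ::
    "real \<Rightarrow> (((real \<Rightarrow> real) \<Rightarrow> real) \<Rightarrow> real) \<Rightarrow> (real \<Rightarrow> (real \<Rightarrow> real) \<Rightarrow> real) set" where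
  "step_processes T E = {Y. \<exists>N s \<zeta>.
     0 \<le> s 0 \<and> strict_mono_on {..N} s \<and> s N \<le> T \<and>
     (\<forall>i<N. \<zeta> i \<in> LG T E 2 (s i)) \<and>
     Y = (\<lambda>t \<omega>. \<Sum>i<N. \<zeta> i \<omega> * indicator {s i<..s (Suc i)} t)}"

text \<open>
  As for \<open>LG\<close>, the abstract limit of a Cauchy sequence of step processes is identified with a
  jointly measurable process through its images in \<open>L\<^sup>2(dt \<otimes> P)\<close>.
\<close>

definition MG2 ::
    "real \<Rightarrow> (((real \<Rightarrow> real) \<Rightarrow> real) \<Rightarrow> real) \<Rightarrow> (real \<Rightarrow> (real \<Rightarrow> real) \<Rightarrow> real) set" where
  "MG2 T E = {\<xi>. \<exists>Y.
     (\<forall>k. Y k \<in> step_processes T E) \<and>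
     (\<forall>e>0. \<exists>N. \<forall>k\<ge>N. \<forall>l\<ge>N.
        sqrt (Ehat T E (\<lambda>\<omega>. LINT s:{0..T}|lborel. \<bar>Y k s \<omega> - Y l s \<omega>\<bar>\<^sup>2)) < e) \<and>
     (\<lambda>(s, \<omega>). \<xi> s \<omega>) \<in> borel_measurable (restrict_space borel {0..T} \<Otimes>\<^sub>M path_borel T) \<and>
     (\<forall>P\<in>dominated T E.
        (\<lambda>k. \<integral>\<^sup>+\<omega>. (\<integral>\<^sup>+s\<in>{0..T}. ennreal (\<bar>Y k s \<omega> - \<xi> s \<omega>\<bar>\<^sup>2) \<partial>lborel) \<partial>P) \<longlonglongrightarrow> 0)}"


section \<open>The representing probabilities and the argmax sets\<close>

definition Probs :: "real \<Rightarrow> (((real \<Rightarrow> real) \<Rightarrow> real) \<Rightarrow> real) \<Rightarrow> (real \<Rightarrow> real) measure set" where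
  "Probs T E = {P. prob_space P \<and> sets P = sets (path_borel T) \<and>
     (\<forall>X\<in>LG T E 1 T. (\<integral>\<omega>. X \<omega> \<partial>P) \<le> Ehat T E X)}"

definition Probs_at ::
    "real \<Rightarrow> (((real \<Rightarrow> real) \<Rightarrow> real) \<Rightarrow> real) \<Rightarrow> ((real \<Rightarrow> real) \<Rightarrow> real)
      \<Rightarrow> (real \<Rightarrow> real) measure set" where
  "Probs_at T E X = {P \<in> Probs T E. (\<integral>\<omega>. X \<omega> \<partial>P) = Ehat T E X}"

definition Ehat_at ::
    "real \<Rightarrow> (((real \<Rightarrow> real) \<Rightarrow> real) \<Rightarrow> real) \<Rightarrow> ((real \<Rightarrow> real) \<Rightarrow> real)
      \<Rightarrow> ((real \<Rightarrow> real) \<Rightarrow> real) \<Rightarrow> real" where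
  "Ehat_at T E X Y = (SUP P\<in>Probs_at T E X. \<integral>\<omega>. Y \<omega> \<partial>P)"

definition Probs_at2 ::
    "real \<Rightarrow> (((real \<Rightarrow> real) \<Rightarrow> real) \<Rightarrow> real) \<Rightarrow> ((real \<Rightarrow> real) \<Rightarrow> real)
      \<Rightarrow> ((real \<Rightarrow> real) \<Rightarrow> real) \<Rightarrow> (real \<Rightarrow> real) measure set" where
  "Probs_at2 T E X Y = {R \<in> Probs_at T E X. (\<integral>\<omega>. Y \<omega> \<partial>R) = Ehat_at T E X Y}"

definition BL_norm :: "real \<Rightarrow> ((real \<Rightarrow> real) \<Rightarrow> real) \<Rightarrow> ennreal" where
  "BL_norm T f =
     (SUP \<omega>\<in>mspace (path_metric T). ennreal \<bar>f \<omega>\<bar>) +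
     (SUP (\<omega>, \<omega>') \<in> {(\<omega>, \<omega>'). \<omega> \<in> mspace (path_metric T) \<and> \<omega>' \<in> mspace (path_metric T) \<and> \<omega> \<noteq> \<omega>'}.
        ennreal (\<bar>f \<omega> - f \<omega>'\<bar> / mdist (path_metric T) \<omega> \<omega>'))"

definition BL_dist :: "real \<Rightarrow> (real \<Rightarrow> real) measure \<Rightarrow> (real \<Rightarrow> real) measure \<Rightarrow> real" where
  "BL_dist T P Q = (SUP f\<in>{f. BL_norm T f \<le> 1}. (\<integral>\<omega>. f \<omega> \<partial>P) - (\<integral>\<omega>. f \<omega> \<partial>Q))"

definition Probs_borel ::
    "real \<Rightarrow> (((real \<Rightarrow> real) \<Rightarrow> real) \<Rightarrow> real) \<Rightarrow> (real \<Rightarrow> real) measure measure" where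
  "Probs_borel T E = metric_borel (Probs T E) (BL_dist T)"

end

theory Submission
  imports Defs
begin

text \<open>
  The \<open>G\<close>-expectation enters only through two properties: it is sublinear on the bounded Lipschitz
  cylinder functions \<open>Lip T\<close>, and the truncated fourth moments of the increments satisfy
  \<open>E[\<bar>B t - B s\<bar>\<^sup>4] \<le> M (t - s)\<^sup>2\<close> (locale \<open>moment_bound\<close>). Everything else follows from these.
  
  Representation. A linear functional on \<open>Lip T\<close> below \<open>E\<close> is tight: a chaining argument along dyadic
  times shows that it almost lives on a set of paths that is compact for pointwise convergence
  (\<open>l_tight\<close>). By Dini's theorem it is therefore continuous along decreasing sequences
  (\<open>l_continuous\<close>), and the Daniell construction turns it into a probability on the path space
  (\<open>functional_representation\<close>). Together with the Hahn-Banach theorem this gives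
  \<open>E X = max E\<^sub>P[X]\<close> over the dominated probabilities \<open>P\<close>, first on \<open>Lip T\<close> and then, by uniform
  approximation, for \<open>Ehat\<close> on the completions (\<open>Ehat_eq\<close>); moreover \<open>Probs T E\<close> is exactly the set of
  dominated probabilities (\<open>Probs_eq\<close>).
  
  Compactness. The representing probabilities correspond to the functionals below \<open>E\<close>, which form a
  compact set by Tychonoff's theorem (\<open>compact_functionals\<close>). Tightness shows that finitely many cylinder
  functions control the bounded Lipschitz distance up to any given error (\<open>finite_test_family\<close>).
  Consequently sets that are open for this distance are weakly open (\<open>BL_open_imp_weakly_open\<close>), and
  countably many cylinder functions separate the probabilities.
  
  Selection. By the Cauchy-Schwarz inequality \<open>t \<mapsto> E\<^sub>P[\<xi> t]\<close> and \<open>t \<mapsto> E\<^sub>P[\<eta> t]\<close> are Hoelder continuous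
  uniformly in \<open>P\<close>, so both are jointly continuous in \<open>(t, P)\<close>. A measurable selection is obtained by
  lexicographic maximisation: maximise \<open>\<xi> t\<close>, then \<open>\<eta> t\<close>, and then, one after the other, the functions
  of the separating family. The last maximisations leave exactly one point, and at each stage the set of
  times at which the maximisers meet a given closed set is Borel
  (\<open>measurable_lexicographic_selection\<close>).
\<close>

section \<open>Tychonoff and Hahn-Banach theorems\<close>

lemma compact_Pi:
  fixes S :: "'i \<Rightarrow> 'a::topological_space set"
  assumes "\<And>i. compact (S i)"
  shows "compact {f. \<forall>i. f i \<in> S i}"
proof -
  have "compactin (product_topology (\<lambda>i. euclidean) UNIV) (PiE UNIV S)"
    using assms by (simp add: compactin_PiE)
  moreover have "PiE UNIV S = {f. \<forall>i. f i \<in> S i}" by (auto simp: PiE_def)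
  ultimately show ?thesis by (simp add: euclidean_product_topology)
qed

text \<open>
  A vector subspace of the real functions on a type, with the operations taken pointwise.
\<close>

definition function_subspace :: "('a \<Rightarrow> real) set \<Rightarrow> bool" where
  "function_subspace V \<longleftrightarrow>
     (\<forall>X\<in>V. \<forall>Y\<in>V. (\<lambda>w. X w + Y w) \<in> V) \<and> (\<forall>X\<in>V. \<forall>c. (\<lambda>w. c * X w) \<in> V) \<and> V \<noteq> {}"

text \<open>
  Subadditivity and positive homogeneity on \<open>V\<close>; values outside \<open>V\<close> are unconstrained. The same convention applies to linear functionals.
\<close>

definition sublinear_functional :: "('a \<Rightarrow> real) set \<Rightarrow> (('a \<Rightarrow> real) \<Rightarrow> real) \<Rightarrow> bool" where
  "sublinear_functional V p \<longleftrightarrow>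
     (\<forall>X\<in>V. \<forall>Y\<in>V. p (\<lambda>w. X w + Y w) \<le> p X + p Y) \<and>
     (\<forall>X\<in>V. \<forall>c\<ge>0. p (\<lambda>w. c * X w) = c * p X)"

definition linear_functional :: "('a \<Rightarrow> real) set \<Rightarrow> (('a \<Rightarrow> real) \<Rightarrow> real) \<Rightarrow> bool" where
  "linear_functional V l \<longleftrightarrow>
     (\<forall>X\<in>V. \<forall>Y\<in>V. l (\<lambda>w. X w + Y w) = l X + l Y) \<and>
     (\<forall>X\<in>V. \<forall>c. l (\<lambda>w. c * X w) = c * l X)"

lemma sublinear_functional_lower:
  assumes V: "function_subspace V" and p: "sublinear_functional V p" and X: "X \<in> V"
  shows "- p (\<lambda>w. - X w) \<le> p X"
proof -
  have m: "(\<lambda>w. - X w) \<in> V" using V X unfolding function_subspace_def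
    by (metis (no_types, lifting) mult_minus1 ext)
  have "\<forall>Y\<in>V. p (\<lambda>w. X w + Y w) \<le> p X + p Y"
    using p X unfolding sublinear_functional_def by blast
  from bspec[OF this m] have "p (\<lambda>w. X w + - X w) \<le> p X + p (\<lambda>w. - X w)" .
  moreover have "p (\<lambda>w. 0 * X w) = 0 * p X" using p X unfolding sublinear_functional_def by blast
  ultimately show ?thesis by simp
qed

text \<open>
  Lowering \<open>p\<close> as far as possible along the direction \<open>Y\<close>. A minimal sublinear functional is unchanged
  by this operation, which forces it to be linear.
\<close>

lemma directional_sublinear:
  assumes V: "function_subspace V" and p: "sublinear_functional V p" and Y: "Y \<in> V"
  defines "q \<equiv> (\<lambda>X. INF t\<in>{0..}. p (\<lambda>w. X w + t * Y w) - t * p Y)"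
  shows "sublinear_functional V q" and "\<And>X. X \<in> V \<Longrightarrow> q X \<le> p X" and "q (\<lambda>w. - Y w) \<le> - p Y"
proof -
  have add: "(\<lambda>w. X w + Z w) \<in> V" if "X \<in> V" "Z \<in> V" for X Z
    using V that unfolding function_subspace_def by blast
  have sc: "(\<lambda>w. c * X w) \<in> V" if "X \<in> V" for X c
    using V that unfolding function_subspace_def by blast
  have neg: "(\<lambda>w. - X w) \<in> V" if "X \<in> V" for X
    using sc[OF that, of "-1"] by simp
  have psub: "p (\<lambda>w. X w + Z w) \<le> p X + p Z" if "X \<in> V" "Z \<in> V" for X Z
    using p that unfolding sublinear_functional_def by blast
  have psc: "p (\<lambda>w. c * X w) = c * p X" if "X \<in> V" "c \<ge> 0" for X c
    using p that unfolding sublinear_functional_def by blast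
  have bdd: "bdd_below ((\<lambda>t. p (\<lambda>w. X w + t * Y w) - t * p Y) ` {0..})" if X: "X \<in> V" for X
  proof (rule bdd_belowI2)
    fix t :: real assume t: "t \<in> {0..}"
    have "t * p Y = p (\<lambda>w. t * Y w)" using psc[OF Y] t by simp
    also have "\<dots> = p (\<lambda>w. (X w + t * Y w) + - X w)" by simp
    also have "\<dots> \<le> p (\<lambda>w. X w + t * Y w) + p (\<lambda>w. - X w)"
      by (intro psub add sc neg X Y)
    finally show "- p (\<lambda>w. - X w) \<le> p (\<lambda>w. X w + t * Y w) - t * p Y" by simp
  qed
  have le: "q X \<le> p (\<lambda>w. X w + t * Y w) - t * p Y" if "X \<in> V" "t \<ge> 0" for X t
    unfolding q_def using bdd[OF that(1)] that(2) by (intro cINF_lower) auto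
  show "q X \<le> p X" if "X \<in> V" for X using le[OF that, of 0] by simp
  show "q (\<lambda>w. - Y w) \<le> - p Y" 
    using le[OF neg[OF Y], of 1] psc[OF Y, of 0] by simp
  show "sublinear_functional V q" unfolding sublinear_functional_def
  proof (intro conjI ballI allI impI)
    fix X Z assume XZ: "X \<in> V" "Z \<in> V"
    have *: "q (\<lambda>w. X w + Z w) \<le> (p (\<lambda>w. X w + s * Y w) - s * p Y) + (p (\<lambda>w. Z w + t * Y w) - t * p Y)"
      if st: "s \<ge> 0" "t \<ge> 0" for s t
    proof -
      have "q (\<lambda>w. X w + Z w) \<le> p (\<lambda>w. (X w + Z w) + (s + t) * Y w) - (s + t) * p Y"
        using st XZ by (intro le add) auto
      also have "(\<lambda>w. (X w + Z w) + (s + t) * Y w) = (\<lambda>w. (X w + s * Y w) + (Z w + t * Y w))"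
        by (simp add: algebra_simps)
      also have "p \<dots> \<le> p (\<lambda>w. X w + s * Y w) + p (\<lambda>w. Z w + t * Y w)"
        by (intro psub add sc XZ Y)
      finally show ?thesis by (simp add: algebra_simps)
    qed
    have X_bound: "q (\<lambda>w. X w + Z w) - (p (\<lambda>w. Z w + t * Y w) - t * p Y) \<le> q X" if t: "t \<ge> 0" for t
      unfolding q_def[of ] using *[OF _ t] unfolding q_def by (intro cINF_greatest) (auto simp: algebra_simps)
    then have "q (\<lambda>w. X w + Z w) - q X \<le> p (\<lambda>w. Z w + t * Y w) - t * p Y" if t: "t \<ge> 0" for t
      using X_bound[OF t] by linarith
    then have "q (\<lambda>w. X w + Z w) - q X \<le> q Z"
      unfolding q_def by (intro cINF_greatest) auto
    then show "q (\<lambda>w. X w + Z w) \<le> q X + q Z" by simp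
  next
    fix X and c :: real assume X: "X \<in> V" and c: "0 \<le> c"
    show "q (\<lambda>w. c * X w) = c * q X"
    proof (cases "c = 0")
      case True
      have "p (\<lambda>w. c * X w + t * Y w) - t * p Y = 0" if "t \<in> {0..}" for t
        using True psc[OF Y] that by simp
      then have "q (\<lambda>w. c * X w) = (INF t\<in>{0::real..}. 0)" unfolding q_def by (intro INF_cong refl)
      then show ?thesis using True by simp
    next
      case False
      with c have c: "c > 0" by simp
      have up: "q (\<lambda>w. c * X w) \<le> c * q X" if X: "X \<in> V" and c: "c > 0" for X c
      proof -
        have "q (\<lambda>w. c * X w) / c \<le> p (\<lambda>w. X w + t * Y w) - t * p Y" if t: "t \<ge> 0" for t
        proof -
          have "q (\<lambda>w. c * X w) \<le> p (\<lambda>w. c * X w + (c * t) * Y w) - (c * t) * p Y"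
            using t c by (intro le sc X) auto
          also have "(\<lambda>w. c * X w + (c * t) * Y w) = (\<lambda>w. c * (X w + t * Y w))"
            by (simp add: algebra_simps)
          also have "p \<dots> = c * p (\<lambda>w. X w + t * Y w)"
            using c by (intro psc add sc X Y) auto
          finally show ?thesis using c by (simp add: field_simps)
        qed
        then have "q (\<lambda>w. c * X w) / c \<le> q X" unfolding q_def[of ] by (intro cINF_greatest) (auto simp: q_def)
        then show ?thesis using c by (simp add: field_simps)
      qed
      have "q (\<lambda>w. (1/c) * (c * X w)) \<le> (1/c) * q (\<lambda>w. c * X w)"
        using c by (intro up sc X) auto
      then have "c * q X \<le> q (\<lambda>w. c * X w)" using c by (simp add: field_simps)
      then show ?thesis using up[OF X c] by simp
    qed
  qed
qed

text \<open>
  The Hahn-Banach theorem, by Zorn's lemma for the sublinear functionals below \<open>E\<close>: a minimal one is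
  linear. Starting below the functional lowered along \<open>X0\<close> makes the bound tight at \<open>X0\<close>.
\<close>

theorem dominated_linear_functional_exists:
  assumes V: "function_subspace V" and E: "sublinear_functional V E" and X0: "X0 \<in> V"
  shows "\<exists>l. linear_functional V l \<and> (\<forall>X\<in>V. l X \<le> E X) \<and> l X0 = E X0"
proof -
  have add: "(\<lambda>w. X w + Z w) \<in> V" if "X \<in> V" "Z \<in> V" for X Z
    using V that unfolding function_subspace_def by blast
  have sc: "(\<lambda>w. c * X w) \<in> V" if "X \<in> V" for X c
    using V that unfolding function_subspace_def by blast
  have neg: "(\<lambda>w. - X w) \<in> V" if "X \<in> V" for X
    using sc[OF that, of "-1"] by simp
  obtain q where q: "sublinear_functional V q" "\<And>X. X \<in> V \<Longrightarrow> q X \<le> E X" "q (\<lambda>w. - X0 w) \<le> - E X0"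
    using directional_sublinear[OF V E X0] by blast
  \<comment> \<open>vanishing outside \<open>V\<close> makes the pointwise order antisymmetric on \<open>A\<close>\<close>
  define A where "A = {p. sublinear_functional V p \<and> (\<forall>X\<in>V. p X \<le> q X) \<and> (\<forall>X. X \<notin> V \<longrightarrow> p X = 0)}"
  define P where "P = (\<lambda>p r::('a \<Rightarrow> real) \<Rightarrow> real. \<forall>X. r X \<le> p X)"
  have "\<exists>m\<in>A. \<forall>a\<in>A. P m a \<longrightarrow> a = m"
  proof (rule predicate_Zorn)
    show "partial_order_on A (relation_of P A)"
      unfolding partial_order_on_def preorder_on_def refl_on_def trans_def antisym_def relation_of_def P_def
      by (auto simp: fun_eq_iff intro: order.trans antisym)
  next
    fix C assume C: "C \<in> Chains (relation_of P A)"
    then have CA: "C \<subseteq> A" unfolding Chains_def relation_of_def by blast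
    have ch: "P p r \<or> P r p" if "p \<in> C" "r \<in> C" for p r
      using C that unfolding Chains_def relation_of_def by blast
    show "\<exists>u\<in>A. \<forall>a\<in>C. P a u"
    proof (cases "C = {}")
      case True
      define q' where "q' = (\<lambda>X. if X \<in> V then q X else 0)"
      have "q' \<in> A" using q(1) add sc unfolding A_def q'_def sublinear_functional_def by auto
      then show ?thesis using True by auto
    next
      case False
      define u where "u = (\<lambda>X. INF p\<in>C. p X)"
      have bdd: "bdd_below ((\<lambda>p. p X) ` C)" for X
      proof (cases "X \<in> V")
        case True
        show ?thesis
        proof (rule bdd_belowI2)
          fix p assume "p \<in> C"
          then have "p \<in> A" using CA by auto
          then have "- p (\<lambda>w. - X w) \<le> p X" "p (\<lambda>w. - X w) \<le> q (\<lambda>w. - X w)"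
            using sublinear_functional_lower[OF V _ True, of p] neg[OF True] unfolding A_def by auto
          then show "- q (\<lambda>w. - X w) \<le> p X" by simp
        qed
      next
        case False
        then show ?thesis using CA unfolding A_def by (intro bdd_belowI2[of _ 0]) auto
      qed
      have le: "u X \<le> p X" if "p \<in> C" for p X
        unfolding u_def using bdd that by (intro cINF_lower) auto
      have gr: "z \<le> u X" if "\<And>p. p \<in> C \<Longrightarrow> z \<le> p X" for z X
        unfolding u_def using False that by (intro cINF_greatest) auto
      have "sublinear_functional V u" unfolding sublinear_functional_def
      proof (intro conjI ballI allI impI)
        fix X Z assume XZ: "X \<in> V" "Z \<in> V"
        have *: "u (\<lambda>w. X w + Z w) \<le> p X + r Z" if pr: "p \<in> C" "r \<in> C" for p r
        proof -
          obtain s where s: "s \<in> C" "s X \<le> p X" "s Z \<le> r Z"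
            using ch[OF pr] pr unfolding P_def by blast
          have "u (\<lambda>w. X w + Z w) \<le> s (\<lambda>w. X w + Z w)" using le s by auto
          also have "\<dots> \<le> s X + s Z" using s CA XZ unfolding A_def sublinear_functional_def by blast
          finally show ?thesis using s by simp
        qed
        have "u (\<lambda>w. X w + Z w) - r Z \<le> u X" if "r \<in> C" for r
          using *[OF _ that] by (intro gr) (auto simp: algebra_simps)
        then have "u (\<lambda>w. X w + Z w) - u X \<le> u Z"
          by (intro gr) (auto simp: algebra_simps)
        then show "u (\<lambda>w. X w + Z w) \<le> u X + u Z" by simp
      next
        fix X and c :: real assume X: "X \<in> V" and c: "0 \<le> c"
        have eq: "p (\<lambda>w. c * X w) = c * p X" if "p \<in> C" for p
          using that CA X c unfolding A_def sublinear_functional_def by blast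
        show "u (\<lambda>w. c * X w) = c * u X"
        proof (cases "c = 0")
          case True
          have z: "p (\<lambda>w. c * X w) = 0" if "p \<in> C" for p using eq[OF that] True by simp
          have "(\<lambda>p. p (\<lambda>w. c * X w)) ` C = (\<lambda>p. 0) ` C" by (rule image_cong[OF refl z])
          also have "\<dots> = {0}" using False by (simp add: image_constant_conv)
          finally show ?thesis using True unfolding u_def by simp
        next
          case nz: False
          with c have c: "c > 0" by simp
          have "c * u X \<le> u (\<lambda>w. c * X w)" using le c by (intro gr) (simp add: eq)
          moreover have "u (\<lambda>w. c * X w) / c \<le> u X"
            using eq le[of _ "\<lambda>w. c * X w"] c by (intro gr) (auto simp: field_simps)
          ultimately show ?thesis using c by (simp add: field_simps)
        qed
      qed
      moreover obtain p0 where p0: "p0 \<in> C" using False by auto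
      moreover have "u X \<le> q X" if "X \<in> V" for X
      proof -
        have "p0 \<in> A" using CA p0 by (rule subsetD)
        then have "p0 X \<le> q X" using that unfolding A_def by blast
        then show ?thesis using le[OF p0, of X] by linarith
      qed
      moreover have "u X = 0" if "X \<notin> V" for X
      proof -
        have z: "p X = 0" if "p \<in> C" for p
          using subsetD[OF CA that] \<open>X \<notin> V\<close> unfolding A_def by blast
        have "(\<lambda>p. p X) ` C = (\<lambda>p. 0) ` C" by (rule image_cong[OF refl z])
        also have "\<dots> = {0}" using False by (simp add: image_constant_conv)
        finally have "(\<lambda>p. p X) ` C = {0}" .
        then show ?thesis unfolding u_def by simp
      qed
      ultimately have "u \<in> A" unfolding A_def by blast
      then show ?thesis using le unfolding P_def by blast
    qed
  qed
  then obtain l where l: "l \<in> A" and min: "\<And>a. a \<in> A \<Longrightarrow> (\<forall>X. a X \<le> l X) \<Longrightarrow> a = l"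
    unfolding P_def by blast
  have ls: "sublinear_functional V l" and lq: "\<And>X. X \<in> V \<Longrightarrow> l X \<le> q X"
    and l0: "\<And>X. X \<notin> V \<Longrightarrow> l X = 0" using l unfolding A_def by auto
  have lsub: "l (\<lambda>w. X w + Z w) \<le> l X + l Z" if "X \<in> V" "Z \<in> V" for X Z
    using ls that unfolding sublinear_functional_def by blast
  have lsc: "l (\<lambda>w. c * X w) = c * l X" if "X \<in> V" "c \<ge> 0" for X c
    using ls that unfolding sublinear_functional_def by blast
  have lneg: "l (\<lambda>w. - Y w) = - l Y" if Y: "Y \<in> V" for Y
  proof -
    obtain r where r: "sublinear_functional V r" "\<And>X. X \<in> V \<Longrightarrow> r X \<le> l X" "r (\<lambda>w. - Y w) \<le> - l Y"
      using directional_sublinear[OF V ls Y] by blast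
    define r' where "r' = (\<lambda>X. if X \<in> V then r X else 0)"
    have "sublinear_functional V r'" using r(1) add sc unfolding r'_def sublinear_functional_def by auto
    then have "r' \<in> A" using r(2) lq l0 unfolding A_def r'_def by (auto intro: order.trans)
    then have "r' = l" using r(2) l0 by (intro min) (auto simp: r'_def)
    moreover have "r' (\<lambda>w. - Y w) = r (\<lambda>w. - Y w)" using neg[OF Y] by (simp add: r'_def)
    ultimately have "l (\<lambda>w. - Y w) \<le> - l Y" using r(3) by simp
    then show ?thesis using sublinear_functional_lower[OF V ls Y] by simp
  qed
  have "linear_functional V l" unfolding linear_functional_def
  proof (intro conjI ballI allI)
    fix X Z assume XZ: "X \<in> V" "Z \<in> V"
    have "l X = l (\<lambda>w. (X w + Z w) + - Z w)" by simp
    also have "\<dots> \<le> l (\<lambda>w. X w + Z w) + l (\<lambda>w. - Z w)" by (intro lsub add neg XZ)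
    finally show "l (\<lambda>w. X w + Z w) = l X + l Z" using lsub[OF XZ] lneg[OF XZ(2)] by simp
  next
    fix X and c :: real assume X: "X \<in> V"
    show "l (\<lambda>w. c * X w) = c * l X"
    proof (cases "c \<ge> 0")
      case True then show ?thesis using lsc X by blast
    next
      case False
      have "l (\<lambda>w. c * X w) = l (\<lambda>w. - ((-c) * X w))" by simp
      also have "\<dots> = - l (\<lambda>w. (-c) * X w)" by (intro lneg sc X)
      also have "l (\<lambda>w. (-c) * X w) = (-c) * l X" using False by (intro lsc X) auto
      finally show ?thesis by simp
    qed
  qed
  moreover have "l X \<le> E X" if "X \<in> V" for X using lq[OF that] q(2)[OF that] by simp
  moreover have "l X0 = E X0" 
    using lneg[OF X0] lq[OF neg[OF X0]] q(3) lq[OF X0] q(2)[OF X0] by simp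
  ultimately show ?thesis by blast
qed

section \<open>Product topologies are Hausdorff\<close>

text \<open>
  The product topology on a function type inherits the separation axioms from the codomain. All three
  instances are stated, in increasing strength, so that each is more general than the corresponding one
  derived from the metric on functions with countable domain.
\<close>

instance "fun" :: (type, t0_space) t0_space
proof
  fix f g :: "'a \<Rightarrow> 'b" assume "f \<noteq> g"
  then obtain x where "f x \<noteq> g x" by blast
  then obtain U where U: "open U" "\<not> (f x \<in> U \<longleftrightarrow> g x \<in> U)" using separation_t0[of "f x" "g x"] by blast
  have "open ((\<lambda>h::'a\<Rightarrow>'b. h x) -` U)"
    using U continuous_on_product_coordinates[of x] by (auto intro: open_vimage)
  then show "\<exists>U. open U \<and> \<not> (f \<in> U \<longleftrightarrow> g \<in> U)"
    using U by (intro exI[of _ "(\<lambda>h. h x) -` U"]) auto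
qed

instance "fun" :: (type, t1_space) t1_space
proof
  fix f g :: "'a \<Rightarrow> 'b" assume "f \<noteq> g"
  then obtain x where "f x \<noteq> g x" by blast
  then obtain U where U: "open U" "f x \<in> U" "g x \<notin> U" using separation_t1[of "f x" "g x"] by blast
  have "open ((\<lambda>h::'a\<Rightarrow>'b. h x) -` U)"
    using U continuous_on_product_coordinates[of x] by (auto intro: open_vimage)
  then show "\<exists>U. open U \<and> f \<in> U \<and> g \<notin> U"
    using U by (intro exI[of _ "(\<lambda>h. h x) -` U"]) auto
qed

instance "fun" :: (type, t2_space) t2_space
proof
  fix f g :: "'a \<Rightarrow> 'b" assume "f \<noteq> g"
  then obtain x where "f x \<noteq> g x" by blast
  then obtain U V where UV: "open U" "open V" "f x \<in> U" "g x \<in> V" "U \<inter> V = {}" using hausdorff by metis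
  have "open ((\<lambda>h. h x) -` U)" "open ((\<lambda>h::'a\<Rightarrow>'b. h x) -` V)"
    using UV continuous_on_product_coordinates[of x] by (auto intro: open_vimage)
  then show "\<exists>U V. open U \<and> open V \<and> f \<in> U \<and> g \<in> V \<and> U \<inter> V = {}"
    using UV by (intro exI[of _ "(\<lambda>h. h x) -` U"] exI[of _ "(\<lambda>h. h x) -` V"]) auto
qed

section \<open>Measurable selection by lexicographic maximisation\<close>

lemma compact_attains_levels:
  fixes f :: "'b::t2_space \<Rightarrow> real"
  assumes K: "compact K" and f: "continuous_on K f"
    and ne: "\<And>c. c \<in> \<rat> \<Longrightarrow> c < b \<Longrightarrow> \<exists>x\<in>K. f x \<ge> c"
  shows "\<exists>x\<in>K. f x \<ge> b"
proof -
  obtain c where "c \<in> \<rat>" "c < b" using Rats_dense_in_real[of "b - 1" b] by auto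
  then have "K \<noteq> {}" using ne by auto
  then obtain x where x: "x \<in> K" "\<And>y. y \<in> K \<Longrightarrow> f y \<le> f x"
    using continuous_attains_sup[OF K _ f] by auto
  have "b \<le> f x"
  proof (rule ccontr)
    assume "\<not> b \<le> f x"
    then obtain c where "c \<in> \<rat>" "f x < c" "c < b" using Rats_dense_in_real[of "f x" b] by auto
    with ne obtain y where "y \<in> K" "f y \<ge> c" by blast
    then show False using x(2)[of y] \<open>f x < c\<close> by simp
  qed
  then show ?thesis using x(1) by blast
qed

text \<open>
  The set of maximisers of \<open>f\<close> over \<open>K\<close>.
\<close>

definition argmax_on :: "('b \<Rightarrow> real) \<Rightarrow> 'b set \<Rightarrow> 'b set" where
  "argmax_on f K = {x\<in>K. \<forall>y\<in>K. f y \<le> f x}"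

lemma argmax_on_subset: "argmax_on f K \<subseteq> K"
  unfolding argmax_on_def by blast

lemma argmax_on_nonempty:
  fixes f :: "'b::t2_space \<Rightarrow> real"
  assumes "compact K" "K \<noteq> {}" "continuous_on K f"
  shows "argmax_on f K \<noteq> {}"
  using continuous_attains_sup[OF assms] unfolding argmax_on_def by blast

lemma compact_argmax_on:
  fixes f :: "'b::t2_space \<Rightarrow> real"
  assumes K: "compact K" and f: "continuous_on K f"
  shows "compact (argmax_on f K)"
proof -
  have "argmax_on f K = (if K = {} then {} else K \<inter> (\<Inter>y\<in>K. {x\<in>K. f y \<le> f x}))"
    unfolding argmax_on_def by auto
  moreover have "closed {x\<in>K. f y \<le> f x}" for y
    using compact_imp_closed[OF K] f by (intro closed_Collect_le continuous_on_closed_Collect_le continuous_on_const) auto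
  ultimately show ?thesis using K by (auto intro!: compact_Int_closed)
qed

text \<open>
  Whether the maximisers of \<open>f\<close> meet \<open>F\<close> is decided by countably many conditions on superlevel sets.
\<close>

lemma argmax_on_meets_iff:
  fixes f :: "'b::t2_space \<Rightarrow> real"
  assumes K: "compact K" and f: "continuous_on K f" and F: "closed F" and ne: "K \<noteq> {}"
  shows "argmax_on f K \<inter> F \<noteq> {} \<longleftrightarrow>
    (\<forall>c\<in>\<rat>. (\<exists>x\<in>K. c \<le> f x) \<longrightarrow> (\<exists>x\<in>K \<inter> F. c \<le> f x))"
proof
  assume "argmax_on f K \<inter> F \<noteq> {}"
  then show "\<forall>c\<in>\<rat>. (\<exists>x\<in>K. c \<le> f x) \<longrightarrow> (\<exists>x\<in>K \<inter> F. c \<le> f x)"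
    unfolding argmax_on_def by (auto intro: order.trans)
next
  assume *: "\<forall>c\<in>\<rat>. (\<exists>x\<in>K. c \<le> f x) \<longrightarrow> (\<exists>x\<in>K \<inter> F. c \<le> f x)"
  obtain x where x: "x \<in> K" "\<And>y. y \<in> K \<Longrightarrow> f y \<le> f x"
    using continuous_attains_sup[OF K ne f] by auto
  have "\<exists>z\<in>K \<inter> F. f x \<le> f z"
  proof (rule compact_attains_levels)
    show "compact (K \<inter> F)" using K F by (rule compact_Int_closed)
    show "continuous_on (K \<inter> F) f" using f by (rule continuous_on_subset) auto
    show "\<exists>z\<in>K \<inter> F. c \<le> f z" if "c \<in> \<rat>" "c < f x" for c
      using * that x(1) by (auto intro: less_imp_le)
  qed
  then show "argmax_on f K \<inter> F \<noteq> {}" using x unfolding argmax_on_def by (auto intro: order.trans)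
qed

text \<open>
  Measurability of a set-valued map \<open>K\<close> on \<open>I\<close>: the times at which \<open>K t\<close> meets a closed set are Borel.
\<close>

definition meets_borel :: "real set \<Rightarrow> (real \<Rightarrow> 'b::t2_space set) \<Rightarrow> bool" where
  "meets_borel I K \<longleftrightarrow> (\<forall>F. closed F \<longrightarrow> {t\<in>I. K t \<inter> F \<noteq> {}} \<in> sets borel)"

lemma meets_borel_argmax:
  fixes K :: "real \<Rightarrow> 'b::t2_space set"
  assumes I: "I \<in> sets borel"
    and K: "\<And>t. t \<in> I \<Longrightarrow> compact (K t)" "\<And>t. t \<in> I \<Longrightarrow> K t \<noteq> {}"
    and f: "\<And>t. t \<in> I \<Longrightarrow> continuous_on (K t) (f t)"
    and m: "\<And>F c. closed F \<Longrightarrow> {t\<in>I. \<exists>x\<in>K t \<inter> F. c \<le> f t x} \<in> sets borel"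
  shows "meets_borel I (\<lambda>t. argmax_on (f t) (K t))"
  unfolding meets_borel_def
proof (intro allI impI)
  fix F :: "'b set" assume F: "closed F"
  have "{t\<in>I. argmax_on (f t) (K t) \<inter> F \<noteq> {}} =
     {t\<in>I. \<forall>c\<in>\<rat>. (\<exists>x\<in>K t. c \<le> f t x) \<longrightarrow> (\<exists>x\<in>K t \<inter> F. c \<le> f t x)}"
    using argmax_on_meets_iff[OF K(1) f F K(2)] by blast
  also have "\<dots> = I \<inter> (\<Inter>c\<in>\<rat>. (I - {t\<in>I. \<exists>x\<in>K t \<inter> UNIV. c \<le> f t x}) \<union> {t\<in>I. \<exists>x\<in>K t \<inter> F. c \<le> f t x})"
    by auto
  also have "\<dots> \<in> sets borel"
    using I F m[OF closed_UNIV] m[OF F] countable_rat Rats_0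
    by (intro sets.Int sets.countable_INT' sets.Un sets.Diff image_subsetI) auto
  finally show "{t\<in>I. argmax_on (f t) (K t) \<inter> F \<noteq> {}} \<in> sets borel" .
qed

lemma compact_projection_borel:
  fixes C :: "(real \<times> 'b::t2_space) set"
  assumes "compact C"
  shows "{t. \<exists>x. (t, x) \<in> C} \<in> sets borel"
proof -
  have "{t. \<exists>x. (t, x) \<in> C} = fst ` C" by force
  moreover have "compact (fst ` C)" using assms by (intro compact_continuous_image continuous_on_fst continuous_on_id)
  ultimately show ?thesis by (simp add: borel_compact)
qed

text \<open>
  Maximise \<open>u t\<close>, then \<open>v t\<close>, then \<open>\<psi> 0\<close>, \<open>\<psi> 1\<close>, and so on. Since the \<open>\<psi> k\<close> separate points, exactly one
  point survives all stages, and by compactness it lies in a closed set iff every stage meets that set.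
\<close>

theorem measurable_lexicographic_selection:
  fixes S :: "'b::t2_space set" and u v :: "real \<Rightarrow> 'b \<Rightarrow> real" and \<psi> :: "nat \<Rightarrow> 'b \<Rightarrow> real"
  assumes S: "compact S" "S \<noteq> {}" and I: "compact I"
    and u: "continuous_on (I \<times> S) (\<lambda>(t, x). u t x)"
    and v: "continuous_on (I \<times> S) (\<lambda>(t, x). v t x)"
    and \<psi>: "\<And>k. continuous_on S (\<psi> k)"
    and sep: "\<And>x y. x \<in> S \<Longrightarrow> y \<in> S \<Longrightarrow> (\<And>k. \<psi> k x = \<psi> k y) \<Longrightarrow> x = y"
  shows "\<exists>r. (\<forall>t\<in>I. r t \<in> argmax_on (v t) (argmax_on (u t) S)) \<and>
    (\<forall>F. closed F \<longrightarrow> {t\<in>I. r t \<in> F} \<in> sets borel)"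
proof -
  define K0 where "K0 t = argmax_on (u t) S" for t
  have Ib: "I \<in> sets borel" using I by (simp add: borel_compact)
  have ut: "continuous_on S (u t)" and vt: "continuous_on S (v t)" if "t \<in> I" for t
  proof -
    have "continuous_on S ((\<lambda>(t, x). u t x) \<circ> (\<lambda>x. (t, x)))"
      using that by (intro continuous_on_compose continuous_intros continuous_on_subset[OF u]) auto
    then show "continuous_on S (u t)" by (simp add: o_def)
    have "continuous_on S ((\<lambda>(t, x). v t x) \<circ> (\<lambda>x. (t, x)))"
      using that by (intro continuous_on_compose continuous_intros continuous_on_subset[OF v]) auto
    then show "continuous_on S (v t)" by (simp add: o_def)
  qed
  have K0: "compact (K0 t)" "K0 t \<noteq> {}" "K0 t \<subseteq> S" if "t \<in> I" for t
    unfolding K0_def using compact_argmax_on[OF S(1) ut] argmax_on_nonempty[OF S ut] that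
    by (auto simp: argmax_on_def)
  have IS: "compact (I \<times> S)" using I S(1) by (rule compact_Times)
  have ISc: "closed (I \<times> S)" by (rule compact_imp_closed[OF IS])
  \<comment> \<open>the graph of the first stage is compact, so sets of times defined by it are compact projections\<close>
  have graph: "compact {p\<in>I \<times> S. snd p \<in> K0 (fst p)}"
  proof -
    have uy: "continuous_on (I \<times> S) (\<lambda>p. u (fst p) y)" if "y \<in> S" for y
    proof -
      have "continuous_on (I \<times> S) ((\<lambda>(t, x). u t x) \<circ> (\<lambda>p. (fst p, y)))"
        using that by (intro continuous_on_compose continuous_intros continuous_on_subset[OF u]) auto
      then show ?thesis by (simp add: o_def)
    qed
    have "{p\<in>I \<times> S. snd p \<in> K0 (fst p)} = (I \<times> S) \<inter> (\<Inter>y\<in>S. {p\<in>I\<times>S. u (fst p) y \<le> (\<lambda>(t, x). u t x) p})"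
      unfolding K0_def argmax_on_def by auto
    moreover have "closed {p\<in>I\<times>S. u (fst p) y \<le> (\<lambda>(t, x). u t x) p}" if "y \<in> S" for y
      by (intro continuous_on_closed_Collect_le uy that u ISc)
    ultimately show ?thesis using IS by (auto intro!: compact_Int_closed)
  qed
  have K1: "meets_borel I (\<lambda>t. argmax_on (v t) (K0 t))"
  proof (rule meets_borel_argmax[OF Ib])
    show "continuous_on (K0 t) (v t)" if "t \<in> I" for t using vt K0(3) that continuous_on_subset by blast
  next
    fix F :: "'b set" and c assume F: "closed F"
    let ?C = "{p\<in>I \<times> S. snd p \<in> K0 (fst p)} \<inter> ({p\<in>I\<times>S. c \<le> (\<lambda>(t, x). v t x) p} \<inter> UNIV \<times> F)"
    have "compact ?C"
      by (intro compact_Int_closed[OF graph] closed_Int closed_Times closed_UNIV F 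
            continuous_on_closed_Collect_le continuous_on_const v ISc)
    from compact_projection_borel[OF this]
    have "{t. \<exists>x. (t, x) \<in> ?C} \<in> sets borel" .
    also have "{t. \<exists>x. (t, x) \<in> ?C} = {t\<in>I. \<exists>x\<in>K0 t \<inter> F. c \<le> v t x}"
      using K0(3) by auto
    finally show "{t\<in>I. \<exists>x\<in>K0 t \<inter> F. c \<le> v t x} \<in> sets borel" .
  qed (use K0 in auto)
  define K where "K = rec_nat (\<lambda>t. argmax_on (v t) (K0 t)) (\<lambda>n Kn t. argmax_on (\<psi> n) (Kn t))"
  have K_0: "K 0 t = argmax_on (v t) (K0 t)" and K_Suc: "K (Suc n) t = argmax_on (\<psi> n) (K n t)" for n t
    unfolding K_def by simp_all
  have Kp: "(\<forall>t\<in>I. compact (K n t) \<and> K n t \<noteq> {} \<and> K n t \<subseteq> S) \<and> meets_borel I (K n)" for n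
  proof (induction n)
    case 0
    have c: "continuous_on (K0 t) (v t)" if "t \<in> I" for t using vt K0(3) that continuous_on_subset by blast
    have "compact (K 0 t)" "K 0 t \<noteq> {}" "K 0 t \<subseteq> S" if "t \<in> I" for t
      unfolding K_0 using compact_argmax_on[OF K0(1) c] argmax_on_nonempty[OF K0(1,2) c] that
        K0(3)[OF that] argmax_on_subset[of "v t" "K0 t"] by blast+
    then show ?case using K1 by (simp add: K_0[abs_def])
  next
    case (Suc n)
    then have n: "compact (K n t)" "K n t \<noteq> {}" "K n t \<subseteq> S" if "t \<in> I" for t using that by auto
    have c: "continuous_on (K n t) (\<psi> n)" if "t \<in> I" for t 
      using \<psi> n(3)[OF that] continuous_on_subset by blast
    have "compact (K (Suc n) t)" "K (Suc n) t \<noteq> {}" "K (Suc n) t \<subseteq> S" if "t \<in> I" for t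
      unfolding K_Suc using compact_argmax_on[OF n(1) c] argmax_on_nonempty[OF n(1,2) c] that
        n(3)[OF that] argmax_on_subset[of "\<psi> n" "K n t"] by blast+
    moreover have "meets_borel I (\<lambda>t. argmax_on (\<psi> n) (K n t))"
    proof (rule meets_borel_argmax[OF Ib n(1,2) c])
      fix F :: "'b set" and a assume F: "closed F"
      \<comment> \<open>for the functions independent of time, a superlevel set is just another closed set\<close>
    have cl: "closed (F \<inter> {x\<in>S. a \<le> \<psi> n x})" 
        by (intro closed_Int F continuous_on_closed_Collect_le continuous_on_const \<psi> compact_imp_closed S)
      have "{t\<in>I. K n t \<inter> (F \<inter> {x\<in>S. a \<le> \<psi> n x}) \<noteq> {}} \<in> sets borel"
        using Suc cl unfolding meets_borel_def by blast
      also have "{t\<in>I. K n t \<inter> (F \<inter> {x\<in>S. a \<le> \<psi> n x}) \<noteq> {}} = {t\<in>I. \<exists>x\<in>K n t \<inter> F. a \<le> \<psi> n x}"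
        using n(3) by auto
      finally show "{t\<in>I. \<exists>x\<in>K n t \<inter> F. a \<le> \<psi> n x} \<in> sets borel" .
    qed
    ultimately show ?case by (simp add: K_Suc[abs_def])
  qed
  have dec: "K n t \<subseteq> K m t" if "m \<le> n" for m n t
    using that by (induction rule: dec_induct) (auto simp: K_Suc argmax_on_def)
  have inter: "(\<forall>n. K n t \<inter> F \<noteq> {}) \<longleftrightarrow> (\<Inter>n. K n t) \<inter> F \<noteq> {}" if t: "t \<in> I" and F: "closed F" for t F
  proof
    assume *: "\<forall>n. K n t \<inter> F \<noteq> {}"
    have "S \<inter> (\<Inter>n. K n t \<inter> F) \<noteq> {}"
    proof (rule compact_imp_fip_image[OF S(1)])
      show "closed (K n t \<inter> F)" for n using Kp t F by (intro closed_Int compact_imp_closed) auto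
      fix J :: "nat set" assume "finite J" 
      let ?m = "Max (insert 0 J)"
      have "K ?m t \<subseteq> K n t" if "n \<in> J" for n
        using that \<open>finite J\<close> by (intro dec Max_ge) auto
      moreover have "K ?m t \<subseteq> S" using Kp[of ?m] t by blast
      ultimately have "K ?m t \<inter> F \<subseteq> S \<inter> (\<Inter>n\<in>J. K n t \<inter> F)" by blast
      then show "S \<inter> (\<Inter>n\<in>J. K n t \<inter> F) \<noteq> {}" using * by blast
    qed
    then show "(\<Inter>n. K n t) \<inter> F \<noteq> {}" by blast
  qed blast
  define r where "r t = (SOME x. x \<in> (\<Inter>n. K n t))" for t
  have r: "r t \<in> (\<Inter>n. K n t)" if "t \<in> I" for t
  proof -
    have "(\<Inter>n. K n t) \<noteq> {}" using inter[OF that closed_UNIV] Kp that by simp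
    then show ?thesis unfolding r_def by (simp only: some_in_eq not_False_eq_True)
  qed
  have uniq: "x = r t" if t: "t \<in> I" and x: "x \<in> (\<Inter>n. K n t)" for x t
  proof (rule sep)
    show "x \<in> S" "r t \<in> S" using x r[OF t] Kp[of 0] t by blast+
    fix k
    have "x \<in> K (Suc k) t" "r t \<in> K (Suc k) t" using x r[OF t] by blast+
    then show "\<psi> k x = \<psi> k (r t)" unfolding K_Suc argmax_on_def by (auto intro: antisym)
  qed
  show ?thesis
  proof (intro exI conjI ballI allI impI)
    fix t assume "t \<in> I"
    then show "r t \<in> argmax_on (v t) (argmax_on (u t) S)" using r[of t] K_0 K0_def by auto
  next
    fix F :: "'b set" assume F: "closed F"
    have memb: "r t \<in> F \<longleftrightarrow> (\<forall>n. K n t \<inter> F \<noteq> {})" if "t \<in> I" for t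
      unfolding inter[OF that F] using r[OF that] uniq[OF that] by blast
    have "{t\<in>I. r t \<in> F} = {t\<in>I. \<forall>n. K n t \<inter> F \<noteq> {}}"
      by (intro Collect_cong conj_cong refl memb)
    also have "\<dots> = (\<Inter>n. {t\<in>I. K n t \<inter> F \<noteq> {}})" by blast
    also have "\<dots> \<in> sets borel" using Kp F unfolding meets_borel_def by (intro sets.countable_INT'' ) auto
    finally show "{t\<in>I. r t \<in> F} \<in> sets borel" .
  qed
qed

section \<open>The Daniell construction\<close>

text \<open>
  A positive normalised linear functional \<open>l\<close> on a lattice algebra \<open>L\<close> of bounded functions, where order
  and limits are those of the restrictions to \<open>\<Omega>\<close>; the last assumption is continuity along decreasing
  sequences.
\<close>

locale daniell =
  fixes \<Omega> :: "'a set" and L :: "('a \<Rightarrow> real) set" and l :: "('a \<Rightarrow> real) \<Rightarrow> real"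
  assumes const: "(\<lambda>_. c) \<in> L"
    and add: "X \<in> L \<Longrightarrow> Y \<in> L \<Longrightarrow> (\<lambda>w. X w + Y w) \<in> L"
    and mult: "X \<in> L \<Longrightarrow> Y \<in> L \<Longrightarrow> (\<lambda>w. X w * Y w) \<in> L"
    and min: "X \<in> L \<Longrightarrow> Y \<in> L \<Longrightarrow> (\<lambda>w. min (X w) (Y w)) \<in> L"
    and bounded: "X \<in> L \<Longrightarrow> \<exists>K. \<forall>w\<in>\<Omega>. \<bar>X w\<bar> \<le> K"
    and l_add: "X \<in> L \<Longrightarrow> Y \<in> L \<Longrightarrow> l (\<lambda>w. X w + Y w) = l X + l Y"
    and l_scale: "X \<in> L \<Longrightarrow> l (\<lambda>w. c * X w) = c * l X"
    and l_one: "l (\<lambda>_. 1) = 1"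
    and l_mono: "X \<in> L \<Longrightarrow> Y \<in> L \<Longrightarrow> (\<And>w. w \<in> \<Omega> \<Longrightarrow> X w \<le> Y w) \<Longrightarrow> l X \<le> l Y"
    and l_cont: "\<And>X :: nat \<Rightarrow> 'a \<Rightarrow> real. (\<And>n. X n \<in> L) \<Longrightarrow> (\<And>w. w \<in> \<Omega> \<Longrightarrow> decseq (\<lambda>n. X n w)) \<Longrightarrow>
       (\<And>w. w \<in> \<Omega> \<Longrightarrow> (\<lambda>n. X n w) \<longlonglongrightarrow> 0) \<Longrightarrow> (\<lambda>n. l (X n)) \<longlonglongrightarrow> 0"
begin

lemma scale: "X \<in> L \<Longrightarrow> (\<lambda>w. c * X w) \<in> L"
  using mult[OF const] by auto

lemma diff: "X \<in> L \<Longrightarrow> Y \<in> L \<Longrightarrow> (\<lambda>w. X w - Y w) \<in> L"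
  using add[OF _ scale[of Y "-1"]] by auto

lemma l_diff: "X \<in> L \<Longrightarrow> Y \<in> L \<Longrightarrow> l (\<lambda>w. X w - Y w) = l X - l Y"
  using l_add[OF _ scale[of Y "-1"], of X] l_scale[of Y "-1"] by simp

lemma max: "X \<in> L \<Longrightarrow> Y \<in> L \<Longrightarrow> (\<lambda>w. max (X w) (Y w)) \<in> L"
  using diff[OF add min, of X Y X Y] by (simp add: max_def min_def if_distrib cong: if_cong)

lemma sum: "(\<And>i. i \<in> A \<Longrightarrow> X i \<in> L) \<Longrightarrow> (\<lambda>w. \<Sum>i\<in>A. X i w) \<in> L"
  by (induction A rule: infinite_finite_induct) (auto intro: const add)

lemma l_zero: "l (\<lambda>_. 0) = 0"
  using l_scale[OF const, of 0 0] by simp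

lemma l_const: "l (\<lambda>_. c) = c"
  using l_scale[OF const, of c 1] l_one by simp

lemma l_sum: "(\<And>i. i \<in> A \<Longrightarrow> X i \<in> L) \<Longrightarrow> l (\<lambda>w. \<Sum>i\<in>A. X i w) = (\<Sum>i\<in>A. l (X i))"
  by (induction A rule: infinite_finite_induct) (auto simp: l_zero l_add sum)

lemma l_nonneg: "X \<in> L \<Longrightarrow> (\<And>w. w \<in> \<Omega> \<Longrightarrow> 0 \<le> X w) \<Longrightarrow> 0 \<le> l X"
  using l_mono[OF const, of X 0] l_zero by simp

text \<open>
  Countable covers of \<open>A\<close> by nonnegative functions of \<open>L\<close>, and the outer measure that they induce.
\<close>

definition cover :: "'a set \<Rightarrow> (nat \<Rightarrow> 'a \<Rightarrow> real) set" where
  "cover A = {X. (\<forall>n. X n \<in> L) \<and> (\<forall>n. \<forall>w\<in>\<Omega>. 0 \<le> X n w) \<and>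
     (\<forall>w\<in>A. 1 \<le> (\<Sum>n. ennreal (X n w)))}"

definition outer :: "'a set \<Rightarrow> ennreal" where
  "outer A = (INF X\<in>cover A. \<Sum>n. ennreal (l (X n)))"

lemma outer_le: "X \<in> cover A \<Longrightarrow> outer A \<le> (\<Sum>n. ennreal (l (X n)))"
  unfolding outer_def by (rule INF_lower)

lemma outer_le_single:
  assumes X: "X \<in> L" "\<And>w. w \<in> \<Omega> \<Longrightarrow> 0 \<le> X w" "\<And>w. w \<in> A \<Longrightarrow> 1 \<le> X w"
  shows "outer A \<le> ennreal (l X)"
proof -
  define Y where "Y n = (if n = (0::nat) then X else (\<lambda>_. 0))" for n
  have s: "(\<Sum>n. ennreal (Y n w)) = ennreal (X w)" for w
    by (subst suminf_offset[of _ 1]) (auto simp: Y_def)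
  have "Y \<in> cover A" unfolding cover_def using X s by (auto simp: Y_def const)
  then have "outer A \<le> (\<Sum>n. ennreal (l (Y n)))" by (rule outer_le)
  also have "\<dots> = ennreal (l X)" by (subst suminf_offset[of _ 1]) (auto simp: Y_def l_zero)
  finally show ?thesis .
qed

lemma outer_approx:
  assumes "0 < e" "A \<subseteq> \<Omega>"
  obtains X where "X \<in> cover A" "(\<Sum>n. ennreal (l (X n))) < outer A + ennreal e"
proof -
  have "outer A \<le> ennreal (l (\<lambda>_. 1))" by (rule outer_le_single) (auto simp: const)
  then have "outer A \<noteq> \<infinity>" by (auto simp: top_unique)
  from INF_approx_ennreal[OF assms(1) outer_def this] that show ?thesis by blast
qed

lemma outer_double_sequence:
  assumes X: "\<And>i n. X i n \<in> L" "\<And>i n w. w \<in> \<Omega> \<Longrightarrow> 0 \<le> X i n w"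
    and A: "\<And>w. w \<in> A \<Longrightarrow> 1 \<le> (\<Sum>i. \<Sum>n. ennreal (X i n w))"
  shows "outer A \<le> (\<Sum>i. \<Sum>n. ennreal (l (X i n)))"
proof -
  define Y where "Y k = (case prod_decode k of (i, n) \<Rightarrow> X i n)" for k
  have "(\<Sum>k. ennreal (Y k w)) = (\<Sum>i. \<Sum>n. ennreal (X i n w))" for w
    using suminf_ennreal_2dimen[of "\<lambda>i. \<Sum>n. ennreal (X i n w)" "\<lambda>(i, n). ennreal (X i n w)"]
    by (simp add: Y_def split_beta)
  then have "Y \<in> cover A" unfolding cover_def using X A by (auto simp: Y_def split: prod.split)
  moreover have "(\<Sum>k. ennreal (l (Y k))) = (\<Sum>i. \<Sum>n. ennreal (l (X i n)))"
    using suminf_ennreal_2dimen[of "\<lambda>i. \<Sum>n. ennreal (l (X i n))" "\<lambda>(i, n). ennreal (l (X i n))"]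
    by (simp add: Y_def split_beta)
  ultimately show ?thesis using outer_le by metis
qed

lemma suminf_geometric_ennreal:
  assumes "0 \<le> e"
  shows "(\<Sum>n. ennreal (e * (1/2) ^ Suc n)) = ennreal e"
proof -
  have "(\<Sum>n. ennreal (e * (1/2) ^ Suc n)) = (\<Sum>n. ennreal e * ennreal ((1/2) ^ Suc n))"
    using assms by (intro suminf_cong ennreal_mult) auto
  also have "\<dots> = ennreal e * (\<Sum>n. ennreal ((1/2) ^ Suc n))" by (rule ennreal_suminf_cmult)
  also have "(\<Sum>n. ennreal ((1/2) ^ Suc n)) = 1"
    by (rule trans[OF suminf_ennreal_eq[OF _ power_half_series]]) auto
  finally show ?thesis by simp
qed

lemma outer_measure_space_outer: "outer_measure_space (Pow \<Omega>) outer"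
proof -
  have "outer {} \<le> ennreal (l (\<lambda>_. 0))" by (rule outer_le_single) (auto simp: const)
  then have "positive (Pow \<Omega>) outer" by (simp add: positive_def l_zero)
  moreover have "increasing (Pow \<Omega>) outer"
    unfolding increasing_def outer_def by (auto intro!: INF_superset_mono simp: cover_def)
  moreover have "countably_subadditive (Pow \<Omega>) outer"
    unfolding countably_subadditive_def
  proof safe
    fix A :: "nat \<Rightarrow> 'a set" assume A: "range A \<subseteq> Pow \<Omega>"
    show "outer (\<Union>i. A i) \<le> (\<Sum>i. outer (A i))"
    proof (rule ennreal_le_epsilon)
      fix e :: real assume e: "0 < e"
      have "\<exists>X. X \<in> cover (A i) \<and> (\<Sum>n. ennreal (l (X n))) < outer (A i) + ennreal (e * (1/2) ^ Suc i)" for i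
        using outer_approx[of "e * (1/2) ^ Suc i" "A i"] e A by fastforce
      then obtain X where X: "\<And>i. X i \<in> cover (A i)"
        "\<And>i. (\<Sum>n. ennreal (l (X i n))) < outer (A i) + ennreal (e * (1/2) ^ Suc i)" by metis
      have "outer (\<Union>i. A i) \<le> (\<Sum>i. \<Sum>n. ennreal (l (X i n)))"
      proof (rule outer_double_sequence)
        fix w assume "w \<in> (\<Union>i. A i)"
        then obtain i where "w \<in> A i" by blast
        then have "1 \<le> (\<Sum>n. ennreal (X i n w))" using X(1)[of i] unfolding cover_def by blast
        also have "\<dots> = (\<Sum>j\<in>{i}. \<Sum>n. ennreal (X j n w))" by simp
        also have "\<dots> \<le> (\<Sum>i. \<Sum>n. ennreal (X i n w))" by (rule sum_le_suminf) auto
        finally show "1 \<le> (\<Sum>i. \<Sum>n. ennreal (X i n w))" .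
      qed (use X(1) in \<open>auto simp: cover_def\<close>)
      also have "\<dots> \<le> (\<Sum>i. outer (A i) + ennreal (e * (1/2) ^ Suc i))"
        using X(2) by (intro suminf_le) (auto intro: less_imp_le)
      also have "\<dots> = (\<Sum>i. outer (A i)) + ennreal e"
        using e by (subst suminf_add[symmetric]) (auto simp only: suminf_geometric_ennreal summableI)
      finally show "outer (\<Union>i. A i) \<le> (\<Sum>i. outer (A i)) + ennreal e" .
    qed
  qed
  ultimately show ?thesis unfolding outer_measure_space_def by blast
qed

text \<open>
  Functions of \<open>L\<close> increasing to the indicator of \<open>{X > 0}\<close>.
\<close>

definition ramp :: "nat \<Rightarrow> ('a \<Rightarrow> real) \<Rightarrow> 'a \<Rightarrow> real" where
  "ramp k X w = max 0 (min 1 (real k * X w))"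

lemma ramp_in: "X \<in> L \<Longrightarrow> ramp k X \<in> L"
  unfolding ramp_def[abs_def] by (intro max min const scale)

lemma ramp_bounds: "0 \<le> ramp k X w" "ramp k X w \<le> 1" unfolding ramp_def by auto

lemma ramp_0: "ramp 0 X w = 0" by (simp add: ramp_def)

lemma ramp_mono: "ramp k X w \<le> ramp (Suc k) X w"
proof (cases "X w \<ge> 0")
  case True
  then have "real k * X w \<le> real (Suc k) * X w" by (intro mult_right_mono) auto
  then show ?thesis unfolding ramp_def by linarith
next
  case False
  then show ?thesis using mult_nonneg_nonpos[of "real k" "X w"] by (simp add: ramp_def)
qed

lemma ramp_nonpos: "X w \<le> 0 \<Longrightarrow> ramp k X w = 0"
  using mult_nonneg_nonpos[of "real k" "X w"] by (simp add: ramp_def)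

lemma ramp_tendsto: "X w > 0 \<Longrightarrow> (\<lambda>k. ramp k X w) \<longlonglongrightarrow> 1"
proof -
  assume p: "X w > 0"
  obtain N :: nat where N: "1 < real N * X w" using reals_Archimedean3[OF p] by blast
  have "ramp k X w = 1" if "k \<ge> N" for k
  proof -
    have "real N * X w \<le> real k * X w" using that p by (intro mult_right_mono) auto
    with N show ?thesis unfolding ramp_def by simp
  qed
  then show ?thesis by (intro tendsto_eventually eventually_sequentiallyI)
qed

text \<open>
  The sets \<open>{X > 0}\<close> are measurable in the sense of Caratheodory. A cover \<open>Z\<close> of \<open>A\<close> is split by the ramps
  \<open>h\<close> of \<open>X\<close>: the increments \<open>Z n * (h (k + 1) - h k)\<close> cover the part inside the set, and
  \<open>Z n * (1 - h (m n))\<close>, with \<open>m n\<close> so large that little of the cover is counted twice, the part outside.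
\<close>

lemma lambda_system_positive_set:
  assumes X: "X \<in> L"
  shows "{w\<in>\<Omega>. 0 < X w} \<in> lambda_system \<Omega> (Pow \<Omega>) outer"
proof -
  let ?G = "{w\<in>\<Omega>. 0 < X w}"
  have up: "outer (?G \<inter> A) + outer ((\<Omega> - ?G) \<inter> A) \<le> outer A" if A: "A \<subseteq> \<Omega>" for A
  proof (rule ennreal_le_epsilon)
    fix e :: real assume e: "0 < e"
    obtain Z where Z: "Z \<in> cover A" and Zl: "(\<Sum>n. ennreal (l (Z n))) < outer A + ennreal (e/2)"
      using outer_approx[OF _ A, of "e/2"] e by auto
    have ZL: "Z n \<in> L" and Z0: "w \<in> \<Omega> \<Longrightarrow> 0 \<le> Z n w" for n w using Z unfolding cover_def by auto
    have Z1: "w \<in> A \<Longrightarrow> 1 \<le> (\<Sum>n. ennreal (Z n w))" for w using Z unfolding cover_def by auto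
    define g where "g k w = ramp (Suc k) X w - ramp k X w" for k w
    have gL: "g k \<in> L" for k unfolding g_def[abs_def] by (intro diff ramp_in X)
    have g0: "0 \<le> g k w" for k w unfolding g_def using ramp_mono[of k X w] by simp
    have ZgL: "(\<lambda>w. Z n w * g k w) \<in> L" for n k by (intro mult ZL gL)
    have Zg0: "0 \<le> l (\<lambda>w. Z n w * g k w)" for n k
      using Z0 g0 by (intro l_nonneg ZgL) auto
    have sg: "(\<Sum>k<m. g k w) = ramp m X w" for m w
      unfolding g_def using sum_lessThan_telescope[of "\<lambda>k. ramp k X w" m] by (simp add: ramp_0)
    have lsum: "(\<Sum>k<m. l (\<lambda>w. Z n w * g k w)) = l (\<lambda>w. Z n w * ramp m X w)" for m n
      by (subst l_sum[OF ZgL, symmetric]) (simp add: sum_distrib_left[symmetric] sg)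
    have lub: "l (\<lambda>w. Z n w * ramp m X w) \<le> l (Z n)" for m n
      using Z0 ramp_bounds by (intro l_mono mult ZL ramp_in X) (auto intro: mult_left_le)
    have summ: "summable (\<lambda>k. l (\<lambda>w. Z n w * g k w))" for n
      using lub Zg0 by (intro summableI_nonneg_bounded[where x="l (Z n)"]) (auto simp: lsum)
    have "\<exists>m. (\<Sum>k. l (\<lambda>w. Z n w * g k w)) < l (\<lambda>w. Z n w * ramp m X w) + (e/2) * (1/2) ^ Suc n" for n
    proof -
      let ?S = "\<Sum>k. l (\<lambda>w. Z n w * g k w)"
      have "(\<lambda>m. \<Sum>k<m. l (\<lambda>w. Z n w * g k w)) \<longlonglongrightarrow> ?S" by (rule summable_LIMSEQ[OF summ])
      moreover have "?S - (e/2) * (1/2) ^ Suc n < ?S" using e by simp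
      ultimately have "eventually (\<lambda>m. ?S - (e/2) * (1/2) ^ Suc n < (\<Sum>k<m. l (\<lambda>w. Z n w * g k w))) sequentially"
        by (rule order_tendstoD(1))
      then obtain m where "?S - (e/2) * (1/2) ^ Suc n < (\<Sum>k<m. l (\<lambda>w. Z n w * g k w))"
        using eventually_happens by fastforce
      then show ?thesis unfolding lsum by (intro exI[of _ m]) simp
    qed
    then obtain m where m: "\<And>n. (\<Sum>k. l (\<lambda>w. Z n w * g k w)) < l (\<lambda>w. Z n w * ramp (m n) X w) + (e/2) * (1/2) ^ Suc n"
      by metis
    have "outer (?G \<inter> A) \<le> (\<Sum>n. \<Sum>k. ennreal (l (\<lambda>w. Z n w * g k w)))"
    proof (rule outer_double_sequence[OF ZgL])
      show "0 \<le> Z n w * g k w" if "w \<in> \<Omega>" for n k w using that Z0 g0 by simp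
      fix w assume w: "w \<in> ?G \<inter> A"
      have "(\<lambda>k. g k w) sums 1" unfolding sums_def sg using w by (intro ramp_tendsto) auto
      then have "(\<lambda>k. Z n w * g k w) sums Z n w" for n using sums_mult[of "\<lambda>k. g k w" 1 "Z n w"] by simp
      then have "(\<Sum>k. ennreal (Z n w * g k w)) = ennreal (Z n w)" for n
        using Z0 g0 w by (intro suminf_ennreal_eq) auto
      then show "1 \<le> (\<Sum>n. \<Sum>k. ennreal (Z n w * g k w))" using Z1 w by simp
    qed
    moreover have "outer ((\<Omega> - ?G) \<inter> A) \<le> (\<Sum>n. ennreal (l (\<lambda>w. Z n w - Z n w * ramp (m n) X w)))"
    proof (rule outer_le)
      show "(\<lambda>n w. Z n w - Z n w * ramp (m n) X w) \<in> cover ((\<Omega> - ?G) \<inter> A)"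
        unfolding cover_def using Z1 Z0 ramp_bounds
        by (auto intro!: diff mult ZL ramp_in X mult_left_le simp: ramp_nonpos not_less)
    qed
    ultimately have "outer (?G \<inter> A) + outer ((\<Omega> - ?G) \<inter> A) \<le>
      (\<Sum>n. (\<Sum>k. ennreal (l (\<lambda>w. Z n w * g k w))) + ennreal (l (\<lambda>w. Z n w - Z n w * ramp (m n) X w)))"
      by (subst suminf_add[symmetric]) (auto intro!: add_mono)
    also have "\<dots> \<le> (\<Sum>n. ennreal (l (Z n)) + ennreal ((e/2) * (1/2) ^ Suc n))"
    proof (intro suminf_le summableI)
      fix n
      have "(\<Sum>k. ennreal (l (\<lambda>w. Z n w * g k w))) = ennreal (\<Sum>k. l (\<lambda>w. Z n w * g k w))"
        by (rule suminf_ennreal2[OF Zg0 summ])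
      moreover have "l (\<lambda>w. Z n w - Z n w * ramp (m n) X w) = l (Z n) - l (\<lambda>w. Z n w * ramp (m n) X w)"
        by (intro l_diff mult ZL ramp_in X)
      moreover have "0 \<le> (\<Sum>k. l (\<lambda>w. Z n w * g k w))" using Zg0 summ by (intro suminf_nonneg) auto
      moreover have "0 \<le> l (Z n)" using Z0 by (intro l_nonneg ZL)
      ultimately show "(\<Sum>k. ennreal (l (\<lambda>w. Z n w * g k w))) + ennreal (l (\<lambda>w. Z n w - Z n w * ramp (m n) X w))
         \<le> ennreal (l (Z n)) + ennreal ((e/2) * (1/2) ^ Suc n)"
        using m[of n] lub[of n "m n"] e by (simp add: ennreal_plus[symmetric] del: ennreal_plus)
    qed
    also have "\<dots> = (\<Sum>n. ennreal (l (Z n))) + ennreal (e/2)"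
      using e by (subst suminf_add[symmetric]) (auto simp only: suminf_geometric_ennreal summableI half_gt_zero less_imp_le)
    also have "\<dots> \<le> outer A + ennreal (e/2) + ennreal (e/2)"
      using Zl by (intro add_right_mono) simp
    also have "\<dots> = outer A + ennreal e"
      using e by (simp add: add.assoc ennreal_plus[symmetric] del: ennreal_plus)
    finally show "outer (?G \<inter> A) + outer ((\<Omega> - ?G) \<inter> A) \<le> outer A + ennreal e" .
  qed
  interpret sigma_algebra \<Omega> "Pow \<Omega>" by (rule sigma_algebra_Pow)
  have "subadditive (Pow \<Omega>) outer"
    using outer_measure_space_outer unfolding outer_measure_space_def
    by (intro countably_subadditive_subadditive) auto
  then have "outer A \<le> outer (?G \<inter> A) + outer ((\<Omega> - ?G) \<inter> A)" if "A \<subseteq> \<Omega>" for A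
  proof -
    have "outer ((?G \<inter> A) \<union> ((\<Omega> - ?G) \<inter> A)) \<le> outer (?G \<inter> A) + outer ((\<Omega> - ?G) \<inter> A)"
      by (rule subadditiveD[OF \<open>subadditive (Pow \<Omega>) outer\<close>]) auto
    moreover have "(?G \<inter> A) \<union> ((\<Omega> - ?G) \<inter> A) = A" using that by blast
    ultimately show ?thesis by simp
  qed
  then show ?thesis unfolding lambda_system_def using up by (auto intro!: antisym)
qed

text \<open>
  The one place where continuity of \<open>l\<close> along decreasing sequences is used.
\<close>

lemma outer_space: "outer \<Omega> = 1"
proof (rule antisym)
  have "outer \<Omega> \<le> ennreal (l (\<lambda>_. 1))" by (rule outer_le_single) (auto simp: const)
  then show "outer \<Omega> \<le> 1" by (simp add: l_one)
  show "1 \<le> outer \<Omega>" unfolding outer_def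
  proof (rule INF_greatest)
    fix X assume X: "X \<in> cover \<Omega>"
    then have XL: "X n \<in> L" and X0: "w \<in> \<Omega> \<Longrightarrow> 0 \<le> X n w" and X1: "w \<in> \<Omega> \<Longrightarrow> 1 \<le> (\<Sum>n. ennreal (X n w))" for n w
      unfolding cover_def by auto
    define Y where "Y m w = max 0 (1 - (\<Sum>n<m. X n w))" for m w
    have YL: "Y m \<in> L" for m unfolding Y_def[abs_def] by (intro max const diff sum XL)
    have "(\<lambda>m. l (Y m)) \<longlonglongrightarrow> 0"
    proof (rule l_cont[OF YL])
      fix w assume w: "w \<in> \<Omega>"
      show "decseq (\<lambda>m. Y m w)"
      proof (rule decseq_SucI)
        show "Y (Suc m) w \<le> Y m w" for m using X0[OF w, of m] by (simp add: Y_def max_def)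
      qed
      show "(\<lambda>m. Y m w) \<longlonglongrightarrow> 0"
      proof (rule LIMSEQ_I)
        fix r :: real assume r: "0 < r"
        have "(\<lambda>m. \<Sum>n<m. ennreal (X n w)) \<longlonglongrightarrow> (\<Sum>n. ennreal (X n w))" by (intro summable_LIMSEQ summableI)
        moreover have "ennreal (1 - r) < (\<Sum>n. ennreal (X n w))"
          by (rule less_le_trans[OF _ X1[OF w]]) (use r in \<open>simp add: ennreal_less_one_iff\<close>)
        ultimately have "eventually (\<lambda>m. ennreal (1 - r) < (\<Sum>n<m. ennreal (X n w))) sequentially"
          by (rule order_tendstoD(1))
        then obtain N where N: "\<And>m. m \<ge> N \<Longrightarrow> ennreal (1 - r) < (\<Sum>n<m. ennreal (X n w))"
          unfolding eventually_sequentially by blast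
        have "norm (Y m w - 0) < r" if "m \<ge> N" for m
        proof -
          have "(\<Sum>n<m. ennreal (X n w)) = ennreal (\<Sum>n<m. X n w)" using X0[OF w] by (intro sum_ennreal) auto
          then have "1 - r < (\<Sum>n<m. X n w)" using N[OF that] sum_nonneg[of "{..<m}" "\<lambda>n. X n w"] X0[OF w]
            by (cases "1 - r < 0") (auto simp: ennreal_less_iff not_less)
          then show ?thesis using r unfolding Y_def by auto
        qed
        then show "\<exists>N. \<forall>m\<ge>N. norm (Y m w - 0) < r" by blast
      qed
    qed
    then have "(\<lambda>m. 1 - l (Y m)) \<longlonglongrightarrow> 1 - 0" by (intro tendsto_intros)
    then have lim: "(\<lambda>m. ennreal (1 - l (Y m))) \<longlonglongrightarrow> 1" by (auto dest: tendsto_ennrealI simp: ennreal_1[symmetric] simp del: ennreal_1)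
    show "1 \<le> (\<Sum>n. ennreal (l (X n)))"
    proof (rule LIMSEQ_le_const2[OF lim], intro exI allI impI)
      fix m
      have "1 = l (\<lambda>_. 1)" using l_one by simp
      also have "\<dots> \<le> l (\<lambda>w. (\<Sum>n<m. X n w) + Y m w)"
        by (intro l_mono const add sum XL YL) (auto simp: Y_def)
      also have "\<dots> = (\<Sum>n<m. l (X n)) + l (Y m)" by (subst l_add) (auto intro: sum XL YL simp: l_sum XL)
      finally have "1 - l (Y m) \<le> (\<Sum>n<m. l (X n))" by simp
      then have "ennreal (1 - l (Y m)) \<le> ennreal (\<Sum>n<m. l (X n))" by (rule ennreal_leI)
      also have "\<dots> = (\<Sum>n<m. ennreal (l (X n)))" using l_nonneg[OF XL X0] by (intro sum_ennreal[symmetric]) auto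
      also have "\<dots> \<le> (\<Sum>n. ennreal (l (X n)))" by (rule sum_le_suminf) auto
      finally show "ennreal (1 - l (Y m)) \<le> (\<Sum>n. ennreal (l (X n)))" .
    qed
  qed
qed

theorem representing_measure:
  "\<exists>P. prob_space P \<and> space P = \<Omega> \<and>
    (\<forall>X\<in>L. X \<in> borel_measurable P \<and> (\<integral>w. X w \<partial>P) = l X)"
proof -
  interpret sigma_algebra \<Omega> "Pow \<Omega>" by (rule sigma_algebra_Pow)
  let ?S = "lambda_system \<Omega> (Pow \<Omega>) outer"
  have ms: "measure_space \<Omega> ?S outer" by (rule caratheodory_lemma[OF outer_measure_space_outer])
  define P where "P = measure_of \<Omega> ?S outer"
  have S: "?S \<subseteq> Pow \<Omega>" by (auto simp: lambda_system_def)
  have sa: "sigma_algebra \<Omega> ?S" using ms by (simp add: measure_space_def)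
  have sets: "sets P = ?S" unfolding P_def using sigma_algebra.sets_measure_of_eq[OF sa] .
  have space: "space P = \<Omega>" unfolding P_def using S by (rule space_measure_of)
  have em: "emeasure P A = outer A" if "A \<in> sets P" for A
    using that ms by (intro emeasure_measure_of[OF P_def S]) (auto simp: sets measure_space_def)
  have ps: "prob_space P"
    using em[of \<Omega>] outer_space space sets.top[of P] by (intro prob_spaceI) simp
  interpret P: prob_space P by (rule ps)
  have meas: "X \<in> borel_measurable P" if X: "X \<in> L" for X
  proof (rule borel_measurableI_greater)
    fix y
    have "{w\<in>\<Omega>. 0 < X w - y} \<in> sets P"
      unfolding sets by (rule lambda_system_positive_set) (intro diff X const)
    then show "{w \<in> space P. y < X w} \<in> sets P" by (simp add: space)
  qed
  have int: "integrable P X" if X: "X \<in> L" for X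
  proof -
    obtain K where "\<forall>w\<in>\<Omega>. \<bar>X w\<bar> \<le> K" using bounded[OF X] by blast
    then show ?thesis using meas[OF X] space by (intro P.integrable_const_bound[where B=K]) auto
  qed
  \<comment> \<open>layer cake: \<open>N X\<close> is a sum of unit ramps \<open>Y j\<close>, each dominating the indicator of \<open>{N X \<ge> j + 1}\<close>\<close>
  have le: "(\<integral>w. X w \<partial>P) \<le> l X" if X: "X \<in> L" and b: "\<And>w. w \<in> \<Omega> \<Longrightarrow> 0 \<le> X w \<and> X w \<le> 1" for X
  proof (rule field_le_epsilon)
    fix e :: real assume e: "0 < e"
    obtain N :: nat where N: "N > 0" "1 / real N < e"
      using e by (metis nat_approx_posE zero_less_Suc)
    define Y where "Y j w = max 0 (min 1 (real N * X w - real j))" for j :: nat and w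
    have YL: "Y j \<in> L" for j unfolding Y_def[abs_def] by (intro max min const diff scale X)
    define A where "A j = {w\<in>\<Omega>. real j + 1 \<le> real N * X w}" for j :: nat
    have As: "A j \<in> sets P" for j
    proof -
      have "{w\<in>space P. (real j + 1) / real N \<le> X w} \<in> sets P" using meas[OF X] by measurable
      then show ?thesis using N by (simp add: A_def space field_simps)
    qed
    have PA: "measure P (A j) \<le> l (Y j)" for j
    proof -
      have "outer (A j) \<le> ennreal (l (Y j))"
        by (rule outer_le_single[OF YL]) (auto simp: Y_def A_def)
      then have "ennreal (measure P (A j)) \<le> ennreal (l (Y j))" using em[OF As] P.emeasure_eq_measure by simp
      moreover have "0 \<le> l (Y j)" by (rule l_nonneg[OF YL]) (auto simp: Y_def)
      ultimately show ?thesis by simp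
    qed
    have sumY: "(\<Sum>j<n. max 0 (min 1 (x - real j))) = min x (real n)" if "0 \<le> x" for n :: nat and x :: real
      using that by (induction n) (auto simp: min_def max_def)
    have sumA: "x \<le> 1 + (\<Sum>j<n. if real j + 1 \<le> x then 1 else 0)" if "x \<le> real n" for n :: nat and x :: real
      using that
    proof (induction n arbitrary: x)
      case (Suc n)
      show ?case
      proof (cases "x \<le> real n")
        case True
        then show ?thesis using Suc.IH[OF True] by auto
      next
        case False
        then have "(\<Sum>j<n. if real j + 1 \<le> x then 1 else 0::real) = (\<Sum>j<n. 1)"
          by (intro sum.cong) auto
        then show ?thesis using False Suc.prems by (cases "real n + 1 \<le> x") auto
      qed
    qed auto
    have "real N * (\<integral>w. X w \<partial>P) = (\<integral>w. real N * X w \<partial>P)" by simp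
    also have "\<dots> \<le> (\<integral>w. 1 + (\<Sum>j<N. indicator (A j) w) \<partial>P)"
    proof (rule integral_mono)
      show "integrable P (\<lambda>w. 1 + (\<Sum>j<N. indicator (A j) w :: real))"
        using As by (intro Bochner_Integration.integrable_add Bochner_Integration.integrable_sum P.integrable_const)
           (auto simp: P.emeasure_eq_measure)
      fix w assume w: "w \<in> space P"
      have "real N * X w \<le> real N" using b[of w] w N space by auto
      from sumA[OF this] show "real N * X w \<le> 1 + (\<Sum>j<N. indicator (A j) w)"
        using w by (simp add: A_def indicator_def space of_bool_def)
    qed (use int[OF X] in auto)
    also have "\<dots> = 1 + (\<Sum>j<N. measure P (A j))"
      using As by (subst Bochner_Integration.integral_add)
        (auto simp: P.emeasure_eq_measure P.prob_space Bochner_Integration.integral_sum intro!: Bochner_Integration.integrable_sum)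
    also have "\<dots> \<le> 1 + (\<Sum>j<N. l (Y j))" by (intro add_left_mono sum_mono PA)
    also have "(\<Sum>j<N. l (Y j)) = l (\<lambda>w. \<Sum>j<N. Y j w)" by (rule l_sum[symmetric]) (rule YL)
    also have "\<dots> \<le> l (\<lambda>w. real N * X w)"
      using b by (intro l_mono sum YL scale X) (auto simp: Y_def sumY)
    also have "\<dots> = real N * l X" by (rule l_scale[OF X])
    finally have "(\<integral>w. X w \<partial>P) \<le> 1 / real N + l X" using N by (simp add: field_simps)
    then show "(\<integral>w. X w \<partial>P) \<le> l X + e" using N by simp
  qed
  \<comment> \<open>the reverse inequality is the same bound for \<open>1 - X\<close>\<close>
  have eq01: "(\<integral>w. X w \<partial>P) = l X" if X: "X \<in> L" and b: "\<And>w. w \<in> \<Omega> \<Longrightarrow> 0 \<le> X w \<and> X w \<le> 1" for X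
  proof -
    have "(\<integral>w. 1 - X w \<partial>P) \<le> l (\<lambda>w. 1 - X w)" using b by (intro le diff const X) auto
    moreover have "(\<integral>w. 1 - X w \<partial>P) = 1 - (\<integral>w. X w \<partial>P)" using int[OF X] by (simp add: P.prob_space)
    moreover have "l (\<lambda>w. 1 - X w) = 1 - l X" using l_diff[OF const X, of 1] l_one by simp
    ultimately show ?thesis using le[OF X b] by simp
  qed
  have "(\<integral>w. X w \<partial>P) = l X" if X: "X \<in> L" for X
  proof -
    obtain K0 where K0: "\<And>w. w \<in> \<Omega> \<Longrightarrow> \<bar>X w\<bar> \<le> K0" using bounded[OF X] by blast
    define K where "K = max K0 1"
    have K: "\<And>w. w \<in> \<Omega> \<Longrightarrow> \<bar>X w\<bar> \<le> K" "K > 0" using K0 unfolding K_def by fastforce+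
    have XL: "(\<lambda>w. (1 / (2 * K)) * (X w + K)) \<in> L" by (intro scale add const X)
    have "(\<integral>w. (1 / (2 * K)) * (X w + K) \<partial>P) = l (\<lambda>w. (1 / (2 * K)) * (X w + K))"
      using K(1) K(2) by (intro eq01[OF XL]) (force simp: field_simps abs_le_iff)
    also have "\<dots> = (1 / (2 * K)) * (l X + K)"
      by (subst l_scale) (auto simp: add X const l_add l_const)
    finally show ?thesis using int[OF X] K(2) by (simp add: P.prob_space)
  qed
  then show ?thesis using ps space meas by blast
qed

end

section \<open>Cylinder functions\<close>

lemma increments_sum: "(\<Sum>j\<le>i. increments t \<omega> j) = \<omega> (t i)"
  by (induction i) auto

text \<open>
  \<open>Lip T\<close> consists of the bounded functions that are Lipschitz in the values of the path at finitely many
  times: this description, free of grids and increments, is the one used below.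
\<close>

lemma LipD:
  assumes "X \<in> Lip T"
  obtains F K L where "finite F" "F \<subseteq> {0..T}" "F \<noteq> {}" "0 < L" "0 < K" "\<And>\<omega>. \<bar>X \<omega>\<bar> \<le> K"
    "\<And>\<omega> \<omega>'. \<bar>X \<omega> - X \<omega>'\<bar> \<le> L * (\<Sum>t\<in>F. \<bar>\<omega> t - \<omega>' t\<bar>)"
proof -
  obtain n t \<phi> where g: "time_grid T n t" and b: "bdd_lipschitz n \<phi>" and X: "X = (\<lambda>\<omega>. \<phi> (increments t \<omega>))"
    using assms unfolding Lip_def by blast
  obtain K0 L0 where K0: "\<And>x. \<bar>\<phi> x\<bar> \<le> K0"
    and L0: "\<And>x y. \<bar>\<phi> x - \<phi> y\<bar> \<le> L0 * L2_set (\<lambda>i. x i - y i) {..<n}"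
    using b unfolding bdd_lipschitz_def by blast
  define L where "L = \<bar>L0\<bar> + 1"
  have n: "1 \<le> n" "0 \<le> t 0" "t (n - 1) \<le> T" and sm: "strict_mono_on {..<n} t" using g unfolding time_grid_def by auto
  have inj: "inj_on t {..<n}" by (rule strict_mono_on_imp_inj_on[OF sm])
  have mono: "t i \<le> t j" if "i \<le> j" "j < n" for i j
    using strict_mono_onD[OF sm, of i j] that by (cases "i = j") (auto intro: less_imp_le)
  have tI: "t i \<in> {0..T}" if "i < n" for i
  proof -
    have "t 0 \<le> t i" "t i \<le> t (n - 1)" using that n by (auto intro!: mono)
    then show ?thesis using n by simp
  qed
  have d: "\<bar>increments t \<omega> i - increments t \<omega>' i\<bar> \<le> 2 * (\<Sum>s\<in>t ` {..<n}. \<bar>\<omega> s - \<omega>' s\<bar>)" if i: "i < n" for i \<omega> \<omega>'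
  proof -
    have m: "\<bar>\<omega> (t j) - \<omega>' (t j)\<bar> \<le> (\<Sum>s\<in>t ` {..<n}. \<bar>\<omega> s - \<omega>' s\<bar>)" if "j < n" for j
      using that by (intro member_le_sum) auto
    show ?thesis
    proof (cases i)
      case 0 then show ?thesis using m[of 0] i by auto
    next
      case (Suc k)
      have "\<bar>increments t \<omega> i - increments t \<omega>' i\<bar> \<le> \<bar>\<omega> (t i) - \<omega>' (t i)\<bar> + \<bar>\<omega> (t k) - \<omega>' (t k)\<bar>"
        using Suc by simp
      then show ?thesis using m[of i] m[of k] i Suc by simp
    qed
  qed
  show ?thesis
  proof (rule that[where F="t ` {..<n}" and K="\<bar>K0\<bar> + 1" and L="L * (2 * real n)"])
    show "finite (t ` {..<n})" "t ` {..<n} \<subseteq> {0..T}" "t ` {..<n} \<noteq> {}" using tI n by (auto simp: lessThan_empty_iff)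
    show "0 < \<bar>K0\<bar> + 1" by simp
    show "\<bar>X \<omega>\<bar> \<le> \<bar>K0\<bar> + 1" for \<omega> using K0[of "increments t \<omega>"] unfolding X by linarith
    show "0 < L * (2 * real n)" using n by (simp add: L_def)
    fix \<omega> \<omega>'
    let ?d = "\<lambda>i. increments t \<omega> i - increments t \<omega>' i"
    have "\<bar>X \<omega> - X \<omega>'\<bar> \<le> L0 * L2_set ?d {..<n}" unfolding X by (rule L0)
    also have "\<dots> \<le> L * L2_set ?d {..<n}" unfolding L_def by (intro mult_right_mono) auto
    also have "\<dots> \<le> L * (\<Sum>i<n. \<bar>?d i\<bar>)" unfolding L_def by (intro mult_left_mono L2_set_le_sum_abs) auto
    also have "\<dots> \<le> L * (\<Sum>i<n. 2 * (\<Sum>s\<in>t ` {..<n}. \<bar>\<omega> s - \<omega>' s\<bar>))"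
      unfolding L_def using d by (intro mult_left_mono sum_mono) auto
    finally show "\<bar>X \<omega> - X \<omega>'\<bar> \<le> L * (2 * real n) * (\<Sum>t\<in>t ` {..<n}. \<bar>\<omega> t - \<omega>' t\<bar>)" by (simp add: algebra_simps)
  qed
qed

lemma LipI:
  assumes T: "0 \<le> T" and F: "finite F" "F \<subseteq> {0..T}" and K: "\<And>\<omega>. \<bar>X \<omega>\<bar> \<le> K"
    and L: "\<And>\<omega> \<omega>'. \<bar>X \<omega> - X \<omega>'\<bar> \<le> L * (\<Sum>t\<in>F. \<bar>\<omega> t - \<omega>' t\<bar>)"
  shows "X \<in> Lip T"
proof -
  define F' where "F' = insert 0 F"
  have F': "finite F'" "F' \<subseteq> {0..T}" "F' \<noteq> {}" using F T by (auto simp: F'_def)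
  define n where "n = card F'"
  define xs where "xs = sorted_list_of_set F'"
  define t where "t i = xs ! i" for i
  have xs: "set xs = F'" "length xs = n" "sorted_wrt (<) xs"
    using F' by (auto simp: xs_def n_def strict_sorted_list_of_set)
  have n: "1 \<le> n" using F' by (simp add: n_def Suc_le_eq card_gt_0_iff)
  have tF: "t i \<in> F'" if "i < n" for i using xs that unfolding t_def by (metis nth_mem)
  have grid: "time_grid T n t" unfolding time_grid_def
    using n tF[of 0] tF[of "n - 1"] F' xs
    by (auto simp: t_def strict_mono_on_def sorted_wrt_iff_nth_less subset_iff)
  have "\<exists>i<n. t i = s" if "s \<in> F'" for s using that xs unfolding t_def by (metis in_set_conv_nth)
  then obtain idx where idx: "\<And>s. s \<in> F' \<Longrightarrow> idx s < n \<and> t (idx s) = s" by metis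
  define path where "path x s = (if s \<in> F' then \<Sum>j\<le>idx s. x j else 0)" for x :: "nat \<Rightarrow> real" and s
  define \<phi> where "\<phi> x = X (path x)" for x
  have "X \<omega> = \<phi> (increments t \<omega>)" for \<omega>
  proof -
    have "path (increments t \<omega>) s = \<omega> s" if "s \<in> F" for s
      using idx[of s] that by (simp add: path_def increments_sum F'_def)
    then have "(\<Sum>s\<in>F. \<bar>\<omega> s - path (increments t \<omega>) s\<bar>) = 0" by simp
    then show ?thesis using L[of \<omega> "path (increments t \<omega>)"] by (simp add: \<phi>_def)
  qed
  moreover have "bdd_lipschitz n \<phi>" unfolding bdd_lipschitz_def
  proof (intro conjI exI allI)
    show "\<bar>\<phi> x\<bar> \<le> K" for x unfolding \<phi>_def by (rule K)
    fix x y :: "nat \<Rightarrow> real"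
    let ?N = "L2_set (\<lambda>i. x i - y i) {..<n}"
    have p: "\<bar>path x s - path y s\<bar> \<le> real n * ?N" if s: "s \<in> F" for s
    proof -
      have sF: "s \<in> F'" using s by (simp add: F'_def)
      have "\<bar>path x s - path y s\<bar> = \<bar>\<Sum>j\<le>idx s. x j - y j\<bar>" using sF by (simp add: path_def sum_subtractf)
      also have "\<dots> \<le> (\<Sum>j\<le>idx s. \<bar>x j - y j\<bar>)" by (rule sum_abs)
      also have "\<dots> \<le> (\<Sum>j<n. \<bar>x j - y j\<bar>)" using idx[OF sF] by (intro sum_mono2) auto
      also have "\<dots> \<le> (\<Sum>j<n. ?N)"
        using member_le_L2_set[of "{..<n}" _ "\<lambda>i. \<bar>x i - y i\<bar>"]
        by (intro sum_mono) (simp add: L2_set_def)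
      finally show ?thesis by simp
    qed
    have "\<bar>\<phi> x - \<phi> y\<bar> \<le> L * (\<Sum>s\<in>F. \<bar>path x s - path y s\<bar>)" unfolding \<phi>_def by (rule L)
    also have "\<dots> \<le> \<bar>L\<bar> * (\<Sum>s\<in>F. \<bar>path x s - path y s\<bar>)" by (intro mult_right_mono sum_nonneg) auto
    also have "\<dots> \<le> \<bar>L\<bar> * (\<Sum>s\<in>F. real n * ?N)" using p by (intro mult_left_mono sum_mono) auto
    finally show "\<bar>\<phi> x - \<phi> y\<bar> \<le> (\<bar>L\<bar> * real (card F) * real n) * ?N" by (simp add: algebra_simps)
  qed
  ultimately show ?thesis using grid unfolding Lip_def by blast
qed

text \<open>
  \<open>Lip T\<close> is closed under binary operations that are bounded and Lipschitz on bounded sets.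
\<close>

lemma Lip_combine:
  assumes T: "0 \<le> T" and X: "X \<in> Lip T" and Y: "Y \<in> Lip T"
    and g: "\<And>K. \<exists>C. \<forall>x y. \<bar>x\<bar> \<le> K \<and> \<bar>y\<bar> \<le> K \<longrightarrow> \<bar>g x y\<bar> \<le> C"
    and l: "\<And>K. \<exists>C. \<forall>x y x' y'. \<bar>x\<bar> \<le> K \<and> \<bar>y\<bar> \<le> K \<and> \<bar>x'\<bar> \<le> K \<and> \<bar>y'\<bar> \<le> K \<longrightarrow> \<bar>g x y - g x' y'\<bar> \<le> C * (\<bar>x - x'\<bar> + \<bar>y - y'\<bar>)"
  shows "(\<lambda>\<omega>. g (X \<omega>) (Y \<omega>)) \<in> Lip T"
proof -
  obtain F K L where 1: "finite F" "F \<subseteq> {0..T}" "0 < L" "\<And>\<omega>. \<bar>X \<omega>\<bar> \<le> K"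
    "\<And>\<omega> \<omega>'. \<bar>X \<omega> - X \<omega>'\<bar> \<le> L * (\<Sum>t\<in>F. \<bar>\<omega> t - \<omega>' t\<bar>)" by (rule LipD[OF X]) blast
  obtain F' K' L' where 2: "finite F'" "F' \<subseteq> {0..T}" "0 < L'" "\<And>\<omega>. \<bar>Y \<omega>\<bar> \<le> K'"
    "\<And>\<omega> \<omega>'. \<bar>Y \<omega> - Y \<omega>'\<bar> \<le> L' * (\<Sum>t\<in>F'. \<bar>\<omega> t - \<omega>' t\<bar>)" by (rule LipD[OF Y]) blast
  define B where "B = max K K'"
  obtain C where C: "\<And>x y. \<bar>x\<bar> \<le> B \<Longrightarrow> \<bar>y\<bar> \<le> B \<Longrightarrow> \<bar>g x y\<bar> \<le> C" using g[of B] by blast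
  obtain D where D: "\<And>x y x' y'. \<bar>x\<bar> \<le> B \<Longrightarrow> \<bar>y\<bar> \<le> B \<Longrightarrow> \<bar>x'\<bar> \<le> B \<Longrightarrow> \<bar>y'\<bar> \<le> B \<Longrightarrow> \<bar>g x y - g x' y'\<bar> \<le> D * (\<bar>x - x'\<bar> + \<bar>y - y'\<bar>)"
    using l[of B] by blast
  have b: "\<bar>X \<omega>\<bar> \<le> B" "\<bar>Y \<omega>\<bar> \<le> B" for \<omega> using 1(4)[of \<omega>] 2(4)[of \<omega>] unfolding B_def by auto
  show ?thesis
  proof (rule LipI[OF T])
    show "finite (F \<union> F')" "F \<union> F' \<subseteq> {0..T}" using 1 2 by auto
    show "\<bar>g (X \<omega>) (Y \<omega>)\<bar> \<le> C" for \<omega> by (intro C b)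
    fix \<omega> \<omega>' :: "real \<Rightarrow> real"
    let ?S = "\<Sum>t\<in>F \<union> F'. \<bar>\<omega> t - \<omega>' t\<bar>"
    have "(\<Sum>t\<in>F. \<bar>\<omega> t - \<omega>' t\<bar>) \<le> ?S" "(\<Sum>t\<in>F'. \<bar>\<omega> t - \<omega>' t\<bar>) \<le> ?S"
      using 1(1) 2(1) by (auto intro!: sum_mono2)
    then have "\<bar>X \<omega> - X \<omega>'\<bar> \<le> L * ?S" "\<bar>Y \<omega> - Y \<omega>'\<bar> \<le> L' * ?S"
      using 1(3) 2(3) by (auto intro: order.trans[OF 1(5)] order.trans[OF 2(5)] mult_left_mono)
    then have s: "\<bar>X \<omega> - X \<omega>'\<bar> + \<bar>Y \<omega> - Y \<omega>'\<bar> \<le> (L + L') * ?S" by (simp add: algebra_simps)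
    have "\<bar>g (X \<omega>) (Y \<omega>) - g (X \<omega>') (Y \<omega>')\<bar> \<le> D * (\<bar>X \<omega> - X \<omega>'\<bar> + \<bar>Y \<omega> - Y \<omega>'\<bar>)" by (intro D b)
    also have "\<dots> \<le> \<bar>D\<bar> * (\<bar>X \<omega> - X \<omega>'\<bar> + \<bar>Y \<omega> - Y \<omega>'\<bar>)" by (intro mult_right_mono) auto
    also have "\<dots> \<le> \<bar>D\<bar> * ((L + L') * ?S)" using s by (intro mult_left_mono) auto
    finally show "\<bar>g (X \<omega>) (Y \<omega>) - g (X \<omega>') (Y \<omega>')\<bar> \<le> (\<bar>D\<bar> * (L + L')) * ?S" by (simp add: algebra_simps)
  qed
qed

lemma Lip_const: "0 \<le> T \<Longrightarrow> (\<lambda>_. c) \<in> Lip T"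
  by (rule LipI[where F="{}" and K="\<bar>c\<bar>" and L=0]) auto

lemma Lip_add: "0 \<le> T \<Longrightarrow> X \<in> Lip T \<Longrightarrow> Y \<in> Lip T \<Longrightarrow> (\<lambda>\<omega>. X \<omega> + Y \<omega>) \<in> Lip T"
proof (rule Lip_combine[where g="\<lambda>x y. x + y"])
  show "\<exists>C. \<forall>x y::real. \<bar>x\<bar> \<le> K \<and> \<bar>y\<bar> \<le> K \<longrightarrow> \<bar>x + y\<bar> \<le> C" for K by (intro exI[of _ "2 * K"]) auto
qed (auto intro!: exI[of _ 1])

lemma Lip_mult: 
  assumes "0 \<le> T" "X \<in> Lip T" "Y \<in> Lip T"
  shows "(\<lambda>\<omega>. X \<omega> * Y \<omega>) \<in> Lip T"
proof (rule Lip_combine[OF assms, where g="\<lambda>x y. x * y"])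
  show "\<exists>C. \<forall>x y::real. \<bar>x\<bar> \<le> K \<and> \<bar>y\<bar> \<le> K \<longrightarrow> \<bar>x * y\<bar> \<le> C" for K
    by (intro exI[of _ "K * K"]) (auto simp: abs_mult intro!: mult_mono order.trans[OF abs_ge_zero])
  show "\<exists>C. \<forall>x y x' y'::real. \<bar>x\<bar> \<le> K \<and> \<bar>y\<bar> \<le> K \<and> \<bar>x'\<bar> \<le> K \<and> \<bar>y'\<bar> \<le> K \<longrightarrow> \<bar>x * y - x' * y'\<bar> \<le> C * (\<bar>x - x'\<bar> + \<bar>y - y'\<bar>)" for K
  proof (intro exI[of _ K] allI impI)
    fix x y x' y' :: real assume b: "\<bar>x\<bar> \<le> K \<and> \<bar>y\<bar> \<le> K \<and> \<bar>x'\<bar> \<le> K \<and> \<bar>y'\<bar> \<le> K"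
    have "x * y - x' * y' = (x - x') * y + x' * (y - y')" by (simp add: algebra_simps)
    then have "\<bar>x * y - x' * y'\<bar> \<le> \<bar>x - x'\<bar> * \<bar>y\<bar> + \<bar>x'\<bar> * \<bar>y - y'\<bar>" by (metis abs_mult abs_triangle_ineq)
    also have "\<dots> \<le> \<bar>x - x'\<bar> * K + K * \<bar>y - y'\<bar>" using b by (intro add_mono mult_mono) auto
    finally show "\<bar>x * y - x' * y'\<bar> \<le> K * (\<bar>x - x'\<bar> + \<bar>y - y'\<bar>)" by (simp add: algebra_simps)
  qed
qed

lemma Lip_scale: "0 \<le> T \<Longrightarrow> X \<in> Lip T \<Longrightarrow> (\<lambda>\<omega>. c * X \<omega>) \<in> Lip T"
  by (intro Lip_mult Lip_const)

lemma Lip_diff: "0 \<le> T \<Longrightarrow> X \<in> Lip T \<Longrightarrow> Y \<in> Lip T \<Longrightarrow> (\<lambda>\<omega>. X \<omega> - Y \<omega>) \<in> Lip T"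
  using Lip_add[OF _ _ Lip_scale[of T Y "-1"]] by simp

lemma Lip_min: 
  assumes "0 \<le> T" "X \<in> Lip T" "Y \<in> Lip T"
  shows "(\<lambda>\<omega>. min (X \<omega>) (Y \<omega>)) \<in> Lip T"
proof (rule Lip_combine[OF assms, where g="\<lambda>x y. min x y"])
  show "\<exists>C. \<forall>x y::real. \<bar>x\<bar> \<le> K \<and> \<bar>y\<bar> \<le> K \<longrightarrow> \<bar>min x y\<bar> \<le> C" for K
    by (intro exI[of _ K]) auto
qed (auto intro!: exI[of _ 1] simp: min_def)

lemma Lip_abs:
  assumes "0 \<le> T" "X \<in> Lip T"
  shows "(\<lambda>\<omega>. \<bar>X \<omega>\<bar>) \<in> Lip T"
proof (rule Lip_combine[OF assms(1,2,2), where g="\<lambda>x y. \<bar>x\<bar>"])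
  show "\<exists>C. \<forall>x y::real. \<bar>x\<bar> \<le> K \<and> \<bar>y\<bar> \<le> K \<longrightarrow> \<bar>\<bar>x\<bar>\<bar> \<le> C" for K
    by (intro exI[of _ K]) auto
qed (auto intro!: exI[of _ 1])

lemma Lip_power: "0 \<le> T \<Longrightarrow> X \<in> Lip T \<Longrightarrow> (\<lambda>\<omega>. X \<omega> ^ n) \<in> Lip T"
  by (induction n) (auto intro: Lip_const Lip_mult)

lemma Lip_sum: "0 \<le> T \<Longrightarrow> (\<And>i. i \<in> A \<Longrightarrow> X i \<in> Lip T) \<Longrightarrow> (\<lambda>\<omega>. \<Sum>i\<in>A. X i \<omega>) \<in> Lip T"
  by (induction A rule: infinite_finite_induct) (auto intro: Lip_const Lip_add)

lemma function_subspace_Lip: "0 \<le> T \<Longrightarrow> function_subspace (Lip T)"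
  unfolding function_subspace_def using Lip_add Lip_scale Lip_const[of T 0] by blast

text \<open>
  Continuity refers to pointwise convergence on all of \<^typ>\<open>real \<Rightarrow> real\<close>.
\<close>

lemma Lip_continuous: "X \<in> Lip T \<Longrightarrow> continuous_on A X"
proof -
  assume X: "X \<in> Lip T"
  obtain F K L where 1: "finite F" "0 < L" 
    "\<And>\<omega> \<omega>'. \<bar>X \<omega> - X \<omega>'\<bar> \<le> L * (\<Sum>t\<in>F. \<bar>\<omega> t - \<omega>' t\<bar>)" by (rule LipD[OF X]) blast
  have "isCont X \<omega>" for \<omega>
  proof -
    have cont: "continuous_on UNIV (\<lambda>\<omega>'. L * (\<Sum>t\<in>F. \<bar>\<omega>' t - \<omega> t\<bar>))"
      by (intro continuous_intros continuous_on_product_coordinates)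
    have "((\<lambda>\<omega>'. L * (\<Sum>t\<in>F. \<bar>\<omega>' t - \<omega> t\<bar>)) \<longlongrightarrow> L * (\<Sum>t\<in>F. \<bar>\<omega> t - \<omega> t\<bar>)) (at \<omega>)"
      using cont unfolding continuous_on_eq_continuous_at[OF open_UNIV] isCont_def by blast
    then have "((\<lambda>\<omega>'. L * (\<Sum>t\<in>F. \<bar>\<omega>' t - \<omega> t\<bar>)) \<longlongrightarrow> 0) (at \<omega>)" by simp
    then have "((\<lambda>\<omega>'. X \<omega>' - X \<omega>) \<longlongrightarrow> 0) (at \<omega>)"
      by (rule Lim_null_comparison[rotated]) (use 1(3) in auto)
    then show ?thesis by (simp add: isCont_def LIM_zero_iff)
  qed
  then show ?thesis by (simp add: continuous_at_imp_continuous_on)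
qed

text \<open>
  Truncation to \<open>[- c, c]\<close>.
\<close>

definition clip :: "real \<Rightarrow> real \<Rightarrow> real" where "clip c x = max (- c) (min c x)"

lemma clip_lipschitz: "\<bar>clip c x - clip c y\<bar> \<le> \<bar>x - y\<bar>" unfolding clip_def by auto
lemma clip_bound: "0 \<le> c \<Longrightarrow> \<bar>clip c x\<bar> \<le> c" unfolding clip_def by auto
lemma clip_uminus: "0 \<le> c \<Longrightarrow> clip c (- x) = - clip c x" unfolding clip_def by auto
lemma clip_0: "0 \<le> c \<Longrightarrow> clip c 0 = 0" unfolding clip_def by auto
lemma abs_clip: "0 \<le> c \<Longrightarrow> \<bar>clip c x\<bar> = min c \<bar>x\<bar>" unfolding clip_def by auto
lemma clip_scale: "0 < b \<Longrightarrow> clip 1 (x / b) = clip b x / b"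
  unfolding clip_def by (auto simp: min_def max_def field_simps)

lemma Lip_clip_coord: "0 \<le> c \<Longrightarrow> t \<in> {0..T} \<Longrightarrow> (\<lambda>\<omega>. clip c (\<omega> t)) \<in> Lip T"
  by (rule LipI[where F="{t}" and K=c and L=1]) (auto simp: clip_bound clip_lipschitz)

lemma Lip_clip_diff: 
  assumes "0 \<le> c" "t \<in> {0..T}" "s \<in> {0..T}"
  shows "(\<lambda>\<omega>. clip c (\<omega> t - \<omega> s)) \<in> Lip T"
proof (rule LipI[where F="{t, s}" and K=c and L=1])
  fix \<omega> \<omega>' :: "real \<Rightarrow> real"
  have "\<bar>clip c (\<omega> t - \<omega> s) - clip c (\<omega>' t - \<omega>' s)\<bar> \<le> \<bar>(\<omega> t - \<omega> s) - (\<omega>' t - \<omega>' s)\<bar>" by (rule clip_lipschitz)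
  also have "\<dots> \<le> 1 * (\<Sum>r\<in>{t, s}. \<bar>\<omega> r - \<omega>' r\<bar>)" by (cases "t = s") auto
  finally show "\<bar>clip c (\<omega> t - \<omega> s) - clip c (\<omega>' t - \<omega>' s)\<bar> \<le> 1 * (\<Sum>r\<in>{t, s}. \<bar>\<omega> r - \<omega>' r\<bar>)" .
qed (use assms in \<open>auto simp: clip_bound\<close>)

section \<open>Dyadic interpolation\<close>

text \<open>
  The dyadic points \<open>i T / 2\<^sup>m\<close> of \<open>[0, T]\<close>, and the piecewise linear interpolation of a function between
  them, written as a combination of hat functions and restricted to \<open>[0, T]\<close> so that it is a path.
\<close>

definition node :: "real \<Rightarrow> nat \<Rightarrow> nat \<Rightarrow> real" where "node T m i = T * real i / 2 ^ m"

definition interp :: "real \<Rightarrow> nat \<Rightarrow> (real \<Rightarrow> real) \<Rightarrow> real \<Rightarrow> real" where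
  "interp T m \<omega> = restrict (\<lambda>t. \<Sum>i\<le>2 ^ m. max 0 (1 - \<bar>t * 2 ^ m / T - real i\<bar>) * \<omega> (node T m i)) {0..T}"

lemma node_in: "0 < T \<Longrightarrow> i \<le> 2 ^ m \<Longrightarrow> node T m i \<in> {0..T}"
proof -
  assume T: "0 < T" and i: "i \<le> 2 ^ m"
  have "real i \<le> 2 ^ m" using i of_nat_le_iff[where 'a=real, of i "2 ^ m"] by simp
  then show ?thesis using T by (simp add: node_def field_simps)
qed

lemma node_0: "node T m 0 = 0" and node_last: "node T m (2 ^ m) = T" by (auto simp: node_def)
lemma node_refine: "node T (Suc m) (2 * i) = node T m i" by (simp add: node_def)
lemma node_refine_iter: "node T (m + k) (i * 2 ^ k) = node T m i"
  by (simp add: node_def power_add field_simps)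

text \<open>
  Every time is \<open>T (i + \<theta>) / 2\<^sup>m\<close> for a cell \<open>i\<close> and a relative position \<open>\<theta>\<close>; the right endpoint \<open>T\<close>
  belongs to the last cell, with \<open>\<theta> = 1\<close>.
\<close>

lemma cell_exists:
  assumes T: "0 < T" and t: "t \<in> {0..T}"
  obtains i \<theta> where "i < 2 ^ m" "0 \<le> \<theta>" "\<theta> \<le> 1" "t = T * (real i + \<theta>) / 2 ^ m"
proof (cases "t = T")
  case True
  show ?thesis
    by (rule that[of "2 ^ m - 1" 1]) (use True in \<open>auto simp: of_nat_diff\<close>)
next
  case False
  define x where "x = t * 2 ^ m / T"
  have x: "0 \<le> x" "x < 2 ^ m" using False t T by (auto simp: x_def field_simps)
  show ?thesis
  proof (rule that[of "nat \<lfloor>x\<rfloor>" "x - real (nat \<lfloor>x\<rfloor>)"])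
    have r: "real (nat \<lfloor>x\<rfloor>) = of_int \<lfloor>x\<rfloor>" using x by simp
    have "real (nat \<lfloor>x\<rfloor>) < 2 ^ m" unfolding r using of_int_floor_le[of x] x(2) by linarith
    then show "nat \<lfloor>x\<rfloor> < 2 ^ m" using of_nat_less_iff[where 'a=real, of "nat \<lfloor>x\<rfloor>" "2 ^ m"] by simp
    show "0 \<le> x - real (nat \<lfloor>x\<rfloor>)" "x - real (nat \<lfloor>x\<rfloor>) \<le> 1" unfolding r by linarith+
    show "t = T * (real (nat \<lfloor>x\<rfloor>) + (x - real (nat \<lfloor>x\<rfloor>))) / 2 ^ m" using T by (simp add: x_def)
  qed
qed

lemma cell_in: "0 < T \<Longrightarrow> i < 2 ^ m \<Longrightarrow> 0 \<le> \<theta> \<Longrightarrow> \<theta> \<le> 1 \<Longrightarrow> T * (real i + \<theta>) / 2 ^ m \<in> {0..T}"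
proof -
  assume T: "0 < T" and i: "i < 2 ^ m" and th: "0 \<le> \<theta>" "\<theta> \<le> 1"
  have "real (Suc i) \<le> 2 ^ m" using i of_nat_le_iff[where 'a=real, of "Suc i" "2 ^ m"] by simp
  then have "real i + \<theta> \<le> 2 ^ m" using th by simp
  then have "T * (real i + \<theta>) \<le> T * 2 ^ m" using T by (intro mult_left_mono) auto
  then show ?thesis using T th by (simp add: divide_le_eq)
qed

lemma interp_cell:
  assumes T: "0 < T" and i: "i < 2 ^ m" and th: "0 \<le> \<theta>" "\<theta> \<le> 1"
  shows "interp T m \<omega> (T * (real i + \<theta>) / 2 ^ m) = (1 - \<theta>) * \<omega> (node T m i) + \<theta> * \<omega> (node T m (Suc i))"
proof -
  let ?h = "\<lambda>j. max 0 (1 - \<bar>(real i + \<theta>) - real j\<bar>) * \<omega> (node T m j)"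
  have "interp T m \<omega> (T * (real i + \<theta>) / 2 ^ m) = (\<Sum>j\<le>2 ^ m. ?h j)"
    unfolding interp_def using cell_in[OF T i th] T by simp
  also have "\<dots> = (\<Sum>j\<in>{i, Suc i}. ?h j)"
  proof (rule sum.mono_neutral_right)
    show "\<forall>j\<in>{..2 ^ m} - {i, Suc i}. ?h j = 0"
    proof
      fix j assume j: "j \<in> {..2 ^ m} - {i, Suc i}"
      then have "Suc j \<le> i \<or> Suc (Suc i) \<le> j" by auto
      then have "real (Suc j) \<le> real i \<or> real (Suc (Suc i)) \<le> real j" by (simp only: of_nat_le_iff)
      then have "real j + 1 \<le> real i \<or> real i + 2 \<le> real j" by (simp, linarith)
      then show "?h j = 0" using th by auto
    qed
  qed (use i in auto)
  also have "\<dots> = (1 - \<theta>) * \<omega> (node T m i) + \<theta> * \<omega> (node T m (Suc i))" using th by simp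
  finally show ?thesis .
qed

lemma interp_node:
  assumes T: "0 < T" and i: "i \<le> 2 ^ m"
  shows "interp T m \<omega> (node T m i) = \<omega> (node T m i)"
proof (cases "i = 2 ^ m")
  case True
  then have "node T m i = T * (real (2 ^ m - 1) + 1) / 2 ^ m" by (simp add: node_def of_nat_diff)
  then show ?thesis using interp_cell[OF T, of "2 ^ m - 1" m 1 \<omega>] True by simp
next
  case False
  then show ?thesis using interp_cell[OF T, of i m 0 \<omega>] i by (simp add: node_def)
qed

lemma interp_0: "0 < T \<Longrightarrow> interp T m \<omega> 0 = \<omega> 0" using interp_node[of T 0 m] by (simp add: node_0)
lemma interp_T: "0 < T \<Longrightarrow> interp T m \<omega> T = \<omega> T" using interp_node[of T "2 ^ m" m] by (simp add: node_last)

lemma interp_cong: "(\<And>i. i \<le> 2 ^ m \<Longrightarrow> \<omega> (node T m i) = \<omega>' (node T m i)) \<Longrightarrow> interp T m \<omega> = interp T m \<omega>'"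
  unfolding interp_def by (intro restrict_ext sum.cong) auto

lemma interp_extensional: "interp T m \<omega> \<in> extensional {0..T}" unfolding interp_def by simp

lemma interp_continuous: "0 < T \<Longrightarrow> continuous_on {0..T} (interp T m \<omega>)"
proof -
  assume T: "0 < T"
  have "continuous_on {0..T} (\<lambda>t. \<Sum>i\<le>2 ^ m. max 0 (1 - \<bar>t * 2 ^ m / T - real i\<bar>) * \<omega> (node T m i))"
    using T by (intro continuous_intros) auto
  then show ?thesis unfolding interp_def by (rule continuous_on_eq) auto
qed

lemma interp_path: "0 < T \<Longrightarrow> interp T m \<omega> \<in> mspace (path_metric T)"
  using interp_extensional interp_continuous by (simp add: mspace_path_metric)

lemma interp_diff_le:
  assumes T: "0 < T" and t: "t \<in> {0..T}" and d: "\<And>i. i \<le> 2 ^ m \<Longrightarrow> \<bar>\<omega> (node T m i) - \<omega>' (node T m i)\<bar> \<le> d"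
  shows "\<bar>interp T m \<omega> t - interp T m \<omega>' t\<bar> \<le> d"
proof -
  obtain i \<theta> where c: "i < 2 ^ m" "0 \<le> \<theta>" "\<theta> \<le> 1" "t = T * (real i + \<theta>) / 2 ^ m" using cell_exists[OF T t] .
  let ?d = "\<lambda>j. \<omega> (node T m j) - \<omega>' (node T m j)"
  have "interp T m \<omega> t - interp T m \<omega>' t = (1 - \<theta>) * ?d i + \<theta> * ?d (Suc i)"
    unfolding c(4) interp_cell[OF T c(1-3)] by (simp add: algebra_simps)
  also have "\<bar>\<dots>\<bar> \<le> (1 - \<theta>) * \<bar>?d i\<bar> + \<theta> * \<bar>?d (Suc i)\<bar>"
    using c abs_triangle_ineq[of "(1 - \<theta>) * ?d i" "\<theta> * ?d (Suc i)"] by (simp add: abs_mult)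
  also have "\<dots> \<le> (1 - \<theta>) * d + \<theta> * d" using c d[of i] d[of "Suc i"] by (intro add_mono mult_left_mono) auto
  finally show ?thesis by (simp add: algebra_simps)
qed

lemma interp_minus_point_le:
  assumes T: "0 < T" and t: "t \<in> {0..T}"
  obtains i where "i < 2 ^ m" "\<And>\<omega>. \<bar>\<omega> t - interp T m \<omega> t\<bar> \<le> max \<bar>\<omega> t - \<omega> (node T m i)\<bar> \<bar>\<omega> t - \<omega> (node T m (Suc i))\<bar>"
    "\<bar>t - node T m i\<bar> \<le> T / 2 ^ m" "\<bar>t - node T m (Suc i)\<bar> \<le> T / 2 ^ m"
proof -
  obtain i \<theta> where c: "i < 2 ^ m" "0 \<le> \<theta>" "\<theta> \<le> 1" "t = T * (real i + \<theta>) / 2 ^ m" using cell_exists[OF T t] .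
  have "\<bar>\<omega> t - interp T m \<omega> t\<bar> \<le> max \<bar>\<omega> t - \<omega> (node T m i)\<bar> \<bar>\<omega> t - \<omega> (node T m (Suc i))\<bar>" (is "_ \<le> ?M") for \<omega>
  proof -
    have I: "interp T m \<omega> t = (1 - \<theta>) * \<omega> (node T m i) + \<theta> * \<omega> (node T m (Suc i))"
      by (simp only: c(4) interp_cell[OF T c(1-3)])
    have "\<omega> t - interp T m \<omega> t = (1 - \<theta>) * (\<omega> t - \<omega> (node T m i)) + \<theta> * (\<omega> t - \<omega> (node T m (Suc i)))"
      unfolding I by (simp add: algebra_simps)
    also have "\<bar>\<dots>\<bar> \<le> (1 - \<theta>) * \<bar>\<omega> t - \<omega> (node T m i)\<bar> + \<theta> * \<bar>\<omega> t - \<omega> (node T m (Suc i))\<bar>"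
      using c abs_triangle_ineq[of "(1 - \<theta>) * (\<omega> t - \<omega> (node T m i))" "\<theta> * (\<omega> t - \<omega> (node T m (Suc i)))"] by (simp add: abs_mult)
    also have "\<dots> \<le> (1 - \<theta>) * ?M + \<theta> * ?M" using c by (intro add_mono mult_left_mono) auto
    finally show ?thesis by (simp add: algebra_simps)
  qed
  moreover have "t - node T m i = \<theta> * (T / 2 ^ m)" "node T m (Suc i) - t = (1 - \<theta>) * (T / 2 ^ m)"
    by (auto simp: c(4) node_def field_simps)
  moreover have "0 \<le> \<theta> * (T / 2 ^ m)" "\<theta> * (T / 2 ^ m) \<le> T / 2 ^ m" "0 \<le> (1 - \<theta>) * (T / 2 ^ m)" "(1 - \<theta>) * (T / 2 ^ m) \<le> T / 2 ^ m"
    using c T by (intro mult_left_le_one_le mult_nonneg_nonneg; simp)+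
  ultimately show ?thesis using c by (intro that[of i]) auto
qed

text \<open>
  Refining the level changes the interpolation only by the second difference at the midpoint of the cell.
\<close>

lemma interp_step:
  assumes T: "0 < T" and i: "i < 2 ^ m" and th: "0 \<le> \<theta>" "\<theta> \<le> 1"
  shows "interp T (Suc m) \<omega> (T * (real i + \<theta>) / 2 ^ m) - interp T m \<omega> (T * (real i + \<theta>) / 2 ^ m) =
    min \<theta> (1 - \<theta>) * (2 * \<omega> (node T (Suc m) (2 * i + 1)) - \<omega> (node T m i) - \<omega> (node T m (Suc i)))"
proof (cases "\<theta> \<le> 1 / 2")
  case True
  have "T * (real i + \<theta>) / 2 ^ m = T * (real (2 * i) + 2 * \<theta>) / 2 ^ Suc m" by (simp add: field_simps)
  then have "interp T (Suc m) \<omega> (T * (real i + \<theta>) / 2 ^ m) =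
    (1 - 2 * \<theta>) * \<omega> (node T m i) + 2 * \<theta> * \<omega> (node T (Suc m) (2 * i + 1))"
    using interp_cell[OF T, of "2 * i" "Suc m" "2 * \<theta>" \<omega>] True i th node_refine[of T m i] by simp
  then show ?thesis using True interp_cell[OF T i th, of \<omega>] by (simp add: min_def algebra_simps)
next
  case False
  have "T * (real i + \<theta>) / 2 ^ m = T * (real (2 * i + 1) + (2 * \<theta> - 1)) / 2 ^ Suc m" by (simp add: field_simps)
  then have "interp T (Suc m) \<omega> (T * (real i + \<theta>) / 2 ^ m) =
    (2 - 2 * \<theta>) * \<omega> (node T (Suc m) (2 * i + 1)) + (2 * \<theta> - 1) * \<omega> (node T m (Suc i))"
    using interp_cell[OF T, of "2 * i + 1" "Suc m" "2 * \<theta> - 1" \<omega>] False i th node_refine[of T m "Suc i"] by simp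
  then show ?thesis using False interp_cell[OF T i th, of \<omega>] by (simp add: min_def algebra_simps)
qed

text \<open>
  The increment over the cell \<open>i\<close> at level \<open>m\<close>.
\<close>

definition incr :: "real \<Rightarrow> nat \<Rightarrow> nat \<Rightarrow> (real \<Rightarrow> real) \<Rightarrow> real" where
  "incr T m i \<omega> = \<omega> (node T m (Suc i)) - \<omega> (node T m i)"

lemma interp_step_le:
  assumes T: "0 < T" and t: "t \<in> {0..T}" and d: "\<And>i. i < 2 ^ Suc m \<Longrightarrow> \<bar>incr T (Suc m) i \<omega>\<bar> \<le> d"
  shows "\<bar>interp T (Suc m) \<omega> t - interp T m \<omega> t\<bar> \<le> d"
proof -
  obtain i \<theta> where c: "i < 2 ^ m" "0 \<le> \<theta>" "\<theta> \<le> 1" "t = T * (real i + \<theta>) / 2 ^ m" using cell_exists[OF T t] .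
  have m: "0 \<le> min \<theta> (1 - \<theta>)" "min \<theta> (1 - \<theta>) \<le> 1/2" using c by (auto simp: min_def)
  let ?e = "2 * \<omega> (node T (Suc m) (2 * i + 1)) - \<omega> (node T m i) - \<omega> (node T m (Suc i))"
  have "?e = incr T (Suc m) (2 * i) \<omega> - incr T (Suc m) (Suc (2 * i)) \<omega>"
    using node_refine[of T m i] node_refine[of T m "Suc i"] by (simp add: incr_def)
  moreover have "\<bar>incr T (Suc m) (2 * i) \<omega>\<bar> \<le> d" "\<bar>incr T (Suc m) (Suc (2 * i)) \<omega>\<bar> \<le> d" using c by (auto intro!: d)
  ultimately have e: "\<bar>?e\<bar> \<le> 2 * d" by linarith
  have "\<bar>interp T (Suc m) \<omega> t - interp T m \<omega> t\<bar> = min \<theta> (1 - \<theta>) * \<bar>?e\<bar>"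
    unfolding c(4) interp_step[OF T c(1-3)] using m by (simp add: abs_mult)
  also have "\<dots> \<le> 1/2 * (2 * d)" using m e by (intro mult_mono) auto
  finally show ?thesis by simp
qed

lemma interp_refine_fixed:
  assumes T: "0 < T" and f: "\<And>t. t \<in> {0..T} \<Longrightarrow> interp T m f t = f t" and t: "t \<in> {0..T}"
  shows "interp T (Suc m) f t = f t"
proof -
  obtain i \<theta> where c: "i < 2 ^ m" "0 \<le> \<theta>" "\<theta> \<le> 1" "t = T * (real i + \<theta>) / 2 ^ m" using cell_exists[OF T t] .
  have mid: "node T (Suc m) (2 * i + 1) = T * (real i + 1/2) / 2 ^ m" by (simp add: node_def field_simps)
  have "f (node T (Suc m) (2 * i + 1)) = interp T m f (T * (real i + 1/2) / 2 ^ m)"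
    unfolding mid using c by (intro f[symmetric] cell_in T) auto
  also have "\<dots> = (f (node T m i) + f (node T m (Suc i))) / 2"
    using interp_cell[OF T c(1), of "1/2" f] by (simp add: field_simps)
  finally have z: "2 * f (node T (Suc m) (2 * i + 1)) - f (node T m i) - f (node T m (Suc i)) = 0" by simp
  have "interp T (Suc m) f t - interp T m f t = 0"
    unfolding c(4) interp_step[OF T c(1-3)] z by simp
  then have "interp T (Suc m) f t = interp T m f t" by simp
  then show ?thesis using f[OF t] by simp
qed

lemma interp_interp_finer:
  assumes T: "0 < T" and t: "t \<in> {0..T}" and mn: "m \<le> n"
  shows "interp T n (interp T m \<omega>) t = interp T m \<omega> t"
  using mn t
proof (induction arbitrary: t rule: dec_induct)
  case base
  then show ?case using interp_cong[of m "interp T m \<omega>" T \<omega>] interp_node[OF T] by simp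
next
  case (step n)
  then show ?case by (intro interp_refine_fixed T) auto
qed

lemma interp_interp_coarser:
  assumes T: "0 < T" and nm: "n \<le> m"
  shows "interp T n (interp T m \<omega>) = interp T n \<omega>"
proof (rule interp_cong)
  fix i :: nat assume i: "i \<le> 2 ^ n"
  have "node T n i = node T m (i * 2 ^ (m - n))" using node_refine_iter[of T n "m - n" i] nm by simp
  moreover have "i * 2 ^ (m - n) \<le> 2 ^ m"
  proof -
    have "i * 2 ^ (m - n) \<le> 2 ^ n * 2 ^ (m - n)" using i by simp
    then show ?thesis using nm by (simp add: power_add[symmetric])
  qed
  ultimately show "interp T m \<omega> (node T n i) = \<omega> (node T n i)" using interp_node[OF T] by simp
qed

text \<open>
  Chaining. The ratio \<open>9/10\<close> is chosen because \<open>(9/10)\<^sup>4 > 1/2\<close>, which makes the moment series in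
  \<open>E_roughness_le\<close> converge; the factor \<open>10\<close> bounds the geometric series.
\<close>

lemma interp_chain_le:
  assumes T: "0 < T" and t: "t \<in> {0..T}" and a: "0 \<le> a" and nm: "n \<le> m"
    and d: "\<And>j i. j \<le> m \<Longrightarrow> i < 2 ^ j \<Longrightarrow> \<bar>incr T j i \<omega>\<bar> \<le> a * (9/10) ^ j"
  shows "\<bar>interp T m \<omega> t - interp T n \<omega> t\<bar> \<le> 10 * a * ((9/10) ^ n - (9/10) ^ m)"
  using nm d
proof (induction rule: dec_induct)
  case base then show ?case by simp
next
  case (step k)
  have "\<bar>interp T k \<omega> t - interp T n \<omega> t\<bar> \<le> 10 * a * ((9/10) ^ n - (9/10) ^ k)"
    using step by auto
  moreover have "\<bar>interp T (Suc k) \<omega> t - interp T k \<omega> t\<bar> \<le> a * (9/10) ^ Suc k"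
  proof (rule interp_step_le[OF T t])
    show "\<bar>incr T (Suc k) i \<omega>\<bar> \<le> a * (9/10) ^ Suc k" if "i < 2 ^ Suc k" for i
      using that by (intro step.prems) simp_all
  qed
  ultimately have "\<bar>interp T (Suc k) \<omega> t - interp T n \<omega> t\<bar> \<le>
      10 * a * ((9/10) ^ n - (9/10) ^ k) + a * (9/10) ^ Suc k" by linarith
  also have "\<dots> = 10 * a * ((9/10) ^ n - (9/10) ^ Suc k) - 1/10 * (a * (9/10) ^ k)"
    by (simp add: field_simps)
  also have "\<dots> \<le> 10 * a * ((9/10) ^ n - (9/10) ^ Suc k)" using a by simp
  finally show ?case .
qed

lemma interp_uniform_limit:
  assumes T: "0 < T" and c: "continuous_on {0..T} \<omega>" and e: "0 < e"
  obtains N where "\<And>n t. n \<ge> N \<Longrightarrow> t \<in> {0..T} \<Longrightarrow> \<bar>\<omega> t - interp T n \<omega> t\<bar> \<le> e"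
proof -
  have "uniformly_continuous_on {0..T} \<omega>" by (rule compact_uniformly_continuous[OF c compact_Icc])
  then obtain d where d: "d > 0" "\<And>s t. s \<in> {0..T} \<Longrightarrow> t \<in> {0..T} \<Longrightarrow> dist s t < d \<Longrightarrow> dist (\<omega> s) (\<omega> t) < e"
    unfolding uniformly_continuous_on_def using e by metis
  have "(\<lambda>n. T * (1/2) ^ n) \<longlonglongrightarrow> T * 0" by (intro tendsto_mult tendsto_const LIMSEQ_power_zero) auto
  then have "eventually (\<lambda>n. T * (1/2) ^ n < d) sequentially" using d(1) by (intro order_tendstoD(2)) auto
  then obtain N where N: "\<And>n. n \<ge> N \<Longrightarrow> T * (1/2) ^ n < d" unfolding eventually_sequentially by blast
  show ?thesis
  proof (rule that[of N])
    fix n t assume n: "n \<ge> N" and t: "t \<in> {0..T}"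
    obtain i where i: "i < 2 ^ n" "\<bar>\<omega> t - interp T n \<omega> t\<bar> \<le> max \<bar>\<omega> t - \<omega> (node T n i)\<bar> \<bar>\<omega> t - \<omega> (node T n (Suc i))\<bar>"
      "\<bar>t - node T n i\<bar> \<le> T / 2 ^ n" "\<bar>t - node T n (Suc i)\<bar> \<le> T / 2 ^ n"
      using interp_minus_point_le[OF T t] by metis
    have "T / 2 ^ n < d" using N[OF n] by (simp add: power_one_over field_simps)
    then have "dist t (node T n i) < d" "dist t (node T n (Suc i)) < d"
      using i by (auto simp: dist_real_def)
    moreover have "node T n i \<in> {0..T}" "node T n (Suc i) \<in> {0..T}"
      using i(1) by (auto intro!: node_in[OF T] simp del: atLeastAtMost_iff)
    ultimately have "dist (\<omega> t) (\<omega> (node T n i)) < e" "dist (\<omega> t) (\<omega> (node T n (Suc i))) < e"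
      using t by (auto intro!: d(2))
    then show "\<bar>\<omega> t - interp T n \<omega> t\<bar> \<le> e" using i(2) by (simp add: dist_real_def)
  qed
qed

section \<open>A compact set of paths\<close>

text \<open>
  Paths that are approximated by their interpolations at a geometric rate. Stating regularity in this way
  keeps every condition closed for pointwise convergence.
\<close>

definition regular_paths :: "real \<Rightarrow> real \<Rightarrow> (real \<Rightarrow> real) set" where
  "regular_paths T a = {f \<in> extensional {0..T}. \<bar>f 0\<bar> \<le> 1 \<and> \<bar>f T\<bar> \<le> 1 + a \<and>
     (\<forall>n. \<forall>t\<in>{0..T}. \<bar>f t - interp T n f t\<bar> \<le> 10 * a * (9/10) ^ n)}"

lemma geometric_tail_small: "0 < e \<Longrightarrow> \<exists>n. 10 * a * (9/10) ^ n \<le> (e::real)"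
proof -
  assume e: "0 < e"
  have "(\<lambda>n. 10 * a * (9/10) ^ n) \<longlonglongrightarrow> 10 * a * 0" by (intro tendsto_mult tendsto_const LIMSEQ_power_zero) auto
  then have "eventually (\<lambda>n. 10 * a * (9/10) ^ n < e) sequentially" using e by (intro order_tendstoD(2)) auto
  then obtain n where "10 * a * (9/10) ^ n < e" unfolding eventually_sequentially by blast
  then show ?thesis by (intro exI[of _ n]) simp
qed

lemma regular_paths_subset_paths:
  assumes T: "0 < T"
  shows "regular_paths T a \<subseteq> mspace (path_metric T)"
proof
  fix f assume f: "f \<in> regular_paths T a"
  have "uniform_limit {0..T} (\<lambda>n. interp T n f) f sequentially"
  proof (rule uniform_limitI)
    fix e :: real assume e: "0 < e"
    obtain n0 where n0: "10 * a * (9/10) ^ n0 \<le> e / 2" using geometric_tail_small[of "e/2" a] e by auto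
    have "dist (interp T n f t) (f t) < e" if n: "n0 \<le> n" and t: "t \<in> {0..T}" for n t
    proof -
      have b: "\<bar>f t - interp T n f t\<bar> \<le> 10 * a * (9/10) ^ n" using f t unfolding regular_paths_def by blast
      have "10 * a * (9/10) ^ n \<le> max 0 (10 * a * (9/10) ^ n0)"
      proof (cases "0 \<le> a")
        case True
        then have "10 * a * (9/10) ^ n \<le> 10 * a * (9/10) ^ n0" using n by (intro mult_left_mono power_decreasing) auto
        then show ?thesis by simp
      next
        case False
        then show ?thesis by (simp add: mult_nonpos_nonneg)
      qed
      then show ?thesis using b n0 e by (simp add: dist_real_def abs_minus_commute)
    qed
    then show "\<forall>\<^sub>F n in sequentially. \<forall>t\<in>{0..T}. dist (interp T n f t) (f t) < e"
      unfolding eventually_sequentially by blast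
  qed
  then have "continuous_on {0..T} f"
    by (rule uniform_limit_theorem[rotated]) (auto intro!: always_eventually interp_continuous T)
  then show "f \<in> mspace (path_metric T)" using f by (auto simp: mspace_path_metric regular_paths_def)
qed

lemma regular_paths_bound:
  assumes T: "0 < T" and a: "0 \<le> a" and f: "f \<in> regular_paths T a" and t: "t \<in> {0..T}"
  shows "\<bar>f t\<bar> \<le> 1 + 11 * a"
proof -
  have "\<bar>f t - interp T 0 f t\<bar> \<le> 10 * a * (9/10) ^ 0" using f t unfolding regular_paths_def by blast
  then have "\<bar>f t - interp T 0 f t\<bar> \<le> 10 * a" by simp
  moreover have "\<bar>interp T 0 f t - interp T 0 (\<lambda>_. 0) t\<bar> \<le> 1 + a"
  proof (rule interp_diff_le[OF T t])
    fix i :: nat assume "i \<le> 2 ^ 0"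
    then have "i = 0 \<or> i = 1" by auto
    then show "\<bar>f (node T 0 i) - 0\<bar> \<le> 1 + a" using f a unfolding regular_paths_def node_def by auto
  qed
  moreover have "interp T 0 (\<lambda>_. 0) t = 0" using t by (simp add: interp_def)
  ultimately show ?thesis by linarith
qed

lemma continuous_interp_arg: "continuous_on A (\<lambda>f. interp T n f t)"
proof (cases "t \<in> {0..T}")
  case True
  then have "(\<lambda>f. interp T n f t) = (\<lambda>f. \<Sum>i\<le>2 ^ n. max 0 (1 - \<bar>t * 2 ^ n / T - real i\<bar>) * f (node T n i))"
    by (simp add: interp_def)
  moreover have "continuous_on UNIV (\<lambda>f::real \<Rightarrow> real. \<Sum>i\<le>2 ^ n. max 0 (1 - \<bar>t * 2 ^ n / T - real i\<bar>) * f (node T n i))"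
    by (intro continuous_intros continuous_on_product_coordinates)
  ultimately have "continuous_on UNIV (\<lambda>f. interp T n f t)" by (simp only:)
  then show ?thesis by (rule continuous_on_subset) simp
next
  case False
  then have eq: "(\<lambda>f. interp T n f t) = (\<lambda>f. undefined)" by (auto simp: interp_def)
  show ?thesis unfolding eq by (rule continuous_on_const)
qed

text \<open>
  Compactness for pointwise convergence on all of \<^typ>\<open>real \<Rightarrow> real\<close>.
\<close>

lemma compact_regular_paths:
  assumes T: "0 < T" and a: "0 \<le> a"
  shows "compact (regular_paths T a)"
proof -
  define S where "S t = (if t \<in> {0..T} then {-(1 + 11 * a)..1 + 11 * a} else {undefined})" for t :: real
  have "compact {f. \<forall>t. f t \<in> S t}" by (rule compact_Pi) (auto simp: S_def)
  moreover have "closed {f :: real \<Rightarrow> real. \<bar>f 0\<bar> \<le> 1}" "closed {f :: real \<Rightarrow> real. \<bar>f T\<bar> \<le> 1 + a}"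
    by (intro closed_Collect_le continuous_intros continuous_on_product_coordinates)+
  moreover have "closed {f. \<bar>f t - interp T n f t\<bar> \<le> 10 * a * (9/10) ^ n}" for t n
    by (intro closed_Collect_le continuous_intros continuous_on_product_coordinates continuous_interp_arg)
  ultimately have "compact ({f. \<forall>t. f t \<in> S t} \<inter> ({f. \<bar>f 0\<bar> \<le> 1} \<inter> {f. \<bar>f T\<bar> \<le> 1 + a} \<inter>
      (\<Inter>n. \<Inter>t\<in>{0..T}. {f. \<bar>f t - interp T n f t\<bar> \<le> 10 * a * (9/10) ^ n})))"
    by (intro compact_Int_closed closed_Int closed_INT ballI) auto
  moreover have "{f. \<forall>t. f t \<in> S t} \<inter> ({f. \<bar>f 0\<bar> \<le> 1} \<inter> {f. \<bar>f T\<bar> \<le> 1 + a} \<inter>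
      (\<Inter>n. \<Inter>t\<in>{0..T}. {f. \<bar>f t - interp T n f t\<bar> \<le> 10 * a * (9/10) ^ n})) = regular_paths T a" (is "?L = _")
  proof
    show "?L \<subseteq> regular_paths T a"
      unfolding regular_paths_def S_def extensional_def by auto
    show "regular_paths T a \<subseteq> ?L"
    proof
      fix f assume f: "f \<in> regular_paths T a"
      have "f t \<in> S t" for t
      proof (cases "t \<in> {0..T}")
        case True
        then show ?thesis using regular_paths_bound[OF T a f True] by (auto simp: S_def abs_le_iff)
      next
        case False
        then show ?thesis using f unfolding regular_paths_def extensional_def S_def by auto
      qed
      then show "f \<in> ?L" using f unfolding regular_paths_def by blast
    qed
  qed
  ultimately show ?thesis by simp
qed

lemma interp_in_regular_paths:
  assumes T: "0 < T" and a: "0 \<le> a" and 0: "\<bar>\<omega> 0\<bar> \<le> 1"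
    and d: "\<And>j i. j \<le> m \<Longrightarrow> i < 2 ^ j \<Longrightarrow> \<bar>incr T j i \<omega>\<bar> \<le> a * (9/10) ^ j"
  shows "interp T m \<omega> \<in> regular_paths T a"
proof -
  have "\<bar>incr T 0 0 \<omega>\<bar> \<le> a" using d[of 0 0] by simp
  then have T1: "\<bar>\<omega> T\<bar> \<le> 1 + a" using 0 by (simp add: incr_def node_def)
  have "\<bar>interp T m \<omega> t - interp T n (interp T m \<omega>) t\<bar> \<le> 10 * a * (9/10) ^ n" if t: "t \<in> {0..T}" for n t
  proof (cases "m \<le> n")
    case True
    then show ?thesis using interp_interp_finer[OF T t True] a by simp
  next
    case False
    then have "n \<le> m" by simp
    have "\<bar>interp T m \<omega> t - interp T n \<omega> t\<bar> \<le> 10 * a * ((9/10) ^ n - (9/10) ^ m)"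
      by (rule interp_chain_le[OF T t a \<open>n \<le> m\<close>]) (rule d)
    also have "\<dots> \<le> 10 * a * (9/10) ^ n" using a by (intro mult_left_mono) auto
    finally show ?thesis using interp_interp_coarser[OF T \<open>n \<le> m\<close>] by simp
  qed
  then show ?thesis unfolding regular_paths_def using interp_extensional T1 0 interp_0[OF T] interp_T[OF T] by auto
qed

lemma path_in_regular_paths:
  assumes T: "0 < T" and a: "0 \<le> a" and \<omega>: "\<omega> \<in> mspace (path_metric T)" and 0: "\<bar>\<omega> 0\<bar> \<le> 1"
    and d: "\<And>j i. i < 2 ^ j \<Longrightarrow> \<bar>incr T j i \<omega>\<bar> \<le> a * (9/10) ^ j"
  shows "\<omega> \<in> regular_paths T a"
proof -
  have c: "continuous_on {0..T} \<omega>" and e: "\<omega> \<in> extensional {0..T}" using \<omega> by (auto simp: mspace_path_metric)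
  have "\<bar>incr T 0 0 \<omega>\<bar> \<le> a" using d[of 0 0] by simp
  then have T1: "\<bar>\<omega> T\<bar> \<le> 1 + a" using 0 by (simp add: incr_def node_def)
  have "\<bar>\<omega> t - interp T n \<omega> t\<bar> \<le> 10 * a * (9/10) ^ n" if t: "t \<in> {0..T}" for n t
  proof (rule field_le_epsilon)
    fix e :: real assume "0 < e"
    then obtain N where N: "\<And>k t. k \<ge> N \<Longrightarrow> t \<in> {0..T} \<Longrightarrow> \<bar>\<omega> t - interp T k \<omega> t\<bar> \<le> e"
      using interp_uniform_limit[OF T c] by metis
    define m where "m = max N n"
    have "\<bar>interp T m \<omega> t - interp T n \<omega> t\<bar> \<le> 10 * a * ((9/10) ^ n - (9/10) ^ m)"
      using d by (intro interp_chain_le[OF T t a]) (auto simp: m_def)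
    also have "\<dots> \<le> 10 * a * (9/10) ^ n" using a by (intro mult_left_mono) auto
    finally show "\<bar>\<omega> t - interp T n \<omega> t\<bar> \<le> 10 * a * (9/10) ^ n + e"
      using N[of m t] t by (simp add: m_def)
  qed
  then show ?thesis unfolding regular_paths_def using e 0 T1 by auto
qed

section \<open>Sublinear expectations with a moment bound\<close>

text \<open>
  A sublinear expectation on cylinder functions whose increments satisfy Kolmogorov's moment condition
  and whose canonical process starts at zero. Truncation keeps the moments inside \<open>Lip T\<close>.
\<close>

locale moment_bound =
  fixes T M :: real and E :: "((real \<Rightarrow> real) \<Rightarrow> real) \<Rightarrow> real"
  assumes T: "0 < T" and M: "0 \<le> M" and E: "sublinear_on (Lip T) E"
    and moment: "\<And>c s t. 0 \<le> c \<Longrightarrow> 0 \<le> s \<Longrightarrow> s < t \<Longrightarrow> t \<le> T \<Longrightarrow> E (\<lambda>\<omega>. clip c (\<omega> t - \<omega> s) ^ 4) \<le> M * (t - s)\<^sup>2"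
    and start: "E (\<lambda>\<omega>. clip 1 (\<omega> 0) ^ 4) \<le> 0"
begin

lemma T0: "0 \<le> T" using T by simp

lemma E_props:
  "\<forall>X\<in>Lip T. \<forall>Y\<in>Lip T. (\<forall>w. X w \<le> Y w) \<longrightarrow> E X \<le> E Y"
  "\<forall>c. E (\<lambda>_. c) = c"
  "\<forall>X\<in>Lip T. \<forall>Y\<in>Lip T. E (\<lambda>w. X w + Y w) \<le> E X + E Y"
  "\<forall>X\<in>Lip T. \<forall>c\<ge>0. E (\<lambda>w. c * X w) = c * E X"
  using E[unfolded sublinear_on_def] by - (elim conjE, assumption)+

lemma E_mono: "X \<in> Lip T \<Longrightarrow> Y \<in> Lip T \<Longrightarrow> (\<And>\<omega>. X \<omega> \<le> Y \<omega>) \<Longrightarrow> E X \<le> E Y"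
  by (rule E_props(1)[rule_format])
lemma E_const: "E (\<lambda>_. c) = c"
  by (rule E_props(2)[rule_format])
lemma E_add: "X \<in> Lip T \<Longrightarrow> Y \<in> Lip T \<Longrightarrow> E (\<lambda>\<omega>. X \<omega> + Y \<omega>) \<le> E X + E Y"
  by (rule E_props(3)[rule_format])
lemma E_scale: "X \<in> Lip T \<Longrightarrow> 0 \<le> c \<Longrightarrow> E (\<lambda>\<omega>. c * X \<omega>) = c * E X"
  by (rule E_props(4)[rule_format])
lemma E_sum: "(\<And>i. i \<in> A \<Longrightarrow> X i \<in> Lip T) \<Longrightarrow> E (\<lambda>\<omega>. \<Sum>i\<in>A. X i \<omega>) \<le> (\<Sum>i\<in>A. E (X i))"
proof (induction A rule: infinite_finite_induct)
  case (insert x F)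
  have "E (\<lambda>\<omega>. X x \<omega> + (\<Sum>i\<in>F. X i \<omega>)) \<le> E (X x) + E (\<lambda>\<omega>. \<Sum>i\<in>F. X i \<omega>)"
    using insert by (intro E_add Lip_sum T0) auto
  then show ?case using insert by fastforce
qed (auto simp: E_const)

lemma sublinear_functional_E: "sublinear_functional (Lip T) E"
  unfolding sublinear_functional_def using E_props(3,4) by (intro conjI)

lemma moment_le: 
  assumes "0 \<le> c" "s \<in> {0..T}" "t \<in> {0..T}"
  shows "E (\<lambda>\<omega>. clip c (\<omega> t - \<omega> s) ^ 4) \<le> M * (t - s)\<^sup>2"
proof -
  consider "s < t" | "t < s" | "s = t" by linarith
  then show ?thesis
  proof cases
    case 1 then show ?thesis using moment assms by auto
  next
    case 2
    have "clip c (\<omega> t - \<omega> s) ^ 4 = clip c (\<omega> s - \<omega> t) ^ 4" for \<omega> :: "real \<Rightarrow> real"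
      using clip_uminus[OF assms(1), of "\<omega> s - \<omega> t"] by simp
    then show ?thesis using moment[of c t s] assms 2 by (simp add: power2_commute)
  next
    case 3
    then show ?thesis using assms E_const[of 0] by (simp add: clip_0)
  qed
qed

text \<open>
  A cylinder function that is at least \<open>1\<close> unless the initial value and all dyadic increments up to
  level \<open>m\<close> are small.
\<close>

definition roughness :: "real \<Rightarrow> nat \<Rightarrow> (real \<Rightarrow> real) \<Rightarrow> real" where
  "roughness a m \<omega> = clip 1 (\<omega> 0) ^ 4 + (\<Sum>j\<le>m. \<Sum>i<2 ^ j. clip 1 (incr T j i \<omega> / (a * (9/10) ^ j)) ^ 4)"

lemma clip_incr_Lip:
  assumes "0 < b" "i < 2 ^ j"
  shows "(\<lambda>\<omega>. clip 1 (incr T j i \<omega> / b)) \<in> Lip T"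
proof -
  have "(\<lambda>\<omega>. 1 / b * clip b (\<omega> (node T j (Suc i)) - \<omega> (node T j i))) \<in> Lip T"
    using assms by (intro Lip_scale Lip_clip_diff T0 node_in T) auto
  then show ?thesis using assms by (simp add: incr_def clip_scale)
qed

lemma roughness_Lip: "0 < a \<Longrightarrow> roughness a m \<in> Lip T"
  unfolding roughness_def[abs_def] by (intro Lip_add Lip_sum Lip_power clip_incr_Lip Lip_clip_coord T0) (auto simp: T0)

lemma roughness_nonneg: "0 \<le> roughness a m \<omega>" unfolding roughness_def by (intro add_nonneg_nonneg sum_nonneg) auto

lemma roughness_mono: "roughness a m \<omega> \<le> roughness a (Suc m) \<omega>" unfolding roughness_def by (auto intro!: sum_nonneg)

lemma E_roughness_le:
  assumes a: "0 < a"
  shows "E (roughness a m) \<le> 5 * M * T\<^sup>2 / a ^ 4"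
proof -
  let ?b = "\<lambda>j. a * (9/10) ^ j"
  have b: "0 < ?b j" for j using a by simp
  have quot4: "(x / y) ^ 4 = 1 / y ^ 4 * x ^ 4" for x y :: real by (simp add: power_divide)
  have single: "E (\<lambda>\<omega>. clip 1 (incr T j i \<omega> / ?b j) ^ 4) \<le> M * T\<^sup>2 / a ^ 4 * ((1/4) / (9/10) ^ 4) ^ j" if i: "i < 2 ^ j" for i j
  proof -
    have "(\<lambda>\<omega>. clip 1 (incr T j i \<omega> / ?b j) ^ 4) = (\<lambda>\<omega>. 1 / ?b j ^ 4 * clip (?b j) (\<omega> (node T j (Suc i)) - \<omega> (node T j i)) ^ 4)"
      by (simp only: incr_def clip_scale[OF b] quot4)
    then have "E (\<lambda>\<omega>. clip 1 (incr T j i \<omega> / ?b j) ^ 4) =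
       1 / ?b j ^ 4 * E (\<lambda>\<omega>. clip (?b j) (\<omega> (node T j (Suc i)) - \<omega> (node T j i)) ^ 4)"
      using b[of j] i by (simp only:) (intro E_scale Lip_power Lip_clip_diff T0 node_in T, auto)
    also have "\<dots> \<le> 1 / ?b j ^ 4 * (M * (node T j (Suc i) - node T j i)\<^sup>2)"
      using b[of j] i by (intro mult_left_mono moment_le node_in T) auto
    also have "node T j (Suc i) - node T j i = T / 2 ^ j" by (simp add: node_def field_simps)
    also have "1 / ?b j ^ 4 * (M * (T / 2 ^ j)\<^sup>2) = M * T\<^sup>2 / a ^ 4 * ((1/4) / (9/10) ^ 4) ^ j"
    proof -
      define u :: real where "u = ((9/10) ^ 4) ^ j"
      define v :: real where "v = 4 ^ j"
      have swap: "(x ^ j) ^ k = (x ^ k) ^ j" for x :: real and k by (metis power_mult mult.commute)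
      have "(2 ^ j)\<^sup>2 = v" unfolding v_def swap by simp
      moreover have "?b j ^ 4 = a ^ 4 * u"
        unfolding u_def by (simp only: power_mult_distrib swap)
      moreover have "((1/4) / (9/10) ^ 4) ^ j = 1 / v / u"
        unfolding u_def v_def by (simp only: power_divide power_one)
      ultimately show ?thesis by (simp only: power_divide) simp
    qed
    finally show ?thesis .
  qed
  \<comment> \<open>level \<open>j\<close> has \<open>2\<^sup>j\<close> cells, so the levels form a geometric series of ratio \<open>(1/2) / (9/10)\<^sup>4\<close>\<close>
  have "E (roughness a m) \<le> E (\<lambda>\<omega>. clip 1 (\<omega> 0) ^ 4) + E (\<lambda>\<omega>. \<Sum>j\<le>m. \<Sum>i<2 ^ j. clip 1 (incr T j i \<omega> / ?b j) ^ 4)"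
    unfolding roughness_def[abs_def] using b by (intro E_add Lip_sum Lip_power clip_incr_Lip Lip_clip_coord T0) (auto simp: T0)
  also have "\<dots> \<le> 0 + (\<Sum>j\<le>m. \<Sum>i<2 ^ j. E (\<lambda>\<omega>. clip 1 (incr T j i \<omega> / ?b j) ^ 4))"
    using b by (intro add_mono start order.trans[OF E_sum] sum_mono E_sum Lip_sum Lip_power clip_incr_Lip T0) auto
  also have "\<dots> \<le> 0 + (\<Sum>j\<le>m. \<Sum>i<(2::nat) ^ j. M * T\<^sup>2 / a ^ 4 * ((1/4) / (9/10) ^ 4) ^ j)"
    by (intro add_left_mono sum_mono single) auto
  also have "\<dots> = M * T\<^sup>2 / a ^ 4 * (\<Sum>j\<le>m. ((1/2) / (9/10) ^ 4) ^ j)"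
  proof -
    have e: "2 ^ j * ((1/4) / (9/10) ^ 4) ^ j = ((1/2) / (9/10) ^ 4 :: real) ^ j" for j
      unfolding power_mult_distrib[symmetric] by simp
    have "(\<Sum>i<(2::nat) ^ j. c * x) = c * (2 ^ j * x)" for c x :: real and j by simp
    then show ?thesis by (simp only: e sum_distrib_left add_0)
  qed
  also have "\<dots> \<le> M * T\<^sup>2 / a ^ 4 * 5"
  proof (rule mult_left_mono)
    define r :: real where "r = (1/2) / (9/10) ^ 4"
    have r: "r \<le> 4/5" "0 \<le> r" by (auto simp: power4_eq_xxxx r_def)
    have "1/5 * (\<Sum>j\<le>m. r ^ j) \<le> (1 - r) * (\<Sum>j\<le>m. r ^ j)"
      using r by (intro mult_right_mono sum_nonneg) auto
    also have "\<dots> = 1 - r ^ Suc m" using sum_gp_basic[of r m] by simp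
    also have "\<dots> \<le> 1" using r by simp
    finally have "1/5 * (\<Sum>j\<le>m. r ^ j) \<le> 1" .
    then show "(\<Sum>j\<le>m. ((1/2) / (9/10) ^ 4 :: real) ^ j) \<le> 5" by (simp only: r_def[symmetric])
    show "0 \<le> M * T\<^sup>2 / a ^ 4" using M a by simp
  qed
  also have "\<dots> = 5 * M * T\<^sup>2 / a ^ 4" by simp
  finally show ?thesis .
qed

lemma increments_small_if_roughness_less_1:
  assumes a: "0 < a" and b: "roughness a m \<omega> < 1"
  shows "\<bar>\<omega> 0\<bar> \<le> 1" and "j \<le> m \<Longrightarrow> i < 2 ^ j \<Longrightarrow> \<bar>incr T j i \<omega>\<bar> \<le> a * (9/10) ^ j"
proof -
  have p4: "0 \<le> (x::real) ^ 4" for x by simp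
  have c: "\<bar>x\<bar> \<le> 1" if "clip 1 x ^ 4 < 1" for x
  proof (rule ccontr)
    assume "\<not> \<bar>x\<bar> \<le> 1"
    then have "\<bar>clip 1 x\<bar> = 1" by (simp add: abs_clip)
    then have "\<bar>clip 1 x\<bar> ^ 4 = 1" by simp
    then show False using that by (simp add: power_abs)
  qed
  let ?S = "\<Sum>j\<le>m. \<Sum>i<2 ^ j. clip 1 (incr T j i \<omega> / (a * (9/10) ^ j)) ^ 4"
  have "0 \<le> ?S" by (intro sum_nonneg) auto
  then show "\<bar>\<omega> 0\<bar> \<le> 1" using b c[of "\<omega> 0"] unfolding roughness_def by simp
  assume ji: "j \<le> m" "i < 2 ^ j"
  have "clip 1 (incr T j i \<omega> / (a * (9/10) ^ j)) ^ 4 \<le> (\<Sum>i<2 ^ j. clip 1 (incr T j i \<omega> / (a * (9/10) ^ j)) ^ 4)"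
    using ji by (intro member_le_sum) auto
  also have "\<dots> \<le> ?S" using ji by (intro member_le_sum[of j "{..m}"] sum_nonneg) auto
  finally have "clip 1 (incr T j i \<omega> / (a * (9/10) ^ j)) ^ 4 < 1" using b p4[of "clip 1 (\<omega> 0)"] unfolding roughness_def by linarith
  from c[OF this] show "\<bar>incr T j i \<omega>\<bar> \<le> a * (9/10) ^ j" using a by (simp add: abs_mult divide_le_eq)
qed

lemma interp_Lip:
  assumes "\<And>\<omega>. \<bar>g (interp T n \<omega>)\<bar> \<le> B"
    "\<And>\<omega> \<omega>' d. (\<And>t. t \<in> {0..T} \<Longrightarrow> \<bar>interp T n \<omega> t - interp T n \<omega>' t\<bar> \<le> d) \<Longrightarrow> \<bar>g (interp T n \<omega>) - g (interp T n \<omega>')\<bar> \<le> L * d"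
  shows "(\<lambda>\<omega>. g (interp T n \<omega>)) \<in> Lip T"
proof (rule LipI[OF T0, where F="node T n ` {..2 ^ n}" and K=B and L=L])
  show "finite (node T n ` {..2 ^ n})" "node T n ` {..2 ^ n} \<subseteq> {0..T}" using node_in[OF T] by (auto simp del: atLeastAtMost_iff)
  fix \<omega> \<omega>' :: "real \<Rightarrow> real"
  show "\<bar>g (interp T n \<omega>) - g (interp T n \<omega>')\<bar> \<le> L * (\<Sum>t\<in>node T n ` {..2 ^ n}. \<bar>\<omega> t - \<omega>' t\<bar>)"
    by (intro assms(2) interp_diff_le[OF T] member_le_sum) auto
qed (rule assms(1))

lemma Lip_comp_interp: "X \<in> Lip T \<Longrightarrow> (\<lambda>\<omega>. X (interp T n \<omega>)) \<in> Lip T"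
proof -
  assume X: "X \<in> Lip T"
  obtain F K L where 1: "finite F" "F \<subseteq> {0..T}" "0 < L" "\<And>\<omega>. \<bar>X \<omega>\<bar> \<le> K" 
    "\<And>\<omega> \<omega>'. \<bar>X \<omega> - X \<omega>'\<bar> \<le> L * (\<Sum>t\<in>F. \<bar>\<omega> t - \<omega>' t\<bar>)" by (rule LipD[OF X]) blast
  show ?thesis
  proof (rule interp_Lip[where L="L * real (card F)"])
    fix \<omega> \<omega>' :: "real \<Rightarrow> real" and d
    assume d: "\<And>t. t \<in> {0..T} \<Longrightarrow> \<bar>interp T n \<omega> t - interp T n \<omega>' t\<bar> \<le> d"
    have "(\<Sum>t\<in>F. \<bar>interp T n \<omega> t - interp T n \<omega>' t\<bar>) \<le> (\<Sum>t\<in>F. d)" using 1(2) by (intro sum_mono d) auto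
    then have "L * (\<Sum>t\<in>F. \<bar>interp T n \<omega> t - interp T n \<omega>' t\<bar>) \<le> L * (real (card F) * d)" using 1(3) by simp
    then show "\<bar>X (interp T n \<omega>) - X (interp T n \<omega>')\<bar> \<le> L * real (card F) * d" 
      using 1(5)[of "interp T n \<omega>" "interp T n \<omega>'"] by (simp add: mult.assoc)
  qed (rule 1(4))
qed

end

section \<open>Tightness of dominated functionals\<close>

context moment_bound begin

text \<open>
  Linear functionals on \<open>Lip T\<close> below \<open>E\<close>.
\<close>

definition dominated_functional :: "(((real \<Rightarrow> real) \<Rightarrow> real) \<Rightarrow> real) \<Rightarrow> bool" where
  "dominated_functional l \<longleftrightarrow> linear_functional (Lip T) l \<and> (\<forall>X\<in>Lip T. l X \<le> E X)"

lemma tail_small: "0 < e \<Longrightarrow> \<exists>a>0. 5 * M * T\<^sup>2 / a ^ 4 < e"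
proof -
  assume e: "0 < e"
  have "((\<lambda>a. 5 * M * T\<^sup>2 / a ^ 4) \<longlongrightarrow> 0) at_top"
    by (intro tendsto_divide_0[OF tendsto_const] filterlim_at_top_imp_at_infinity filterlim_pow_at_top filterlim_ident) auto
  then have "eventually (\<lambda>a. 5 * M * T\<^sup>2 / a ^ 4 < e) at_top" using e by (intro order_tendstoD(2)) auto
  then obtain N where N: "\<And>a. a \<ge> N \<Longrightarrow> 5 * M * T\<^sup>2 / a ^ 4 < e" unfolding eventually_at_top_linorder by blast
  show ?thesis by (rule exI[of _ "max N 1"]) (use N[of "max N 1"] in auto)
qed

context
  fixes l assumes l: "dominated_functional l"
begin

lemma l_props:
  "\<forall>X\<in>Lip T. \<forall>Y\<in>Lip T. l (\<lambda>w. X w + Y w) = l X + l Y"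
  "\<forall>X\<in>Lip T. \<forall>c. l (\<lambda>w. c * X w) = c * l X"
  "\<forall>X\<in>Lip T. l X \<le> E X"
  using l[unfolded dominated_functional_def linear_functional_def] by - (elim conjE, assumption)+

lemma l_add: "X \<in> Lip T \<Longrightarrow> Y \<in> Lip T \<Longrightarrow> l (\<lambda>\<omega>. X \<omega> + Y \<omega>) = l X + l Y"
  by (rule l_props(1)[rule_format])
lemma l_scale: "X \<in> Lip T \<Longrightarrow> l (\<lambda>\<omega>. c * X \<omega>) = c * l X"
  by (rule l_props(2)[rule_format])
lemma l_le: "X \<in> Lip T \<Longrightarrow> l X \<le> E X"
  by (rule l_props(3)[rule_format])

lemma l_diff: "X \<in> Lip T \<Longrightarrow> Y \<in> Lip T \<Longrightarrow> l (\<lambda>\<omega>. X \<omega> - Y \<omega>) = l X - l Y"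
  using l_add[OF _ Lip_scale[OF T0, of Y "-1"], of X] l_scale[of Y "-1"] by simp

lemma l_mono_pointwise: "X \<in> Lip T \<Longrightarrow> Y \<in> Lip T \<Longrightarrow> (\<And>\<omega>. X \<omega> \<le> Y \<omega>) \<Longrightarrow> l X \<le> l Y"
proof -
  assume XY: "X \<in> Lip T" "Y \<in> Lip T" and le: "\<And>\<omega>. X \<omega> \<le> Y \<omega>"
  have d: "(\<lambda>\<omega>. X \<omega> - Y \<omega>) \<in> Lip T" by (intro Lip_diff T0 XY)
  have "E (\<lambda>\<omega>. X \<omega> - Y \<omega>) \<le> E (\<lambda>_. 0)" using le by (intro E_mono d Lip_const T0) simp
  then show ?thesis using l_le[OF d] E_const[of 0] l_diff[OF XY] by simp
qed

lemma l_const: "l (\<lambda>_. c) = c"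
proof -
  have "l (\<lambda>_. c) \<le> c" "l (\<lambda>_. - c) \<le> - c" using l_le[OF Lip_const[OF T0]] E_const by auto
  moreover have "l (\<lambda>_. - c) = - l (\<lambda>_. c)" using l_scale[OF Lip_const[OF T0], of "-1" c] by simp
  ultimately show ?thesis by simp
qed

text \<open>
  Either the interpolated path is regular, or the roughness is at least \<open>1\<close>.
\<close>

lemma l_tight_dyadic:
  assumes X: "X \<in> Lip T" and X1: "\<And>\<omega>. X \<omega> \<le> 1" and d0: "0 \<le> d" and a: "0 < a"
    and Xd: "\<And>\<omega>. \<omega> \<in> regular_paths T a \<Longrightarrow> X \<omega> \<le> d"
  shows "l (\<lambda>\<omega>. X (interp T m \<omega>)) \<le> d + 5 * M * T\<^sup>2 / a ^ 4"
proof -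
  have XI: "(\<lambda>\<omega>. X (interp T m \<omega>)) \<in> Lip T" by (rule Lip_comp_interp[OF X])
  have B: "roughness a m \<in> Lip T" by (rule roughness_Lip[OF a])
  have "X (interp T m \<omega>) \<le> d + roughness a m \<omega>" for \<omega>
  proof (cases "roughness a m \<omega> < 1")
    case True
    have "interp T m \<omega> \<in> regular_paths T a"
      by (rule interp_in_regular_paths[OF T]) (use a increments_small_if_roughness_less_1[OF a True] in auto)
    then show ?thesis using Xd roughness_nonneg[of a m \<omega>] by fastforce
  next
    case False
    then show ?thesis using X1[of "interp T m \<omega>"] d0 by simp
  qed
  then have "l (\<lambda>\<omega>. X (interp T m \<omega>)) \<le> l (\<lambda>\<omega>. d + roughness a m \<omega>)"
    by (intro l_mono_pointwise XI Lip_add Lip_const T0 B)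
  also have "\<dots> = d + l (roughness a m)" using l_add[OF Lip_const[OF T0] B, of d] l_const by simp
  also have "\<dots> \<le> d + 5 * M * T\<^sup>2 / a ^ 4" using l_le[OF B] E_roughness_le[OF a, of m] by simp
  finally show ?thesis .
qed

text \<open>
  Cylinder functions may be evaluated along interpolated paths, since the moment condition controls the
  distance between the path at a given time and at the neighbouring dyadic times.
\<close>

lemma l_interp_approx:
  assumes X: "X \<in> Lip T" and e: "0 < e"
  shows "\<exists>m. l X \<le> l (\<lambda>\<omega>. X (interp T m \<omega>)) + e"
proof -
  obtain F K L where F: "finite F" "F \<subseteq> {0..T}" "F \<noteq> {}" and L: "0 < L" and K: "0 < K" "\<And>\<omega>. \<bar>X \<omega>\<bar> \<le> K" 
    and XL: "\<And>\<omega> \<omega>'. \<bar>X \<omega> - X \<omega>'\<bar> \<le> L * (\<Sum>t\<in>F. \<bar>\<omega> t - \<omega>' t\<bar>)" by (rule LipD[OF X]) blast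
  define c where "c = 2 * K / L"
  have c: "0 < c" using K L by (simp add: c_def)
  define \<delta> where "\<delta> = e / (2 * L * real (card F) * 2)"
  have cF: "0 < card F" using F by (simp add: card_gt_0_iff)
  then have \<delta>: "0 < \<delta>" using e L by (simp add: \<delta>_def)
  have "(\<lambda>n. M * T\<^sup>2 / \<delta> ^ 3 * (1/4) ^ n) \<longlonglongrightarrow> M * T\<^sup>2 / \<delta> ^ 3 * 0" by (intro tendsto_mult tendsto_const LIMSEQ_power_zero) auto
  then have "eventually (\<lambda>n. M * T\<^sup>2 / \<delta> ^ 3 * (1/4) ^ n < \<delta>) sequentially" using \<delta> by (intro order_tendstoD(2)) auto
  then obtain m where m: "M * T\<^sup>2 / \<delta> ^ 3 * (1/4) ^ m < \<delta>" unfolding eventually_sequentially by blast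
  have "\<exists>i. i < 2 ^ m \<and> (\<forall>\<omega>. \<bar>\<omega> t - interp T m \<omega> t\<bar> \<le> max \<bar>\<omega> t - \<omega> (node T m i)\<bar> \<bar>\<omega> t - \<omega> (node T m (Suc i))\<bar>) \<and>
    \<bar>t - node T m i\<bar> \<le> T / 2 ^ m \<and> \<bar>t - node T m (Suc i)\<bar> \<le> T / 2 ^ m" if "t \<in> F" for t
    using interp_minus_point_le[OF T, of t m] F(2) that by blast
  then obtain i where i: "\<And>t. t \<in> F \<Longrightarrow> i t < 2 ^ m"
    "\<And>t \<omega>. t \<in> F \<Longrightarrow> \<bar>\<omega> t - interp T m \<omega> t\<bar> \<le> max \<bar>\<omega> t - \<omega> (node T m (i t))\<bar> \<bar>\<omega> t - \<omega> (node T m (Suc (i t)))\<bar>"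
    "\<And>t. t \<in> F \<Longrightarrow> \<bar>t - node T m (i t)\<bar> \<le> T / 2 ^ m" "\<And>t. t \<in> F \<Longrightarrow> \<bar>t - node T m (Suc (i t))\<bar> \<le> T / 2 ^ m"
    by metis
  let ?C = "\<lambda>t s \<omega>. clip c (\<omega> t - \<omega> s) ^ 4"
  have CL: "?C t s \<in> Lip T" if "t \<in> {0..T}" "s \<in> {0..T}" for t s
    using that c by (intro Lip_power Lip_clip_diff T0) auto
  have nI: "node T m (i t) \<in> {0..T}" "node T m (Suc (i t)) \<in> {0..T}" if "t \<in> F" for t
    using i(1)[OF that] by (auto intro!: node_in[OF T] simp del: atLeastAtMost_iff)
  \<comment> \<open>a bound of the truncated modulus by its fourth power, in which \<open>\<delta>\<close> is arbitrary\<close>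
  have young: "min c x \<le> \<delta> + min c x ^ 4 / \<delta> ^ 3" if "0 \<le> x" for x
  proof (cases "min c x \<le> \<delta>")
    case True
    then show ?thesis using c that \<delta> by (simp add: add_increasing2)
  next
    case False
    then have "\<delta> ^ 3 \<le> min c x ^ 3" using \<delta> by (intro power_mono) auto
    then have "min c x * \<delta> ^ 3 \<le> min c x * min c x ^ 3" using c that by (intro mult_left_mono) auto
    also have "\<dots> = min c x ^ 4" by (simp add: power_eq_if)
    finally have "min c x \<le> min c x ^ 4 / \<delta> ^ 3" using \<delta> by (simp add: le_divide_eq)
    then show ?thesis using \<delta> by simp
  qed
  have min_max: "min c x \<le> max (min c y) (min c z)" if "x \<le> max y z" for x y z :: real
    using that by linarith
  let ?Y = "\<lambda>\<omega>. \<Sum>t\<in>F. (2 * \<delta> + (1 / \<delta> ^ 3 * ?C t (node T m (i t)) \<omega> + 1 / \<delta> ^ 3 * ?C t (node T m (Suc (i t))) \<omega>))"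
  have YL: "(\<lambda>\<omega>. 2 * \<delta> + (1 / \<delta> ^ 3 * ?C t (node T m (i t)) \<omega> + 1 / \<delta> ^ 3 * ?C t (node T m (Suc (i t))) \<omega>)) \<in> Lip T"
    if "t \<in> F" for t using that F nI by (intro Lip_add Lip_const Lip_scale CL T0) auto
  have pt: "X \<omega> \<le> X (interp T m \<omega>) + L * ?Y \<omega>" for \<omega>
  proof -
    have le1: "min c \<bar>\<omega> t - interp T m \<omega> t\<bar> \<le> 2 * \<delta> + (1 / \<delta> ^ 3 * ?C t (node T m (i t)) \<omega> + 1 / \<delta> ^ 3 * ?C t (node T m (Suc (i t))) \<omega>)"
      if t: "t \<in> F" for t
    proof -
      have cl: "min c \<bar>\<omega> t - \<omega> s\<bar> \<le> \<delta> + 1 / \<delta> ^ 3 * ?C t s \<omega>" for s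
      proof -
        have "min c \<bar>\<omega> t - \<omega> s\<bar> = \<bar>clip c (\<omega> t - \<omega> s)\<bar>" using c by (simp add: abs_clip)
        then show ?thesis using young[of "\<bar>\<omega> t - \<omega> s\<bar>"] by (simp add: power_even_abs)
      qed
      have nn: "0 \<le> 1 / \<delta> ^ 3 * ?C t s \<omega>" for s using \<delta> by simp
      have comb: "x \<le> 2 * \<delta> + (u + v)" if "x \<le> max y z" "y \<le> \<delta> + u" "z \<le> \<delta> + v" "0 \<le> u" "0 \<le> v" for x y z u v :: real
        using that \<delta> by linarith
      have "min c \<bar>\<omega> t - interp T m \<omega> t\<bar> \<le> max (min c \<bar>\<omega> t - \<omega> (node T m (i t))\<bar>) (min c \<bar>\<omega> t - \<omega> (node T m (Suc (i t)))\<bar>)"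
        by (rule min_max) (rule i(2)[OF t])
      then show ?thesis by (rule comb) (rule cl cl nn nn)+
    qed
    have "\<bar>X \<omega> - X (interp T m \<omega>)\<bar> \<le> L * (\<Sum>t\<in>F. min c \<bar>\<omega> t - interp T m \<omega> t\<bar>)"
    proof (cases "\<exists>t\<in>F. c \<le> \<bar>\<omega> t - interp T m \<omega> t\<bar>")
      case True
      then obtain t where t: "t \<in> F" "c \<le> \<bar>\<omega> t - interp T m \<omega> t\<bar>" by blast
      have "c = min c \<bar>\<omega> t - interp T m \<omega> t\<bar>" using t by simp
      also have "\<dots> \<le> (\<Sum>t\<in>F. min c \<bar>\<omega> t - interp T m \<omega> t\<bar>)" using F t c by (intro member_le_sum) auto
      finally have "L * c \<le> L * (\<Sum>t\<in>F. min c \<bar>\<omega> t - interp T m \<omega> t\<bar>)" using L by simp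
      moreover have "L * c = 2 * K" using L by (simp add: c_def)
      ultimately show ?thesis using K(2)[of \<omega>] K(2)[of "interp T m \<omega>"] by linarith
    next
      case False
      then have "(\<Sum>t\<in>F. min c \<bar>\<omega> t - interp T m \<omega> t\<bar>) = (\<Sum>t\<in>F. \<bar>\<omega> t - interp T m \<omega> t\<bar>)"
        by (intro sum.cong) auto
      then show ?thesis using XL by simp
    qed
    also have "\<dots> \<le> L * ?Y \<omega>" using L le1 by (intro mult_left_mono sum_mono) auto
    finally show ?thesis by linarith
  qed
  have EY: "E ?Y \<le> real (card F) * (4 * \<delta>)"
  proof -
    have "E ?Y \<le> (\<Sum>t\<in>F. 4 * \<delta>)"
    proof (rule order.trans[OF E_sum sum_mono])
      fix t assume t: "t \<in> F"
      have EC: "1 / \<delta> ^ 3 * E (?C t s) \<le> \<delta>" if s: "s \<in> {0..T}" "\<bar>t - s\<bar> \<le> T / 2 ^ m" for s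
      proof -
        have "E (?C t s) \<le> M * (t - s)\<^sup>2" using c s t F by (intro moment_le) auto
        also have "\<dots> \<le> M * (T / 2 ^ m)\<^sup>2" using s M by (intro mult_left_mono) (auto simp: abs_le_square_iff[symmetric] T0)
        also have "(T / 2 ^ m)\<^sup>2 = T\<^sup>2 * (1/4) ^ m"
        proof -
          have swap: "(x ^ m) ^ k = (x ^ k) ^ m" for x :: real and k by (metis power_mult mult.commute)
          show ?thesis by (simp add: power_divide swap)
        qed
        finally have "1 / \<delta> ^ 3 * E (?C t s) \<le> 1 / \<delta> ^ 3 * (M * (T\<^sup>2 * (1/4) ^ m))" using \<delta> by (intro mult_left_mono) auto
        also have "\<dots> = M * T\<^sup>2 / \<delta> ^ 3 * (1/4) ^ m" by simp
        finally show ?thesis using m by linarith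
      qed
      have tI: "t \<in> {0..T}" using t F by auto
      have C1: "(\<lambda>\<omega>. 1 / \<delta> ^ 3 * ?C t (node T m (i t)) \<omega>) \<in> Lip T" "(\<lambda>\<omega>. 1 / \<delta> ^ 3 * ?C t (node T m (Suc (i t))) \<omega>) \<in> Lip T"
        by (intro Lip_scale CL T0 tI nI[OF t])+
      have "E (\<lambda>\<omega>. 2 * \<delta> + (1 / \<delta> ^ 3 * ?C t (node T m (i t)) \<omega> + 1 / \<delta> ^ 3 * ?C t (node T m (Suc (i t))) \<omega>)) \<le>
        2 * \<delta> + (E (\<lambda>\<omega>. 1 / \<delta> ^ 3 * ?C t (node T m (i t)) \<omega>) + E (\<lambda>\<omega>. 1 / \<delta> ^ 3 * ?C t (node T m (Suc (i t))) \<omega>))"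
        using E_add[OF Lip_const[OF T0] Lip_add[OF T0 C1], of "2 * \<delta>"] E_add[OF C1] E_const[of "2 * \<delta>"] by linarith
      also have "\<dots> = 2 * \<delta> + (1 / \<delta> ^ 3 * E (?C t (node T m (i t))) + 1 / \<delta> ^ 3 * E (?C t (node T m (Suc (i t)))))"
        using \<delta> nI[OF t] tI by (subst (1 2) E_scale) (auto intro!: CL simp del: atLeastAtMost_iff)
      also have "\<dots> \<le> 4 * \<delta>" using EC[OF nI(1)[OF t] i(3)[OF t]] EC[OF nI(2)[OF t] i(4)[OF t]] by linarith
      finally show "E (\<lambda>\<omega>. 2 * \<delta> + (1 / \<delta> ^ 3 * ?C t (node T m (i t)) \<omega> + 1 / \<delta> ^ 3 * ?C t (node T m (Suc (i t))) \<omega>)) \<le> 4 * \<delta>" .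
    qed (rule YL)
    then show ?thesis by simp
  qed
  have Yin: "?Y \<in> Lip T" by (intro Lip_sum T0 YL)
  have XI: "(\<lambda>\<omega>. X (interp T m \<omega>)) \<in> Lip T" by (rule Lip_comp_interp[OF X])
  have "l X \<le> l (\<lambda>\<omega>. X (interp T m \<omega>) + L * ?Y \<omega>)" by (intro l_mono_pointwise X Lip_add Lip_scale T0 XI Yin pt)
  also have "\<dots> = l (\<lambda>\<omega>. X (interp T m \<omega>)) + L * l ?Y"
    using l_add[OF XI Lip_scale[OF T0 Yin]] l_scale[OF Yin] by simp
  also have "L * l ?Y \<le> L * (real (card F) * (4 * \<delta>))" using L l_le[OF Yin] EY by (intro mult_left_mono) auto
  also have "L * (real (card F) * (4 * \<delta>)) = e" using L cF by (simp add: \<delta>_def)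
  finally show ?thesis by (intro exI[of _ m]) simp
qed

text \<open>
  Tightness: up to a small error, \<open>l X\<close> only depends on \<open>X\<close> on the regular paths.
\<close>

lemma l_tight:
  assumes X: "X \<in> Lip T" and X1: "\<And>\<omega>. X \<omega> \<le> 1" and d0: "0 \<le> d" and a: "0 < a"
    and Xd: "\<And>\<omega>. \<omega> \<in> regular_paths T a \<Longrightarrow> X \<omega> \<le> d"
  shows "l X \<le> d + 5 * M * T\<^sup>2 / a ^ 4"
proof (rule field_le_epsilon)
  fix e :: real assume "0 < e"
  then obtain m where "l X \<le> l (\<lambda>\<omega>. X (interp T m \<omega>)) + e" using l_interp_approx[OF X] by blast
  then show "l X \<le> d + 5 * M * T\<^sup>2 / a ^ 4 + e" using l_tight_dyadic[OF X X1 d0 a Xd, of m] by linarith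
qed

text \<open>
  Positivity of \<open>l\<close> only requires an inequality on the continuous paths.
\<close>

lemma l_nonpos_on_paths:
  assumes X: "X \<in> Lip T" and le: "\<And>\<omega>. \<omega> \<in> mspace (path_metric T) \<Longrightarrow> X \<omega> \<le> 0"
  shows "l X \<le> 0"
proof -
  obtain F K L where K: "0 < K" "\<And>\<omega>. \<bar>X \<omega>\<bar> \<le> K" by (rule LipD[OF X]) blast
  have Y: "(\<lambda>\<omega>. 1 / K * X \<omega>) \<in> Lip T" by (intro Lip_scale T0 X)
  have "l (\<lambda>\<omega>. 1 / K * X \<omega>) \<le> 0"
  proof (rule field_le_epsilon)
    fix e :: real assume "0 < e"
    then obtain a where a: "0 < a" "5 * M * T\<^sup>2 / a ^ 4 < e" using tail_small by blast
    have "l (\<lambda>\<omega>. 1 / K * X \<omega>) \<le> 0 + 5 * M * T\<^sup>2 / a ^ 4"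
    proof (rule l_tight[OF Y _ _ a(1)])
      show "1 / K * X \<omega> \<le> 1" for \<omega> using K(1) K(2)[of \<omega>] by (simp add: field_simps)
      show "1 / K * X \<omega> \<le> 0" if "\<omega> \<in> regular_paths T a" for \<omega>
        using le[of \<omega>] that regular_paths_subset_paths[OF T] K(1) by (auto simp: divide_le_0_iff)
    qed simp
    then show "l (\<lambda>\<omega>. 1 / K * X \<omega>) \<le> 0 + e" using a by simp
  qed
  then show ?thesis using K(1) by (simp only: l_scale[OF X]) (simp add: divide_le_0_iff)
qed

lemma l_mono:
  assumes X: "X \<in> Lip T" and Y: "Y \<in> Lip T" and le: "\<And>\<omega>. \<omega> \<in> mspace (path_metric T) \<Longrightarrow> X \<omega> \<le> Y \<omega>"
  shows "l X \<le> l Y"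
  using l_nonpos_on_paths[OF Lip_diff[OF T0 X Y]] le l_diff[OF X Y] by simp

text \<open>
  By Dini's theorem the sequence decreases to zero uniformly on the compact set of regular paths.
\<close>

lemma l_continuous:
  fixes X :: "nat \<Rightarrow> (real \<Rightarrow> real) \<Rightarrow> real"
  assumes X: "\<And>n. X n \<in> Lip T" and dec: "\<And>\<omega>. \<omega> \<in> mspace (path_metric T) \<Longrightarrow> decseq (\<lambda>n. X n \<omega>)"
    and lim: "\<And>\<omega>. \<omega> \<in> mspace (path_metric T) \<Longrightarrow> (\<lambda>n. X n \<omega>) \<longlonglongrightarrow> 0"
  shows "(\<lambda>n. l (X n)) \<longlonglongrightarrow> 0"
proof -
  have X0: "0 \<le> X n \<omega>" if "\<omega> \<in> mspace (path_metric T)" for n \<omega>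
    using decseq_ge[OF dec[OF that] lim[OF that]] .
  have l0: "0 \<le> l (X n)" for n using l_mono[OF Lip_const[OF T0, of 0] X[of n]] X0 l_const[of 0] by simp
  have ldec: "l (X n) \<le> l (X m)" if "m \<le> n" for m n
    using that by (intro l_mono X decseqD[OF dec])
  obtain F K L where K: "0 < K" "\<And>\<omega>. \<bar>X 0 \<omega>\<bar> \<le> K" by (rule LipD[OF X[of 0]]) blast
  show ?thesis
  proof (rule LIMSEQ_I)
    fix e :: real assume e: "0 < e"
    define d where "d = e / (3 * K)"
    have d: "0 < d" using e K by (simp add: d_def)
    obtain a where a: "0 < a" "5 * M * T\<^sup>2 / a ^ 4 < d" using tail_small[OF d] by blast
    have "\<exists>N. \<forall>\<omega>\<in>regular_paths T a. X N \<omega> < K * d"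
    proof (rule ccontr)
      assume "\<not> ?thesis"
      then have ne: "{\<omega>\<in>regular_paths T a. K * d \<le> X N \<omega>} \<noteq> {}" for N by (auto simp: not_less)
      have Kc: "compact (regular_paths T a)" using compact_regular_paths[OF T] a by simp
      have "regular_paths T a \<inter> (\<Inter>N. {\<omega>\<in>regular_paths T a. K * d \<le> X N \<omega>}) \<noteq> {}"
      proof (rule compact_imp_fip_image[OF Kc])
        show "closed {\<omega>\<in>regular_paths T a. K * d \<le> X N \<omega>}" for N
          by (intro continuous_on_closed_Collect_le continuous_on_const Lip_continuous[OF X] compact_imp_closed Kc)
        fix J :: "nat set" assume J: "finite J"
        obtain \<omega> where w: "\<omega> \<in> regular_paths T a" "K * d \<le> X (Max (insert 0 J)) \<omega>" using ne by blast
        have wp: "\<omega> \<in> mspace (path_metric T)" using w regular_paths_subset_paths[OF T] by blast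
        have "K * d \<le> X n \<omega>" if "n \<in> J" for n
          using decseqD[OF dec[OF wp], of n "Max (insert 0 J)"] J that w by fastforce
        then show "regular_paths T a \<inter> (\<Inter>N\<in>J. {\<omega>\<in>regular_paths T a. K * d \<le> X N \<omega>}) \<noteq> {}" using w by blast
      qed
      then obtain \<omega> where w: "\<omega> \<in> regular_paths T a" "\<And>N. K * d \<le> X N \<omega>" by blast
      then have "\<omega> \<in> mspace (path_metric T)" using regular_paths_subset_paths[OF T] by blast
      from LIMSEQ_le_const[OF lim[OF this]] w(2) have "K * d \<le> 0" by blast
      then show False using K d by (simp add: mult_le_0_iff)
    qed
    then obtain N where N: "\<And>\<omega>. \<omega> \<in> regular_paths T a \<Longrightarrow> X N \<omega> < K * d" by blast
    define Y where "Y \<omega> = min (X N \<omega>) K" for \<omega>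
    have Y: "Y \<in> Lip T" unfolding Y_def[abs_def] by (intro Lip_min T0 X Lip_const)
    have "X N \<omega> \<le> Y \<omega>" if "\<omega> \<in> mspace (path_metric T)" for \<omega>
      using decseqD[OF dec[OF that], of 0 N] K(2)[of \<omega>] by (simp add: Y_def)
    then have "l (X N) \<le> l Y" by (intro l_mono X Y)
    moreover have "l (\<lambda>\<omega>. 1 / K * Y \<omega>) \<le> d + 5 * M * T\<^sup>2 / a ^ 4"
    proof (rule l_tight[OF Lip_scale[OF T0 Y] _ _ a(1)])
      show "1 / K * Y \<omega> \<le> 1" for \<omega> using K(1) by (simp add: Y_def divide_le_eq)
      show "1 / K * Y \<omega> \<le> d" if "\<omega> \<in> regular_paths T a" for \<omega>
        using N[OF that] K(1) by (simp add: Y_def divide_le_eq mult.commute)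
    qed (use d in simp)
    ultimately have "1 / K * l (X N) \<le> 2 * d" using a K(1) l_scale[OF Y, of "1 / K"] divide_right_mono[of "l (X N)" "l Y" K] by simp
    then have lN: "l (X N) < e" using K e by (simp add: d_def field_simps)
    show "\<exists>no. \<forall>n\<ge>no. norm (l (X n) - 0) < e"
    proof (intro exI allI impI)
      fix n assume "N \<le> n"
      then show "norm (l (X n) - 0) < e" using ldec[of N n] lN l0[of n] by simp
    qed
  qed
qed

lemma daniell_l: "daniell (mspace (path_metric T)) (Lip T) l"
proof
  show "\<exists>K. \<forall>w\<in>mspace (path_metric T). \<bar>X w\<bar> \<le> K" if "X \<in> Lip T" for X
    by (rule LipD[OF that]) blast
qed (auto intro: Lip_const Lip_add Lip_mult Lip_min T0 l_add l_scale l_const l_mono l_continuous)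

end

end

section \<open>Representation of functionals by probabilities\<close>

lemma space_path_borel: "space (path_borel T) = mspace (path_metric T)"
  unfolding path_borel_def metric_borel_def by (rule space_measure_of) blast

lemma path_dist_le:
  assumes "0 \<le> T" "\<omega> \<in> mspace (path_metric T)" "\<omega>' \<in> mspace (path_metric T)"
    "\<And>t. t \<in> {0..T} \<Longrightarrow> \<bar>\<omega> t - \<omega>' t\<bar> \<le> d"
  shows "mdist (path_metric T) \<omega> \<omega>' \<le> d"
  unfolding mdist_path_metric[OF assms(1-3)] using assms by (intro cSUP_least) auto

lemma path_dist_ge:
  assumes "0 \<le> T" and \<omega>: "\<omega> \<in> mspace (path_metric T)" "\<omega>' \<in> mspace (path_metric T)" and t: "t \<in> {0..T}"
  shows "\<bar>\<omega> t - \<omega>' t\<bar> \<le> mdist (path_metric T) \<omega> \<omega>'"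
proof -
  have "continuous_on {0..T} (\<lambda>t. \<bar>\<omega> t - \<omega>' t\<bar>)"
    using \<omega> by (auto simp: mspace_path_metric intro!: continuous_intros)
  then have "compact ((\<lambda>t. \<bar>\<omega> t - \<omega>' t\<bar>) ` {0..T})" by (rule compact_continuous_image) simp
  then have "bdd_above ((\<lambda>t. \<bar>\<omega> t - \<omega>' t\<bar>) ` {0..T})" by (intro bounded_imp_bdd_above compact_imp_bounded)
  then show ?thesis unfolding mdist_path_metric[OF assms(1-3)] by (rule cSUP_upper[OF t])
qed

lemma path_lipschitz_measurable:
  assumes "\<And>\<omega> \<omega>'. \<omega> \<in> mspace (path_metric T) \<Longrightarrow> \<omega>' \<in> mspace (path_metric T) \<Longrightarrow>
     \<bar>f \<omega> - f \<omega>'\<bar> \<le> c * mdist (path_metric T) \<omega> \<omega>'"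
  shows "f \<in> borel_measurable (path_borel T)"
proof (rule borel_measurableI_greater)
  fix y
  let ?M = "mspace (path_metric T)" and ?d = "mdist (path_metric T)"
  let ?U = "{\<omega>\<in>?M. y < f \<omega>}"
  have "\<exists>r>0. \<forall>\<omega>'\<in>?M. ?d \<omega> \<omega>' < r \<longrightarrow> \<omega>' \<in> ?U" if w: "\<omega> \<in> ?U" for \<omega>
  proof (intro exI conjI ballI impI)
    let ?r = "(f \<omega> - y) / (\<bar>c\<bar> + 1)"
    show "0 < ?r" using w by simp
    fix \<omega>' assume w': "\<omega>' \<in> ?M" "?d \<omega> \<omega>' < ?r"
    have "f \<omega> - f \<omega>' \<le> c * ?d \<omega> \<omega>'" using assms[of \<omega> \<omega>'] w w' by simp
    also have "\<dots> \<le> (\<bar>c\<bar> + 1) * ?d \<omega> \<omega>'" by (intro mult_right_mono) auto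
    also have "\<dots> < (\<bar>c\<bar> + 1) * ?r" using w'(2) by (intro mult_strict_left_mono) auto
    also have "\<dots> = f \<omega> - y" by simp
    finally show "\<omega>' \<in> ?U" using w' by simp
  qed
  then have "?U \<in> {U. U \<subseteq> ?M \<and> (\<forall>x\<in>U. \<exists>r>0. \<forall>y\<in>?M. ?d x y < r \<longrightarrow> y \<in> U)}" by blast
  then have "?U \<in> sets (path_borel T)" unfolding path_borel_def metric_borel_def by (intro in_measure_of) auto
  then show "{\<omega> \<in> space (path_borel T). y < f \<omega>} \<in> sets (path_borel T)" by (simp add: space_path_borel)
qed

lemma Lip_measurable:
  assumes T: "0 \<le> T" and X: "X \<in> Lip T"
  shows "X \<in> borel_measurable (path_borel T)"
proof -
  obtain F K L where F: "finite F" "F \<subseteq> {0..T}" "0 < L"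
    "\<And>\<omega> \<omega>'. \<bar>X \<omega> - X \<omega>'\<bar> \<le> L * (\<Sum>t\<in>F. \<bar>\<omega> t - \<omega>' t\<bar>)" by (rule LipD[OF X]) blast
  show ?thesis
  proof (rule path_lipschitz_measurable)
    fix \<omega> \<omega>' assume w: "\<omega> \<in> mspace (path_metric T)" "\<omega>' \<in> mspace (path_metric T)"
    have "(\<Sum>t\<in>F. \<bar>\<omega> t - \<omega>' t\<bar>) \<le> (\<Sum>t\<in>F. mdist (path_metric T) \<omega> \<omega>')"
      using F(2) w T by (intro sum_mono path_dist_ge) auto
    then have "L * (\<Sum>t\<in>F. \<bar>\<omega> t - \<omega>' t\<bar>) \<le> L * (real (card F) * mdist (path_metric T) \<omega> \<omega>')" using F(3) by simp
    then show "\<bar>X \<omega> - X \<omega>'\<bar> \<le> (L * real (card F)) * mdist (path_metric T) \<omega> \<omega>'"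
      using F(4)[of \<omega> \<omega>'] by (simp add: mult.assoc)
  qed
qed

text \<open>
  The unit ball for the supremum bound and the Lipschitz constant separately; it contains the unit ball of
  \<open>BL_norm\<close>, which bounds their sum.
\<close>

definition BL_unit :: "real \<Rightarrow> ((real \<Rightarrow> real) \<Rightarrow> real) \<Rightarrow> bool" where
  "BL_unit T f \<longleftrightarrow> (\<forall>\<omega>\<in>mspace (path_metric T). \<bar>f \<omega>\<bar> \<le> 1) \<and>
    (\<forall>\<omega>\<in>mspace (path_metric T). \<forall>\<omega>'\<in>mspace (path_metric T). \<bar>f \<omega> - f \<omega>'\<bar> \<le> mdist (path_metric T) \<omega> \<omega>')"

lemma BL_norm_le_1_imp_BL_unit:
  assumes "BL_norm T f \<le> 1"
  shows "BL_unit T f"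
proof -
  let ?M = "mspace (path_metric T)"
  let ?P = "{(\<omega>, \<omega>'). \<omega> \<in> ?M \<and> \<omega>' \<in> ?M \<and> \<omega> \<noteq> \<omega>'}"
  let ?S1 = "SUP \<omega>\<in>?M. ennreal \<bar>f \<omega>\<bar>"
  let ?S2 = "SUP (\<omega>, \<omega>') \<in> ?P. ennreal (\<bar>f \<omega> - f \<omega>'\<bar> / mdist (path_metric T) \<omega> \<omega>')"
  have s: "?S1 + ?S2 \<le> 1" using assms by (simp add: BL_norm_def)
  have s1: "?S1 \<le> 1" by (rule order.trans[OF _ s]) simp
  have s2: "?S2 \<le> 1" by (rule order.trans[OF _ s]) simp
  show ?thesis unfolding BL_unit_def
  proof (intro conjI ballI)
    fix \<omega> assume w: "\<omega> \<in> ?M"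
    have "ennreal \<bar>f \<omega>\<bar> \<le> ?S1" by (rule SUP_upper[OF w])
    then have "ennreal \<bar>f \<omega>\<bar> \<le> 1" using s1 by (rule order.trans)
    then show "\<bar>f \<omega>\<bar> \<le> 1" by (simp add: ennreal_le_1)
    fix \<omega>' assume w': "\<omega>' \<in> ?M"
    show "\<bar>f \<omega> - f \<omega>'\<bar> \<le> mdist (path_metric T) \<omega> \<omega>'"
    proof (cases "\<omega> = \<omega>'")
      case False
      then have pos: "0 < mdist (path_metric T) \<omega> \<omega>'"
        using w w' mdist_zero[of \<omega> "path_metric T" \<omega>'] mdist_nonneg[of "path_metric T" \<omega> \<omega>'] by (simp add: less_le)
      have "(case (\<omega>, \<omega>') of (\<omega>, \<omega>') \<Rightarrow> ennreal (\<bar>f \<omega> - f \<omega>'\<bar> / mdist (path_metric T) \<omega> \<omega>')) \<le> ?S2"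
        by (rule SUP_upper) (use False w w' in auto)
      from order.trans[OF this s2]
      have "ennreal (\<bar>f \<omega> - f \<omega>'\<bar> / mdist (path_metric T) \<omega> \<omega>') \<le> 1" by (simp only: prod.case)
      then have "\<bar>f \<omega> - f \<omega>'\<bar> / mdist (path_metric T) \<omega> \<omega>' \<le> 1" by (simp only: ennreal_le_1)
      then show ?thesis using pos by (simp add: divide_le_eq)
    qed simp
  qed
qed

lemma BL_norm_zero: "BL_norm T (\<lambda>_. 0) \<le> 1"
proof -
  have "(SUP \<omega>\<in>mspace (path_metric T). ennreal \<bar>0\<bar>) = 0"
    by (rule antisym[OF SUP_least]) auto
  moreover have "(SUP (\<omega>, \<omega>') \<in> {(\<omega>, \<omega>'). \<omega> \<in> mspace (path_metric T) \<and> \<omega>' \<in> mspace (path_metric T) \<and> \<omega> \<noteq> \<omega>'}.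
        ennreal (\<bar>0 - 0\<bar> / mdist (path_metric T) \<omega> \<omega>')) = 0"
    by (rule antisym[OF SUP_least]) auto
  ultimately show ?thesis unfolding BL_norm_def by simp
qed

context moment_bound begin

abbreviation \<Omega> where "\<Omega> \<equiv> mspace (path_metric T)"

lemma interp_Lip_BL_unit:
  assumes f: "BL_unit T f"
  shows "(\<lambda>\<omega>. f (interp T n \<omega>)) \<in> Lip T"
proof (rule interp_Lip[where B=1 and L=1])
  show "\<bar>f (interp T n \<omega>)\<bar> \<le> 1" for \<omega> using f interp_path[OF T] unfolding BL_unit_def by blast
  fix \<omega> \<omega>' d assume d: "\<And>t. t \<in> {0..T} \<Longrightarrow> \<bar>interp T n \<omega> t - interp T n \<omega>' t\<bar> \<le> d"
  have "\<bar>f (interp T n \<omega>) - f (interp T n \<omega>')\<bar> \<le> mdist (path_metric T) (interp T n \<omega>) (interp T n \<omega>')"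
    using f interp_path[OF T] unfolding BL_unit_def by blast
  also have "\<dots> \<le> d" by (intro path_dist_le T0 interp_path T d)
  finally show "\<bar>f (interp T n \<omega>) - f (interp T n \<omega>')\<bar> \<le> 1 * d" by simp
qed

lemma interp_limit_BL_unit:
  assumes f: "BL_unit T f" and w: "\<omega> \<in> \<Omega>"
  shows "(\<lambda>n. f (interp T n \<omega>)) \<longlonglongrightarrow> f \<omega>"
proof (rule LIMSEQ_I)
  fix r :: real assume "0 < r"
  then have r: "0 < r / 2" by simp
  have c: "continuous_on {0..T} \<omega>" using w by (simp add: mspace_path_metric)
  obtain N where N: "\<And>n t. n \<ge> N \<Longrightarrow> t \<in> {0..T} \<Longrightarrow> \<bar>\<omega> t - interp T n \<omega> t\<bar> \<le> r / 2"
    by (rule interp_uniform_limit[OF T c r]) blast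
  show "\<exists>no. \<forall>n\<ge>no. norm (f (interp T n \<omega>) - f \<omega>) < r"
  proof (intro exI allI impI)
    fix n assume n: "N \<le> n"
    have "\<bar>f (interp T n \<omega>) - f \<omega>\<bar> \<le> mdist (path_metric T) (interp T n \<omega>) \<omega>"
      using f w interp_path[OF T] unfolding BL_unit_def by blast
    also have "\<dots> \<le> r / 2" using N[OF n] by (intro path_dist_le T0 interp_path T w) (simp add: abs_minus_commute)
    finally show "norm (f (interp T n \<omega>) - f \<omega>) < r" using \<open>0 < r\<close> by simp
  qed
qed

text \<open>
  The Borel field of the path space is generated by the cylinder functions: an open set \<open>U\<close> is
  \<open>{f > 0}\<close> for the truncated distance \<open>f\<close> to its complement, and \<open>f\<close> is the limit of its values along
  interpolated paths.
\<close>

lemma path_borel_generated: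
  assumes P: "space P = \<Omega>" and L: "\<And>X. X \<in> Lip T \<Longrightarrow> X \<in> borel_measurable P"
  shows "(\<lambda>\<omega>. \<omega>) \<in> measurable P (path_borel T)"
  unfolding path_borel_def metric_borel_def
proof (rule measurable_measure_of)
  let ?d = "mdist (path_metric T)"
  show "(\<lambda>\<omega>. \<omega>) \<in> space P \<rightarrow> \<Omega>" using P by auto
  fix U assume "U \<in> {U. U \<subseteq> \<Omega> \<and> (\<forall>x\<in>U. \<exists>r>0. \<forall>y\<in>\<Omega>. ?d x y < r \<longrightarrow> y \<in> U)}"
  then have U: "U \<subseteq> \<Omega>" "\<And>x. x \<in> U \<Longrightarrow> \<exists>r>0. \<forall>y\<in>\<Omega>. ?d x y < r \<longrightarrow> y \<in> U" by auto
  have "U \<in> sets P"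
  proof (cases "\<Omega> - U = {}")
    case True
    then have "U = space P" using U(1) P by blast
    then show ?thesis by simp
  next
    case False
    define f where "f \<omega> = min 1 (INF y\<in>\<Omega> - U. ?d \<omega> y)" for \<omega>
    have bdd: "bdd_below (?d \<omega> ` (\<Omega> - U))" for \<omega> by (rule bdd_belowI2[of _ 0]) simp
    have nn: "0 \<le> (INF y\<in>\<Omega> - U. ?d \<omega> y)" for \<omega> using False by (intro cINF_greatest) auto
    have one: "(INF y\<in>\<Omega> - U. ?d \<omega> y) \<le> ?d \<omega> \<omega>' + (INF y\<in>\<Omega> - U. ?d \<omega>' y)" if w: "\<omega> \<in> \<Omega>" "\<omega>' \<in> \<Omega>" for \<omega> \<omega>'
    proof -
      have "(INF y\<in>\<Omega> - U. ?d \<omega> y) - ?d \<omega> \<omega>' \<le> (INF y\<in>\<Omega> - U. ?d \<omega>' y)"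
      proof (rule cINF_greatest[OF False])
        fix y assume y: "y \<in> \<Omega> - U"
        have "(INF y\<in>\<Omega> - U. ?d \<omega> y) \<le> ?d \<omega> y" by (rule cINF_lower[OF bdd y])
        also have "\<dots> \<le> ?d \<omega> \<omega>' + ?d \<omega>' y" using mdist_triangle[of \<omega> "path_metric T" \<omega>' y] w y by simp
        finally show "(INF y\<in>\<Omega> - U. ?d \<omega> y) - ?d \<omega> \<omega>' \<le> ?d \<omega>' y" by simp
      qed
      then show ?thesis by simp
    qed
    have BL: "BL_unit T f" unfolding BL_unit_def
    proof (intro conjI ballI)
      show "\<bar>f \<omega>\<bar> \<le> 1" for \<omega> using nn[of \<omega>] by (simp add: f_def)
      fix \<omega> \<omega>' assume w: "\<omega> \<in> \<Omega>" "\<omega>' \<in> \<Omega>"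
      have "?d \<omega> \<omega>' = ?d \<omega>' \<omega>" by (rule mdist_commute)
      then show "\<bar>f \<omega> - f \<omega>'\<bar> \<le> ?d \<omega> \<omega>'" using one[OF w] one[OF w(2,1)] unfolding f_def by auto
    qed
    have "f \<in> borel_measurable P"
      by (rule borel_measurable_LIMSEQ_real[OF interp_limit_BL_unit[OF BL]]) (auto simp: P intro: L interp_Lip_BL_unit[OF BL])
    then have "{\<omega>\<in>space P. 0 < f \<omega>} \<in> sets P" by measurable
    moreover have "{\<omega>\<in>space P. 0 < f \<omega>} = U"
    proof safe
      fix \<omega> assume w: "\<omega> \<in> space P" "0 < f \<omega>"
      show "\<omega> \<in> U"
      proof (rule ccontr)
        assume "\<omega> \<notin> U"
        then have "(INF y\<in>\<Omega> - U. ?d \<omega> y) \<le> ?d \<omega> \<omega>" using w P by (intro cINF_lower bdd) auto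
        also have "?d \<omega> \<omega> = 0" using w P by simp
        finally show False using w by (simp add: f_def)
      qed
    next
      fix \<omega> assume w: "\<omega> \<in> U"
      then show "\<omega> \<in> space P" using U(1) P by auto
      obtain r where r: "r > 0" "\<And>y. y \<in> \<Omega> \<Longrightarrow> ?d \<omega> y < r \<Longrightarrow> y \<in> U" using U(2)[OF w] by blast
      have "r \<le> (INF y\<in>\<Omega> - U. ?d \<omega> y)" using r(2) by (intro cINF_greatest[OF False]) (auto simp: not_less[symmetric])
      then show "0 < f \<omega>" using r(1) by (simp add: f_def)
    qed
    ultimately show ?thesis by simp
  qed
  moreover have "(\<lambda>\<omega>. \<omega>) -` U \<inter> space P = U" using U(1) P by auto
  ultimately show "(\<lambda>\<omega>. \<omega>) -` U \<inter> space P \<in> sets P" by simp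
qed auto

theorem functional_representation:
  assumes l: "dominated_functional l"
  shows "\<exists>P\<in>dominated T E. \<forall>X\<in>Lip T. (\<integral>\<omega>. X \<omega> \<partial>P) = l X"
proof -
  interpret daniell \<Omega> "Lip T" l by (rule daniell_l[OF l])
  obtain P0 where P0: "prob_space P0" "space P0 = \<Omega>"
    "\<And>X. X \<in> Lip T \<Longrightarrow> X \<in> borel_measurable P0" "\<And>X. X \<in> Lip T \<Longrightarrow> (\<integral>w. X w \<partial>P0) = l X"
    using representing_measure by blast
  define P where "P = distr P0 (path_borel T) (\<lambda>\<omega>. \<omega>)"
  have id: "(\<lambda>\<omega>. \<omega>) \<in> measurable P0 (path_borel T)" by (rule path_borel_generated[OF P0(2,3)])
  have "prob_space P" unfolding P_def by (rule prob_space.prob_space_distr[OF P0(1) id])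
  moreover have "sets P = sets (path_borel T)" by (simp add: P_def)
  moreover have int: "(\<integral>\<omega>. X \<omega> \<partial>P) = l X" if "X \<in> Lip T" for X
    unfolding P_def using integral_distr[OF id Lip_measurable[OF T0 that]] P0(4)[OF that] by simp
  ultimately show ?thesis using l_le[OF l] unfolding dominated_def by (intro bexI[of _ P]) auto
qed

lemma Lip_integrable:
  assumes P: "P \<in> dominated T E" and X: "X \<in> Lip T"
  shows "integrable P X"
proof -
  interpret prob_space P using P by (simp add: dominated_def)
  obtain F K L where K: "\<And>\<omega>. \<bar>X \<omega>\<bar> \<le> K" by (rule LipD[OF X]) blast
  have "X \<in> borel_measurable P" using Lip_measurable[OF T0 X] P by (simp add: dominated_def cong: measurable_cong_sets)
  then show ?thesis using K by (intro integrable_const_bound[where B=K]) auto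
qed

lemma dominated_functional_integral:
  assumes P: "P \<in> dominated T E"
  shows "dominated_functional (\<lambda>X. \<integral>\<omega>. X \<omega> \<partial>P)"
  unfolding dominated_functional_def linear_functional_def
proof (intro conjI ballI allI)
  show "(\<integral>\<omega>. X \<omega> \<partial>P) \<le> E X" if "X \<in> Lip T" for X using P that by (simp add: dominated_def)
  show "(\<integral>\<omega>. X \<omega> + Y \<omega> \<partial>P) = (\<integral>\<omega>. X \<omega> \<partial>P) + (\<integral>\<omega>. Y \<omega> \<partial>P)" if "X \<in> Lip T" "Y \<in> Lip T" for X Y
    by (intro Bochner_Integration.integral_add Lip_integrable[OF P] that)
  show "(\<integral>\<omega>. c * X \<omega> \<partial>P) = c * (\<integral>\<omega>. X \<omega> \<partial>P)" for X :: "(real \<Rightarrow> real) \<Rightarrow> real" and c by simp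
qed

lemma dominated_max:
  assumes X: "X \<in> Lip T"
  shows "\<exists>P\<in>dominated T E. (\<integral>\<omega>. X \<omega> \<partial>P) = E X"
proof -
  obtain l where l: "linear_functional (Lip T) l" "\<forall>X\<in>Lip T. l X \<le> E X" "l X = E X"
    using dominated_linear_functional_exists[OF function_subspace_Lip[OF T0] sublinear_functional_E X] by blast
  then have "dominated_functional l" by (simp add: dominated_functional_def)
  from functional_representation[OF this] show ?thesis using X l(3) by metis
qed

text \<open>
  The same tightness for the measures themselves, through a measurable set of regular paths.
\<close>

lemma dominated_tight:
  assumes P: "P \<in> dominated T E" and a: "0 < a"
  shows "\<exists>A\<in>sets P. A \<subseteq> regular_paths T a \<and> measure P (space P - A) \<le> 5 * M * T\<^sup>2 / a ^ 4"
proof -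
  interpret prob_space P using P by (simp add: dominated_def)
  have sp: "space P = \<Omega>" using P sets_eq_imp_space_eq[of P "path_borel T"] by (simp add: dominated_def space_path_borel)
  have bm: "roughness a m \<in> borel_measurable P" for m using Lip_integrable[OF P roughness_Lip[OF a]] by auto
  define B where "B m = {\<omega>\<in>space P. 1 \<le> roughness a m \<omega>}" for m
  have Bs: "B m \<in> sets P" for m using bm unfolding B_def by measurable
  have "incseq B" unfolding B_def using roughness_mono[of a] by (intro incseq_SucI) (auto intro: order.trans)
  have Bp: "measure P (B m) \<le> 5 * M * T\<^sup>2 / a ^ 4" for m
  proof -
    have "measure P (B m) = (\<integral>\<omega>. indicator (B m) \<omega> \<partial>P)" using Bs by simp
    also have "\<dots> \<le> (\<integral>\<omega>. roughness a m \<omega> \<partial>P)"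
    proof (rule integral_mono)
      show "integrable P (indicator (B m) :: _ \<Rightarrow> real)" using Bs by (simp add: emeasure_eq_measure)
      show "indicator (B m) \<omega> \<le> roughness a m \<omega>" for \<omega>
        using roughness_nonneg[of a m \<omega>] by (simp add: indicator_def B_def)
    qed (rule Lip_integrable[OF P roughness_Lip[OF a]])
    also have "\<dots> \<le> E (roughness a m)" using P roughness_Lip[OF a] by (simp add: dominated_def)
    also have "\<dots> \<le> 5 * M * T\<^sup>2 / a ^ 4" by (rule E_roughness_le[OF a])
    finally show ?thesis .
  qed
  have "(\<lambda>m. measure P (B m)) \<longlonglongrightarrow> measure P (\<Union>m. B m)"
    using Bs \<open>incseq B\<close> by (intro finite_Lim_measure_incseq) auto
  then have U: "measure P (\<Union>m. B m) \<le> 5 * M * T\<^sup>2 / a ^ 4" using Bp by (intro LIMSEQ_le_const2) auto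
  show ?thesis
  proof (intro bexI conjI)
    show "space P - (\<Union>m. B m) \<in> sets P" using Bs by auto
    show "measure P (space P - (space P - (\<Union>m. B m))) \<le> 5 * M * T\<^sup>2 / a ^ 4"
      using U sets.sets_into_space[OF Bs] by (simp add: Diff_Diff_Int Int_absorb1 UN_least)
    show "space P - (\<Union>m. B m) \<subseteq> regular_paths T a"
    proof
      fix \<omega> assume w: "\<omega> \<in> space P - (\<Union>m. B m)"
      then have nb: "roughness a m \<omega> < 1" for m unfolding B_def by (auto simp: not_le)
      show "\<omega> \<in> regular_paths T a"
        using w sp a increments_small_if_roughness_less_1[OF a nb] by (intro path_in_regular_paths[OF T]) auto
    qed
  qed
qed

end

section \<open>Controlling the bounded Lipschitz distance\<close>

context moment_bound begin

text \<open>
  A uniformly bounded family of functions has a finite net with respect to its values on a finite set.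
\<close>

lemma quantization_finite:
  fixes A :: "('a \<Rightarrow> real) set" and I :: "'a set"
  assumes I: "finite I" and b: "\<And>f i. f \<in> A \<Longrightarrow> i \<in> I \<Longrightarrow> \<bar>f i\<bar> \<le> B" and e: "0 < e"
  obtains A' where "finite A'" "A' \<subseteq> A" "\<And>f. f \<in> A \<Longrightarrow> \<exists>g\<in>A'. \<forall>i\<in>I. \<bar>f i - g i\<bar> \<le> e"
proof -
  define q where "q f = restrict (\<lambda>i. \<lfloor>f i / e\<rfloor>) I" for f
  have "q ` A \<subseteq> PiE I (\<lambda>_. {\<lfloor>- B / e\<rfloor>..\<lfloor>B / e\<rfloor>})"
  proof
    fix z assume "z \<in> q ` A"
    then obtain f where f: "f \<in> A" "z = q f" by blast
    have "\<lfloor>f i / e\<rfloor> \<in> {\<lfloor>- B / e\<rfloor>..\<lfloor>B / e\<rfloor>}" if "i \<in> I" for i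
    proof -
      have B: "- B \<le> f i" "f i \<le> B" using b[OF f(1) that] by linarith+
      have "- B / e \<le> f i / e" "f i / e \<le> B / e" using e by (intro divide_right_mono B; simp)+
      then show ?thesis by (auto intro: floor_mono)
    qed
    then show "z \<in> PiE I (\<lambda>_. {\<lfloor>- B / e\<rfloor>..\<lfloor>B / e\<rfloor>})" unfolding f(2) q_def by auto
  qed
  then have "finite (q ` A)" by (rule finite_subset) (intro finite_PiE I, simp)
  then obtain A' where A': "A' \<subseteq> A" "finite A'" "q ` A = q ` A'"
    using finite_subset_image[of "q ` A" q A] by auto
  show ?thesis
  proof (rule that[OF A'(2,1)])
    fix f assume "f \<in> A"
    then obtain g where g: "g \<in> A'" "q f = q g" using A'(3) by blast
    have "\<bar>f i - g i\<bar> \<le> e" if "i \<in> I" for i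
    proof -
      have "\<lfloor>f i / e\<rfloor> = \<lfloor>g i / e\<rfloor>" using fun_cong[OF g(2), of i] that by (simp add: q_def)
      then have "\<bar>f i / e - g i / e\<bar> < 1" by linarith
      then have "\<bar>(f i - g i) / e\<bar> < 1" by (simp add: diff_divide_distrib)
      then show ?thesis using e by (simp add: abs_divide)
    qed
    then show "\<exists>g\<in>A'. \<forall>i\<in>I. \<bar>f i - g i\<bar> \<le> e" using g by blast
  qed
qed

lemma BL_unit_measurable: "BL_unit T f \<Longrightarrow> f \<in> borel_measurable (path_borel T)"
  by (rule path_lipschitz_measurable[where c=1]) (simp add: BL_unit_def)

text \<open>
  Integrals of functions that are close on the regular paths.
\<close>

lemma integral_diff_le:
  assumes P: "P \<in> dominated T E" and a: "0 < a" "0 \<le> d" "0 \<le> b"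
    and f: "f \<in> borel_measurable (path_borel T)" "g \<in> borel_measurable (path_borel T)"
    and f1: "\<And>\<omega>. \<omega> \<in> \<Omega> \<Longrightarrow> \<bar>f \<omega>\<bar> \<le> b" "\<And>\<omega>. \<omega> \<in> \<Omega> \<Longrightarrow> \<bar>g \<omega>\<bar> \<le> b"
    and d: "\<And>\<omega>. \<omega> \<in> regular_paths T a \<Longrightarrow> \<bar>f \<omega> - g \<omega>\<bar> \<le> d"
  shows "\<bar>(\<integral>\<omega>. f \<omega> \<partial>P) - (\<integral>\<omega>. g \<omega> \<partial>P)\<bar> \<le> d + 2 * b * (5 * M * T\<^sup>2 / a ^ 4)"
proof -
  interpret prob_space P using P by (simp add: dominated_def)
  have s: "sets P = sets (path_borel T)" using P by (simp add: dominated_def)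
  have sp: "space P = \<Omega>" using sets_eq_imp_space_eq[OF s] by (simp add: space_path_borel)
  have m: "f \<in> borel_measurable P" "g \<in> borel_measurable P" using f s by (simp_all cong: measurable_cong_sets)
  have i: "integrable P f" "integrable P g"
    using f1 sp m by (auto intro!: integrable_const_bound[where B=b])
  obtain A where A: "A \<in> sets P" "A \<subseteq> regular_paths T a" "measure P (space P - A) \<le> 5 * M * T\<^sup>2 / a ^ 4"
    using dominated_tight[OF P a(1)] by blast
  have ic: "integrable P (indicator (space P - A) :: _ \<Rightarrow> real)" using A by (simp add: emeasure_eq_measure)
  have "\<bar>(\<integral>\<omega>. f \<omega> \<partial>P) - (\<integral>\<omega>. g \<omega> \<partial>P)\<bar> = \<bar>\<integral>\<omega>. f \<omega> - g \<omega> \<partial>P\<bar>" using i by simp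
  also have "\<dots> \<le> (\<integral>\<omega>. \<bar>f \<omega> - g \<omega>\<bar> \<partial>P)" by (rule integral_abs_bound)
  also have "\<dots> \<le> (\<integral>\<omega>. d + 2 * b * indicator (space P - A) \<omega> \<partial>P)"
  proof (rule integral_mono)
    show "integrable P (\<lambda>\<omega>. d + 2 * b * indicator (space P - A) \<omega>)" using ic by simp
    show "integrable P (\<lambda>\<omega>. \<bar>f \<omega> - g \<omega>\<bar>)" using i by simp
    fix \<omega> assume w: "\<omega> \<in> space P"
    show "\<bar>f \<omega> - g \<omega>\<bar> \<le> d + 2 * b * indicator (space P - A) \<omega>"
    proof (cases "\<omega> \<in> A")
      case True
      then show ?thesis using d[of \<omega>] A(2) by auto
    next
      case False
      have "\<bar>f \<omega> - g \<omega>\<bar> \<le> \<bar>f \<omega>\<bar> + \<bar>g \<omega>\<bar>" by linarith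
      then show ?thesis using False w f1[of \<omega>] sp a by simp
    qed
  qed
  also have "\<dots> = d + 2 * b * measure P (space P - A)" using ic A(1) by (simp add: prob_space)
  also have "\<dots> \<le> d + 2 * b * (5 * M * T\<^sup>2 / a ^ 4)" using A(3) a by (intro add_left_mono mult_left_mono) auto
  finally show ?thesis .
qed

text \<open>
  The regular paths have a finite net \<open>S\<close> in the supremum distance, and the functions in the unit ball a
  finite net \<open>\<Phi>\<close> with respect to their values on \<open>S\<close>. The functions in \<open>\<Phi>\<close>, evaluated along interpolated
  paths, are the test functions.
\<close>

theorem finite_test_family:
  assumes e: "0 < e"
  shows "\<exists>\<Psi>. finite \<Psi> \<and> \<Psi> \<subseteq> Lip T \<and> (\<forall>P\<in>dominated T E. \<forall>Q\<in>dominated T E.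
    (\<forall>X\<in>\<Psi>. \<bar>(\<integral>\<omega>. X \<omega> \<partial>P) - (\<integral>\<omega>. X \<omega> \<partial>Q)\<bar> \<le> e) \<longrightarrow>
    (\<forall>f. BL_unit T f \<longrightarrow> \<bar>(\<integral>\<omega>. f \<omega> \<partial>P) - (\<integral>\<omega>. f \<omega> \<partial>Q)\<bar> \<le> 25 * e))"
proof -
  obtain a where a: "0 < a" and tail: "5 * M * T\<^sup>2 / a ^ 4 < e" using tail_small[OF e] by blast
  obtain n where n: "10 * a * (9/10) ^ n \<le> e" using geometric_tail_small[OF e] by blast
  have KI: "\<bar>\<omega> t - interp T n \<omega> t\<bar> \<le> e" if "\<omega> \<in> regular_paths T a" "t \<in> {0..T}" for \<omega> t
  proof -
    have "\<bar>\<omega> t - interp T n \<omega> t\<bar> \<le> 10 * a * (9/10) ^ n" using that unfolding regular_paths_def by blast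
    then show ?thesis using n by (rule order.trans)
  qed
  have KO: "regular_paths T a \<subseteq> \<Omega>" by (rule regular_paths_subset_paths[OF T])
  define D where "D = node T n ` {..2 ^ n}"
  have D: "finite D" "D \<subseteq> {0..T}" unfolding D_def using node_in[OF T] by (auto simp del: atLeastAtMost_iff)
  have "\<bar>\<omega> t\<bar> \<le> 1 + 11 * a" if "\<omega> \<in> regular_paths T a" "t \<in> D" for \<omega> t
    using regular_paths_bound[OF T _ that(1), of t] that a D by auto
  then obtain S where S: "finite S" "S \<subseteq> regular_paths T a" "\<And>\<omega>. \<omega> \<in> regular_paths T a \<Longrightarrow> \<exists>s\<in>S. \<forall>t\<in>D. \<bar>\<omega> t - s t\<bar> \<le> e"
    using quantization_finite[OF D(1) _ e, of "regular_paths T a" "1 + 11 * a"] by blast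
  have near: "\<exists>s\<in>S. mdist (path_metric T) \<omega> s \<le> 3 * e" if w: "\<omega> \<in> regular_paths T a" for \<omega>
  proof -
    obtain s where s: "s \<in> S" "\<And>t. t \<in> D \<Longrightarrow> \<bar>\<omega> t - s t\<bar> \<le> e" using S(3)[OF w] by blast
    have "\<bar>\<omega> t - s t\<bar> \<le> 3 * e" if t: "t \<in> {0..T}" for t
    proof -
      have "\<bar>interp T n \<omega> t - interp T n s t\<bar> \<le> e"
        using s(2) by (intro interp_diff_le[OF T t]) (auto simp: D_def)
      moreover have "s \<in> regular_paths T a" using s S by blast
      ultimately show ?thesis using KI[OF w t] KI[OF _ t, of s] by linarith
    qed
    then have "mdist (path_metric T) \<omega> s \<le> 3 * e" using w s S KO by (intro path_dist_le T0) auto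
    then show ?thesis using s by blast
  qed
  have "\<bar>f s\<bar> \<le> 1" if "f \<in> Collect (BL_unit T)" "s \<in> S" for f s using that S KO unfolding BL_unit_def by blast
  then obtain \<Phi> where \<Phi>: "finite \<Phi>" "\<Phi> \<subseteq> Collect (BL_unit T)" "\<And>f. f \<in> Collect (BL_unit T) \<Longrightarrow> \<exists>g\<in>\<Phi>. \<forall>s\<in>S. \<bar>f s - g s\<bar> \<le> e"
    using quantization_finite[OF S(1) _ e, of "Collect (BL_unit T)" 1] by blast
  define \<Psi> where "\<Psi> = (\<lambda>g \<omega>. g (interp T n \<omega>)) ` \<Phi>"
  show ?thesis
  proof (intro exI[of _ \<Psi>] conjI ballI allI impI)
    show "finite \<Psi>" "\<Psi> \<subseteq> Lip T" using \<Phi> interp_Lip_BL_unit by (auto simp: \<Psi>_def)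
    fix P Q f assume P: "P \<in> dominated T E" and Q: "Q \<in> dominated T E"
      and close: "\<forall>X\<in>\<Psi>. \<bar>(\<integral>\<omega>. X \<omega> \<partial>P) - (\<integral>\<omega>. X \<omega> \<partial>Q)\<bar> \<le> e" and f: "BL_unit T f"
    obtain g where g: "g \<in> \<Phi>" "\<And>s. s \<in> S \<Longrightarrow> \<bar>f s - g s\<bar> \<le> e" using \<Phi>(3)[of f] f by blast
    have gB: "BL_unit T g" using g \<Phi> by blast
    let ?g = "\<lambda>\<omega>. g (interp T n \<omega>)"
    have fg: "\<bar>(\<integral>\<omega>. f \<omega> \<partial>R) - (\<integral>\<omega>. g \<omega> \<partial>R)\<bar> \<le> 7 * e + 2 * 1 * (5 * M * T\<^sup>2 / a ^ 4)" if R: "R \<in> dominated T E" for R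
    proof (rule integral_diff_le[OF R a _ _ BL_unit_measurable[OF f] BL_unit_measurable[OF gB]])
      fix \<omega> assume w: "\<omega> \<in> regular_paths T a"
      obtain s where s: "s \<in> S" "mdist (path_metric T) \<omega> s \<le> 3 * e" using near[OF w] by blast
      have "\<omega> \<in> \<Omega>" "s \<in> \<Omega>" using w s S KO by auto
      then have "\<bar>f \<omega> - f s\<bar> \<le> mdist (path_metric T) \<omega> s" "\<bar>g \<omega> - g s\<bar> \<le> mdist (path_metric T) \<omega> s"
        using f gB unfolding BL_unit_def by auto
      then show "\<bar>f \<omega> - g \<omega>\<bar> \<le> 7 * e" using s(2) g(2)[OF s(1)] by linarith
    qed (use e f gB in \<open>auto simp: BL_unit_def\<close>)
    have gg: "\<bar>(\<integral>\<omega>. g \<omega> \<partial>R) - (\<integral>\<omega>. ?g \<omega> \<partial>R)\<bar> \<le> e + 2 * 1 * (5 * M * T\<^sup>2 / a ^ 4)" if R: "R \<in> dominated T E" for R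
    proof (rule integral_diff_le[OF R a _ _ BL_unit_measurable[OF gB] Lip_measurable[OF T0 interp_Lip_BL_unit[OF gB]]])
      fix \<omega> assume w: "\<omega> \<in> regular_paths T a"
      have "\<bar>g \<omega> - ?g \<omega>\<bar> \<le> mdist (path_metric T) \<omega> (interp T n \<omega>)"
        using gB w KO interp_path[OF T] unfolding BL_unit_def by blast
      also have "\<dots> \<le> e" using w KO by (intro path_dist_le T0 interp_path T KI[OF w]) auto
      finally show "\<bar>g \<omega> - ?g \<omega>\<bar> \<le> e" .
    qed (use e gB interp_path[OF T] in \<open>auto simp: BL_unit_def\<close>)
    have "?g \<in> \<Psi>" using g by (auto simp: \<Psi>_def)
    \<comment> \<open>errors: twice \<open>7 + 2\<close> from \<open>f\<close> to \<open>g\<close>, twice \<open>1 + 2\<close> for the interpolation, and \<open>1\<close> for the test function\<close>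
    from bspec[OF close this] show "\<bar>(\<integral>\<omega>. f \<omega> \<partial>P) - (\<integral>\<omega>. f \<omega> \<partial>Q)\<bar> \<le> 25 * e"
      using fg[OF P] fg[OF Q] gg[OF P] gg[OF Q] tail by linarith
  qed
qed

lemma Lip_BL_unit_multiple:
  assumes X: "X \<in> Lip T"
  obtains c where "0 < c" "BL_unit T (\<lambda>\<omega>. c * X \<omega>)"
proof -
  obtain F K L where F: "finite F" "F \<subseteq> {0..T}" "F \<noteq> {}" "0 < L" "0 < K" "\<And>\<omega>. \<bar>X \<omega>\<bar> \<le> K"
    "\<And>\<omega> \<omega>'. \<bar>X \<omega> - X \<omega>'\<bar> \<le> L * (\<Sum>t\<in>F. \<bar>\<omega> t - \<omega>' t\<bar>)" by (rule LipD[OF X]) blast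
  define B where "B = K + L * real (card F)"
  have "0 \<le> L * real (card F)" using F by simp
  then have B: "K \<le> B" "L * real (card F) \<le> B" "0 < B" using F(5) unfolding B_def by auto
  show ?thesis
  proof (rule that[of "1 / B"])
    show "0 < 1 / B" using B by simp
    show "BL_unit T (\<lambda>\<omega>. 1 / B * X \<omega>)" unfolding BL_unit_def
    proof (intro conjI ballI)
      show "\<bar>1 / B * X \<omega>\<bar> \<le> 1" for \<omega> using F(6)[of \<omega>] B by (simp add: abs_mult divide_le_eq)
      fix \<omega> \<omega>' assume w: "\<omega> \<in> \<Omega>" "\<omega>' \<in> \<Omega>"
      let ?d = "mdist (path_metric T) \<omega> \<omega>'"
      have "(\<Sum>t\<in>F. \<bar>\<omega> t - \<omega>' t\<bar>) \<le> (\<Sum>t\<in>F. ?d)" using F(2) w by (intro sum_mono path_dist_ge T0) auto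
      then have "L * (\<Sum>t\<in>F. \<bar>\<omega> t - \<omega>' t\<bar>) \<le> L * (real (card F) * ?d)" using F(4) by simp
      also have "\<dots> \<le> B * ?d" using B(2) by (simp add: mult.assoc[symmetric] mult_right_mono)
      finally have "\<bar>X \<omega> - X \<omega>'\<bar> \<le> B * ?d" using F(7)[of \<omega> \<omega>'] by linarith
      then have "1 / B * \<bar>X \<omega> - X \<omega>'\<bar> \<le> ?d" using B(3) by (simp add: divide_le_eq mult.commute)
      moreover have "\<bar>1 / B * X \<omega> - 1 / B * X \<omega>'\<bar> = 1 / B * \<bar>X \<omega> - X \<omega>'\<bar>"
        using B(3) by (simp add: diff_divide_distrib[symmetric] abs_divide)
      ultimately show "\<bar>1 / B * X \<omega> - 1 / B * X \<omega>'\<bar> \<le> ?d" by simp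
    qed
  qed
qed

lemma countable_separating_family:
  "\<exists>\<psi>::nat \<Rightarrow> (real \<Rightarrow> real) \<Rightarrow> real. (\<forall>k. \<psi> k \<in> Lip T) \<and> (\<forall>P\<in>dominated T E. \<forall>Q\<in>dominated T E.
    (\<forall>k. (\<integral>\<omega>. \<psi> k \<omega> \<partial>P) = (\<integral>\<omega>. \<psi> k \<omega> \<partial>Q)) \<longrightarrow> (\<forall>X\<in>Lip T. (\<integral>\<omega>. X \<omega> \<partial>P) = (\<integral>\<omega>. X \<omega> \<partial>Q)))"
proof -
  have "\<forall>n. \<exists>\<Psi>. finite \<Psi> \<and> \<Psi> \<subseteq> Lip T \<and> (\<forall>P\<in>dominated T E. \<forall>Q\<in>dominated T E.
    (\<forall>X\<in>\<Psi>. \<bar>(\<integral>\<omega>. X \<omega> \<partial>P) - (\<integral>\<omega>. X \<omega> \<partial>Q)\<bar> \<le> 1 / real (Suc n)) \<longrightarrow>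
    (\<forall>f. BL_unit T f \<longrightarrow> \<bar>(\<integral>\<omega>. f \<omega> \<partial>P) - (\<integral>\<omega>. f \<omega> \<partial>Q)\<bar> \<le> 25 * (1 / real (Suc n))))"
    by (intro allI finite_test_family) simp
  from choice[OF this] obtain \<Psi> where \<Psi>: "\<forall>n. finite (\<Psi> n) \<and> \<Psi> n \<subseteq> Lip T \<and> (\<forall>P\<in>dominated T E. \<forall>Q\<in>dominated T E.
    (\<forall>X\<in>\<Psi> n. \<bar>(\<integral>\<omega>. X \<omega> \<partial>P) - (\<integral>\<omega>. X \<omega> \<partial>Q)\<bar> \<le> 1 / real (Suc n)) \<longrightarrow>
    (\<forall>f. BL_unit T f \<longrightarrow> \<bar>(\<integral>\<omega>. f \<omega> \<partial>P) - (\<integral>\<omega>. f \<omega> \<partial>Q)\<bar> \<le> 25 * (1 / real (Suc n))))" ..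
  define A where "A = insert (\<lambda>_. 0) (\<Union>n. \<Psi> n)"
  have cA: "countable A" "A \<noteq> {}" using \<Psi> by (auto simp: A_def intro: countable_finite)
  have AL: "A \<subseteq> Lip T" using \<Psi> Lip_const[OF T0] unfolding A_def by blast
  have rA: "range (from_nat_into A) = A" by (rule range_from_nat_into[OF cA(2,1)])
  show ?thesis
  proof (intro exI[of _ "from_nat_into A"] conjI allI ballI impI)
    show "from_nat_into A k \<in> Lip T" for k using rA AL by auto
    fix P Q X assume P: "P \<in> dominated T E" and Q: "Q \<in> dominated T E"
      and eq: "\<forall>k. (\<integral>\<omega>. from_nat_into A k \<omega> \<partial>P) = (\<integral>\<omega>. from_nat_into A k \<omega> \<partial>Q)" and X: "X \<in> Lip T"
    have eqA: "(\<integral>\<omega>. Y \<omega> \<partial>P) = (\<integral>\<omega>. Y \<omega> \<partial>Q)" if "Y \<in> A" for Y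
    proof -
      have "Y \<in> range (from_nat_into A)" using that rA by simp
      then obtain k where "Y = from_nat_into A k" by blast
      then show ?thesis using eq by simp
    qed
    obtain c where c: "0 < c" "BL_unit T (\<lambda>\<omega>. c * X \<omega>)" by (rule Lip_BL_unit_multiple[OF X])
    have "\<bar>(\<integral>\<omega>. c * X \<omega> \<partial>P) - (\<integral>\<omega>. c * X \<omega> \<partial>Q)\<bar> \<le> 25 * (1 / real (Suc n))" for n
    proof -
      have "\<forall>Y\<in>\<Psi> n. \<bar>(\<integral>\<omega>. Y \<omega> \<partial>P) - (\<integral>\<omega>. Y \<omega> \<partial>Q)\<bar> \<le> 1 / real (Suc n)"
      proof
        fix Y assume "Y \<in> \<Psi> n"
        then have "Y \<in> A" by (auto simp: A_def)
        from eqA[OF this] show "\<bar>(\<integral>\<omega>. Y \<omega> \<partial>P) - (\<integral>\<omega>. Y \<omega> \<partial>Q)\<bar> \<le> 1 / real (Suc n)" by simp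
      qed
      then show ?thesis using \<Psi> P Q c(2) by blast
    qed
    moreover have "(\<lambda>n. 25 * (1 / real (Suc n))) \<longlonglongrightarrow> 25 * 0"
      using LIMSEQ_inverse_real_of_nat by (intro tendsto_mult tendsto_const) (simp add: inverse_eq_divide)
    ultimately have "\<bar>(\<integral>\<omega>. c * X \<omega> \<partial>P) - (\<integral>\<omega>. c * X \<omega> \<partial>Q)\<bar> \<le> 25 * 0" by (intro LIMSEQ_le_const) auto
    then show "(\<integral>\<omega>. X \<omega> \<partial>P) = (\<integral>\<omega>. X \<omega> \<partial>Q)" using c(1) by simp
  qed
qed

lemma BL_dist_le:
  assumes "\<And>f. BL_unit T f \<Longrightarrow> \<bar>(\<integral>\<omega>. f \<omega> \<partial>P) - (\<integral>\<omega>. f \<omega> \<partial>Q)\<bar> \<le> e"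
  shows "BL_dist T P Q \<le> e"
  unfolding BL_dist_def
proof (rule cSUP_least)
  show "{f. BL_norm T f \<le> 1} \<noteq> {}" using BL_norm_zero by blast
  fix f assume "f \<in> {f. BL_norm T f \<le> 1}"
  then have "BL_unit T f" using BL_norm_le_1_imp_BL_unit by simp
  from assms[OF this] show "(\<integral>\<omega>. f \<omega> \<partial>P) - (\<integral>\<omega>. f \<omega> \<partial>Q) \<le> e" by simp
qed

end

section \<open>The completions and the upper expectation\<close>

context moment_bound begin

lemma dominatedD:
  assumes "P \<in> dominated T E"
  shows "prob_space P" "sets P = sets (path_borel T)" "space P = \<Omega>"
    "f \<in> borel_measurable (path_borel T) \<Longrightarrow> f \<in> borel_measurable P"
proof -
  show s: "prob_space P" "sets P = sets (path_borel T)" using assms by (auto simp: dominated_def)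
  show "space P = \<Omega>" using sets_eq_imp_space_eq[OF s(2)] by (simp add: space_path_borel)
  show "f \<in> borel_measurable (path_borel T) \<Longrightarrow> f \<in> borel_measurable P" using s(2) by (simp cong: measurable_cong_sets)
qed

lemma nn_integral_le_combination:
  fixes g h k :: "'a \<Rightarrow> real"
  assumes m: "h \<in> borel_measurable P" "k \<in> borel_measurable P" and c: "0 \<le> c" "0 \<le> d"
    and nn: "\<And>x. 0 \<le> h x" "\<And>x. 0 \<le> k x" and le: "\<And>x. g x \<le> c * h x + d * k x"
  shows "(\<integral>\<^sup>+x. ennreal (g x) \<partial>P) \<le> ennreal c * (\<integral>\<^sup>+x. ennreal (h x) \<partial>P) + ennreal d * (\<integral>\<^sup>+x. ennreal (k x) \<partial>P)"
proof -
  have "(\<integral>\<^sup>+x. ennreal (g x) \<partial>P) \<le> (\<integral>\<^sup>+x. ennreal c * ennreal (h x) + ennreal d * ennreal (k x) \<partial>P)"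
  proof (rule nn_integral_mono)
    fix x
    have "ennreal (g x) \<le> ennreal (c * h x + d * k x)" by (rule ennreal_leI[OF le])
    also have "\<dots> = ennreal c * ennreal (h x) + ennreal d * ennreal (k x)" using c nn by (simp add: ennreal_mult)
    finally show "ennreal (g x) \<le> ennreal c * ennreal (h x) + ennreal d * ennreal (k x)" .
  qed
  also have "\<dots> = ennreal c * (\<integral>\<^sup>+x. ennreal (h x) \<partial>P) + ennreal d * (\<integral>\<^sup>+x. ennreal (k x) \<partial>P)"
    using m by (simp add: nn_integral_add nn_integral_cmult)
  finally show ?thesis .
qed

text \<open>
  Approximation of \<open>f\<close> by cylinder functions in the \<open>p\<close>-th mean, uniformly over the dominated
  probabilities; for \<open>p\<close> equal to \<open>1\<close> or \<open>2\<close> this is implied by membership in the completion.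
\<close>

definition uniform_approx :: "nat \<Rightarrow> (nat \<Rightarrow> (real \<Rightarrow> real) \<Rightarrow> real) \<Rightarrow> ((real \<Rightarrow> real) \<Rightarrow> real) \<Rightarrow> bool" where
  "uniform_approx p X f \<longleftrightarrow> f \<in> borel_measurable (path_borel T) \<and> (\<forall>n. X n \<in> Lip T) \<and>
     (\<forall>e>0. \<exists>N. \<forall>n\<ge>N. \<forall>P\<in>dominated T E. (\<integral>\<^sup>+\<omega>. ennreal (\<bar>X n \<omega> - f \<omega>\<bar> ^ p) \<partial>P) \<le> ennreal e)"

lemma uniform_approxD:
  assumes "uniform_approx p X f"
  shows "f \<in> borel_measurable (path_borel T)" "X n \<in> Lip T"
    "0 < e \<Longrightarrow> \<exists>N. \<forall>n\<ge>N. \<forall>P\<in>dominated T E. (\<integral>\<^sup>+\<omega>. ennreal (\<bar>X n \<omega> - f \<omega>\<bar> ^ p) \<partial>P) \<le> ennreal e"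
  using assms unfolding uniform_approx_def by blast+

lemma Lip_abs_diff_power: "X \<in> Lip T \<Longrightarrow> Y \<in> Lip T \<Longrightarrow> (\<lambda>\<omega>. \<bar>X \<omega> - Y \<omega>\<bar> ^ p) \<in> Lip T"
  by (intro Lip_power Lip_abs Lip_diff T0)

lemma nn_integral_Lip_le:
  assumes P: "P \<in> dominated T E" and X: "X \<in> Lip T" and nn: "\<And>\<omega>. 0 \<le> X \<omega>"
  shows "(\<integral>\<^sup>+\<omega>. ennreal (X \<omega>) \<partial>P) \<le> ennreal (E X)"
proof -
  have "(\<integral>\<^sup>+\<omega>. ennreal (X \<omega>) \<partial>P) = ennreal (\<integral>\<omega>. X \<omega> \<partial>P)"
    using nn by (intro nn_integral_eq_integral Lip_integrable[OF P X]) auto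
  also have "\<dots> \<le> ennreal (E X)" using P X by (intro ennreal_leI) (simp add: dominated_def)
  finally show ?thesis .
qed

lemma abs_power_le: "p = 1 \<or> p = 2 \<Longrightarrow> \<bar>x - z\<bar> ^ p \<le> 2 * \<bar>x - y\<bar> ^ p + 2 * \<bar>y - z\<bar> ^ p" for x y z :: real
proof (elim disjE)
  assume "p = 2"
  moreover have "(x - z)\<^sup>2 \<le> 2 * (x - y)\<^sup>2 + 2 * (y - z)\<^sup>2"
    using zero_le_power2[of "(x - y) - (y - z)"] by (simp add: power2_eq_square algebra_simps)
  ultimately show ?thesis by simp
next
  assume p: "p = 1"
  have "\<bar>x - z\<bar> \<le> 2 * \<bar>x - y\<bar> + 2 * \<bar>y - z\<bar>"
  proof -
    have "\<bar>x - z\<bar> \<le> \<bar>x - y\<bar> + \<bar>y - z\<bar>" using abs_triangle_ineq[of "x - y" "y - z"] by simp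
    also have "\<dots> \<le> 2 * \<bar>x - y\<bar> + 2 * \<bar>y - z\<bar>" by (intro add_mono) auto
    finally show ?thesis .
  qed
  then show ?thesis by (simp add: p)
qed

lemma represents_imp_uniform_approx:
  assumes p: "p = 1 \<or> p = 2" and r: "represents T E p X f"
  shows "uniform_approx p X f"
proof -
  have f: "f \<in> borel_measurable (path_borel T)" and X: "X n \<in> Lip T" for n using r by (auto simp: represents_def)
  have cau: "\<forall>e>0. \<exists>N. \<forall>m\<ge>N. \<forall>n\<ge>N. root p (E (\<lambda>\<omega>. \<bar>X m \<omega> - X n \<omega>\<bar> ^ p)) < e"
    and lim: "\<And>P. P \<in> dominated T E \<Longrightarrow> (\<lambda>n. \<integral>\<^sup>+\<omega>. ennreal (\<bar>X n \<omega> - f \<omega>\<bar> ^ p) \<partial>P) \<longlonglongrightarrow> 0"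
    using r unfolding represents_def by blast+
  have p0: "0 < p" using p by auto
  have "\<exists>N. \<forall>n\<ge>N. \<forall>P\<in>dominated T E. (\<integral>\<^sup>+\<omega>. ennreal (\<bar>X n \<omega> - f \<omega>\<bar> ^ p) \<partial>P) \<le> ennreal e" if e: "0 < e" for e
  proof -
    have "0 < root p (e / 2)" using e p0 by simp
    then obtain N where N: "\<And>m n. m \<ge> N \<Longrightarrow> n \<ge> N \<Longrightarrow> root p (E (\<lambda>\<omega>. \<bar>X m \<omega> - X n \<omega>\<bar> ^ p)) < root p (e / 2)"
      using cau by blast
    have EN: "E (\<lambda>\<omega>. \<bar>X n \<omega> - X m \<omega>\<bar> ^ p) \<le> e / 2" if "m \<ge> N" "n \<ge> N" for m n
      using N[OF that(2,1)] p0 by simp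
    have "(\<integral>\<^sup>+\<omega>. ennreal (\<bar>X n \<omega> - f \<omega>\<bar> ^ p) \<partial>P) \<le> ennreal e" if n: "n \<ge> N" and P: "P \<in> dominated T E" for n P
    proof -
      let ?I = "\<lambda>m. \<integral>\<^sup>+\<omega>. ennreal (\<bar>X m \<omega> - f \<omega>\<bar> ^ p) \<partial>P"
      have le: "?I n \<le> ennreal e + 2 * ?I m" if m: "m \<ge> N" for m
      proof -
        have "?I n \<le> ennreal 2 * (\<integral>\<^sup>+\<omega>. ennreal (\<bar>X n \<omega> - X m \<omega>\<bar> ^ p) \<partial>P) + ennreal 2 * ?I m"
          using Lip_measurable[OF T0 X] f
          by (intro nn_integral_le_combination abs_power_le p) (auto intro!: dominatedD(4)[OF P] borel_measurable_power borel_measurable_abs borel_measurable_diff)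
        also have "\<dots> \<le> ennreal 2 * ennreal (e / 2) + ennreal 2 * ?I m"
          by (intro add_right_mono mult_left_mono order.trans[OF nn_integral_Lip_le[OF P Lip_abs_diff_power[OF X X]]] ennreal_leI EN m n) auto
        also have "ennreal 2 * ennreal (e / 2) = ennreal e" using ennreal_mult[of 2 "e / 2"] e by simp
        finally show ?thesis by simp
      qed
      have "(\<lambda>m. ennreal e + 2 * ?I m) \<longlonglongrightarrow> ennreal e + 2 * 0"
        by (intro tendsto_add tendsto_const ennreal_tendsto_cmult lim[OF P]) simp
      then show ?thesis using le by (intro LIMSEQ_le_const[of _ "ennreal e"]) auto
    qed
    then show ?thesis by blast
  qed
  then show ?thesis unfolding uniform_approx_def using f X by blast
qed

lemma uniform_approx_2_imp_1:
  assumes u: "uniform_approx 2 X f"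
  shows "uniform_approx 1 X f"
proof -
  note f = uniform_approxD(1)[OF u] and X = uniform_approxD(2)[OF u]
  have "\<exists>N. \<forall>n\<ge>N. \<forall>P\<in>dominated T E. (\<integral>\<^sup>+\<omega>. ennreal (\<bar>X n \<omega> - f \<omega>\<bar> ^ 1) \<partial>P) \<le> ennreal e" if e: "0 < e" for e
  proof -
    define d where "d = e / 2"
    have d: "0 < d" using e by (simp add: d_def)
    obtain N where N: "\<And>n P. n \<ge> N \<Longrightarrow> P \<in> dominated T E \<Longrightarrow> (\<integral>\<^sup>+\<omega>. ennreal (\<bar>X n \<omega> - f \<omega>\<bar> ^ 2) \<partial>P) \<le> ennreal (d * d)"
      using uniform_approxD(3)[OF u, of "d * d"] d by auto
    have "(\<integral>\<^sup>+\<omega>. ennreal (\<bar>X n \<omega> - f \<omega>\<bar> ^ 1) \<partial>P) \<le> ennreal e" if n: "n \<ge> N" and P: "P \<in> dominated T E" for n P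
    proof -
      interpret prob_space P by (rule dominatedD[OF P])
      have yg: "\<bar>x\<bar> ^ 1 \<le> d * 1 + 1 / d * \<bar>x\<bar> ^ 2" for x :: real
      proof (cases "\<bar>x\<bar> \<le> d")
        case True then show ?thesis using d by (simp add: add_increasing2)
      next
        case False
        then have "d * \<bar>x\<bar> \<le> \<bar>x\<bar> * \<bar>x\<bar>" by (intro mult_right_mono) auto
        then have "\<bar>x\<bar> \<le> 1 / d * \<bar>x\<bar> ^ 2" using d by (simp add: field_simps power2_eq_square)
        then show ?thesis using d by simp
      qed
      have "(\<integral>\<^sup>+\<omega>. ennreal (\<bar>X n \<omega> - f \<omega>\<bar> ^ 1) \<partial>P) \<le> ennreal d * (\<integral>\<^sup>+\<omega>. ennreal 1 \<partial>P) + ennreal (1 / d) * (\<integral>\<^sup>+\<omega>. ennreal (\<bar>X n \<omega> - f \<omega>\<bar> ^ 2) \<partial>P)"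
        using d Lip_measurable[OF T0 X] f
        by (intro nn_integral_le_combination yg) (auto intro!: dominatedD(4)[OF P] borel_measurable_power borel_measurable_abs borel_measurable_diff)
      also have "\<dots> \<le> ennreal d * 1 + ennreal (1 / d) * ennreal (d * d)"
        using N[OF n P] by (intro add_mono mult_left_mono) (auto simp: emeasure_space_1)
      also have "\<dots> = ennreal e" using d by (simp add: ennreal_mult[symmetric] ennreal_plus[symmetric] d_def del: ennreal_plus)
      finally show ?thesis .
    qed
    then show ?thesis by blast
  qed
  then show ?thesis unfolding uniform_approx_def using f X by blast
qed

lemma uniform_approx_integrable:
  assumes u: "uniform_approx 1 X f" and P: "P \<in> dominated T E"
  shows "integrable P f"
proof -
  obtain N where N: "(\<integral>\<^sup>+\<omega>. ennreal (\<bar>X N \<omega> - f \<omega>\<bar> ^ 1) \<partial>P) \<le> ennreal 1"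
    using uniform_approxD(3)[OF u, of 1] P by force
  have XN: "integrable P (X N)" by (rule Lip_integrable[OF P uniform_approxD(2)[OF u]])
  have "integrable P (\<lambda>\<omega>. X N \<omega> - f \<omega>)"
  proof (rule integrableI_bounded)
    show "(\<lambda>\<omega>. X N \<omega> - f \<omega>) \<in> borel_measurable P"
      using XN dominatedD(4)[OF P uniform_approxD(1)[OF u]] by simp
    have "(\<integral>\<^sup>+\<omega>. ennreal (norm (X N \<omega> - f \<omega>)) \<partial>P) \<le> ennreal 1" using N by simp
    then show "(\<integral>\<^sup>+\<omega>. ennreal (norm (X N \<omega> - f \<omega>)) \<partial>P) < \<infinity>" by (rule le_less_trans) simp
  qed
  from Bochner_Integration.integrable_diff[OF XN this] show ?thesis by simp
qed

lemma uniform_approx_integral_le: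
  assumes u: "uniform_approx 1 X f" and P: "P \<in> dominated T E" and e: "0 \<le> e"
    and b: "(\<integral>\<^sup>+\<omega>. ennreal (\<bar>X n \<omega> - f \<omega>\<bar> ^ 1) \<partial>P) \<le> ennreal e"
  shows "\<bar>(\<integral>\<omega>. X n \<omega> \<partial>P) - (\<integral>\<omega>. f \<omega> \<partial>P)\<bar> \<le> e"
proof -
  have i: "integrable P (X n)" "integrable P f" using Lip_integrable[OF P uniform_approxD(2)[OF u]] uniform_approx_integrable[OF u P] by auto
  have "ennreal (\<integral>\<omega>. \<bar>X n \<omega> - f \<omega>\<bar> \<partial>P) = (\<integral>\<^sup>+\<omega>. ennreal (\<bar>X n \<omega> - f \<omega>\<bar>) \<partial>P)"
    using i by (intro nn_integral_eq_integral[symmetric]) auto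
  then have "ennreal (\<integral>\<omega>. \<bar>X n \<omega> - f \<omega>\<bar> \<partial>P) \<le> ennreal e" using b by simp
  then have "(\<integral>\<omega>. \<bar>X n \<omega> - f \<omega>\<bar> \<partial>P) \<le> e" using e by simp
  moreover have "\<bar>\<integral>\<omega>. X n \<omega> - f \<omega> \<partial>P\<bar> \<le> (\<integral>\<omega>. \<bar>X n \<omega> - f \<omega>\<bar> \<partial>P)" by (rule integral_abs_bound)
  ultimately show ?thesis using i by simp
qed

lemma uniform_approx_integral_uniform:
  assumes u: "uniform_approx 1 X f" and e: "0 < e"
  shows "\<exists>N. \<forall>n\<ge>N. \<forall>P\<in>dominated T E. \<bar>(\<integral>\<omega>. X n \<omega> \<partial>P) - (\<integral>\<omega>. f \<omega> \<partial>P)\<bar> \<le> e"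
  using uniform_approxD(3)[OF u e] uniform_approx_integral_le[OF u] e by (meson less_imp_le)

lemma dominated_nonempty: "dominated T E \<noteq> {}"
  using dominated_max[OF Lip_const[OF T0]] by blast

lemma uniform_approx_bdd_above:
  assumes u: "uniform_approx 1 X f"
  shows "bdd_above ((\<lambda>P. \<integral>\<omega>. f \<omega> \<partial>P) ` dominated T E)"
proof -
  obtain N where N: "\<And>P. P \<in> dominated T E \<Longrightarrow> \<bar>(\<integral>\<omega>. X N \<omega> \<partial>P) - (\<integral>\<omega>. f \<omega> \<partial>P)\<bar> \<le> 1"
    using uniform_approx_integral_uniform[OF u, of 1] by auto
  have XE: "(\<integral>\<omega>. X N \<omega> \<partial>P) \<le> E (X N)" if "P \<in> dominated T E" for P
    using that uniform_approxD(2)[OF u] by (simp add: dominated_def)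
  show ?thesis by (rule bdd_aboveI2[of _ _ "E (X N) + 1"]) (use N XE in fastforce)
qed

lemma uniform_approx_E_limit:
  assumes u: "uniform_approx 1 X f"
  shows "(\<lambda>n. E (X n)) \<longlonglongrightarrow> (SUP P\<in>dominated T E. \<integral>\<omega>. f \<omega> \<partial>P)"
proof (rule LIMSEQ_I)
  let ?S = "SUP P\<in>dominated T E. \<integral>\<omega>. f \<omega> \<partial>P"
  fix r :: real assume r: "0 < r"
  obtain N where N: "\<And>n P. n \<ge> N \<Longrightarrow> P \<in> dominated T E \<Longrightarrow> \<bar>(\<integral>\<omega>. X n \<omega> \<partial>P) - (\<integral>\<omega>. f \<omega> \<partial>P)\<bar> \<le> r / 2"
    using uniform_approx_integral_uniform[OF u, of "r / 2"] r by auto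
  have "norm (E (X n) - ?S) < r" if n: "n \<ge> N" for n
  proof -
    obtain P where P: "P \<in> dominated T E" "(\<integral>\<omega>. X n \<omega> \<partial>P) = E (X n)" using dominated_max[OF uniform_approxD(2)[OF u]] by blast
    have "(\<integral>\<omega>. f \<omega> \<partial>P) \<le> ?S" by (rule cSUP_upper[OF P(1) uniform_approx_bdd_above[OF u]])
    then have 1: "E (X n) \<le> ?S + r / 2" using N[OF n P(1)] P(2) by linarith
    have "?S \<le> E (X n) + r / 2"
    proof (rule cSUP_least[OF dominated_nonempty])
      fix Q assume Q: "Q \<in> dominated T E"
      then have "(\<integral>\<omega>. X n \<omega> \<partial>Q) \<le> E (X n)" using uniform_approxD(2)[OF u] by (simp add: dominated_def)
      then show "(\<integral>\<omega>. f \<omega> \<partial>Q) \<le> E (X n) + r / 2" using N[OF n Q] by linarith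
    qed
    then show ?thesis using 1 r by auto
  qed
  then show "\<exists>no. \<forall>n\<ge>no. norm (E (X n) - ?S) < r" by blast
qed

text \<open>
  For \<open>p = 1\<close> the converse holds because \<open>E\<close> is attained by a dominated probability.
\<close>

lemma uniform_approx_imp_represents:
  assumes u: "uniform_approx 1 X f"
  shows "represents T E 1 X f"
  unfolding represents_def
proof (intro conjI allI impI ballI)
  show "X n \<in> Lip T" for n by (rule uniform_approxD(2)[OF u])
  show "f \<in> borel_measurable (path_borel T)" by (rule uniform_approxD(1)[OF u])
  show "(\<lambda>n. \<integral>\<^sup>+\<omega>. ennreal (\<bar>X n \<omega> - f \<omega>\<bar> ^ 1) \<partial>P) \<longlonglongrightarrow> 0" if P: "P \<in> dominated T E" for P
  proof (rule tendsto_0_if_Limsup_eq_0_ennreal, rule antisym)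
    show "limsup (\<lambda>n. \<integral>\<^sup>+\<omega>. ennreal (\<bar>X n \<omega> - f \<omega>\<bar> ^ 1) \<partial>P) \<le> 0"
    proof (rule ennreal_le_epsilon)
      fix e :: real assume "0 < e"
      then obtain N where "\<And>n. n \<ge> N \<Longrightarrow> (\<integral>\<^sup>+\<omega>. ennreal (\<bar>X n \<omega> - f \<omega>\<bar> ^ 1) \<partial>P) \<le> ennreal e"
        using uniform_approxD(3)[OF u] P by blast
      then have "limsup (\<lambda>n. \<integral>\<^sup>+\<omega>. ennreal (\<bar>X n \<omega> - f \<omega>\<bar> ^ 1) \<partial>P) \<le> ennreal e"
        by (intro Limsup_bounded) (auto simp: eventually_sequentially)
      then show "limsup (\<lambda>n. \<integral>\<^sup>+\<omega>. ennreal (\<bar>X n \<omega> - f \<omega>\<bar> ^ 1) \<partial>P) \<le> 0 + ennreal e" by simp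
    qed
  qed simp
  fix e :: real assume e: "0 < e"
  obtain N where N: "\<And>n P. n \<ge> N \<Longrightarrow> P \<in> dominated T E \<Longrightarrow> (\<integral>\<^sup>+\<omega>. ennreal (\<bar>X n \<omega> - f \<omega>\<bar> ^ 1) \<partial>P) \<le> ennreal (e / 3)"
    using uniform_approxD(3)[OF u, of "e / 3"] e by auto
  show "\<exists>N. \<forall>m\<ge>N. \<forall>n\<ge>N. root 1 (E (\<lambda>\<omega>. \<bar>X m \<omega> - X n \<omega>\<bar> ^ 1)) < e"
  proof (intro exI allI impI)
    fix m n assume mn: "N \<le> m" "N \<le> n"
    have XL: "(\<lambda>\<omega>. \<bar>X m \<omega> - X n \<omega>\<bar> ^ 1) \<in> Lip T" by (intro Lip_abs_diff_power uniform_approxD(2)[OF u])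
    obtain P where P: "P \<in> dominated T E" "(\<integral>\<omega>. \<bar>X m \<omega> - X n \<omega>\<bar> ^ 1 \<partial>P) = E (\<lambda>\<omega>. \<bar>X m \<omega> - X n \<omega>\<bar> ^ 1)"
      using dominated_max[OF XL] by blast
    have "ennreal (\<integral>\<omega>. \<bar>X m \<omega> - X n \<omega>\<bar> ^ 1 \<partial>P) = (\<integral>\<^sup>+\<omega>. ennreal (\<bar>X m \<omega> - X n \<omega>\<bar> ^ 1) \<partial>P)"
      by (intro nn_integral_eq_integral[symmetric] Lip_integrable[OF P(1) XL]) auto
    also have "\<dots> \<le> ennreal 1 * (\<integral>\<^sup>+\<omega>. ennreal (\<bar>X m \<omega> - f \<omega>\<bar> ^ 1) \<partial>P) + ennreal 1 * (\<integral>\<^sup>+\<omega>. ennreal (\<bar>X n \<omega> - f \<omega>\<bar> ^ 1) \<partial>P)"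
      using Lip_measurable[OF T0 uniform_approxD(2)[OF u]] uniform_approxD(1)[OF u]
      by (intro nn_integral_le_combination) (auto intro!: dominatedD(4)[OF P(1)] borel_measurable_abs borel_measurable_diff)
    also have "\<dots> \<le> ennreal 1 * ennreal (e / 3) + ennreal 1 * ennreal (e / 3)"
      by (intro add_mono mult_left_mono N mn P) auto
    also have "\<dots> = ennreal (2 * e / 3)" using e by (simp add: ennreal_plus[symmetric] del: ennreal_plus)
    finally have "E (\<lambda>\<omega>. \<bar>X m \<omega> - X n \<omega>\<bar> ^ 1) \<le> 2 * e / 3" using e P(2) by simp
    then show "root 1 (E (\<lambda>\<omega>. \<bar>X m \<omega> - X n \<omega>\<bar> ^ 1)) < e" using e by simp
  qed
qed

text \<open>
  The limit defining \<open>Ehat T E f\<close> does not depend on the approximating sequence, being the upper expectation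
  over the dominated probabilities.
\<close>

lemma Ehat_eq:
  assumes u: "uniform_approx 1 X f"
  shows "Ehat T E f = (SUP P\<in>dominated T E. \<integral>\<omega>. f \<omega> \<partial>P)"
  unfolding Ehat_def
proof (rule the_equality)
  show "\<exists>X. represents T E 1 X f \<and> (\<lambda>n. E (X n)) \<longlonglongrightarrow> (SUP P\<in>dominated T E. \<integral>\<omega>. f \<omega> \<partial>P)"
    using uniform_approx_imp_represents[OF u] uniform_approx_E_limit[OF u] by blast
  fix c assume "\<exists>X. represents T E 1 X f \<and> (\<lambda>n. E (X n)) \<longlonglongrightarrow> c"
  then obtain Y where "represents T E 1 Y f" "(\<lambda>n. E (Y n)) \<longlonglongrightarrow> c" by blast
  then show "c = (SUP P\<in>dominated T E. \<integral>\<omega>. f \<omega> \<partial>P)"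
    using uniform_approx_E_limit[OF represents_imp_uniform_approx] LIMSEQ_unique by blast
qed

lemma integral_le_Ehat: "uniform_approx 1 X f \<Longrightarrow> P \<in> dominated T E \<Longrightarrow> (\<integral>\<omega>. f \<omega> \<partial>P) \<le> Ehat T E f"
  using Ehat_eq cSUP_upper[OF _ uniform_approx_bdd_above] by metis

lemma LG_unif: "p = 1 \<or> p = 2 \<Longrightarrow> f \<in> LG T E p T \<Longrightarrow> \<exists>X. uniform_approx p X f"
  unfolding LG_def using represents_imp_uniform_approx by blast

lemma uniform_approx_Lip: "X \<in> Lip T \<Longrightarrow> uniform_approx 1 (\<lambda>_. X) X"
  unfolding uniform_approx_def using Lip_measurable[OF T0] by simp

lemma Ehat_Lip: 
  assumes X: "X \<in> Lip T"
  shows "Ehat T E X = E X"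
proof -
  have "(\<lambda>n::nat. E X) \<longlonglongrightarrow> Ehat T E X" using uniform_approx_E_limit[OF uniform_approx_Lip[OF X]] Ehat_eq[OF uniform_approx_Lip[OF X]] by simp
  then show ?thesis using LIMSEQ_unique[OF _ tendsto_const] by blast
qed

lemma Probs_eq: "Probs T E = dominated T E"
proof (intro set_eqI iffI)
  fix P assume P: "P \<in> Probs T E"
  have "(\<integral>\<omega>. X \<omega> \<partial>P) \<le> E X" if X: "X \<in> Lip T" for X
  proof -
    have "X \<in> LG T E 1 T" unfolding LG_def using uniform_approx_imp_represents[OF uniform_approx_Lip[OF X]] X
      by (intro CollectI exI[of _ "\<lambda>_. X"]) simp
    then show ?thesis using P Ehat_Lip[OF X] by (auto simp: Probs_def)
  qed
  then show "P \<in> dominated T E" using P by (auto simp: Probs_def dominated_def)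
next
  fix P assume P: "P \<in> dominated T E"
  have "(\<integral>\<omega>. X \<omega> \<partial>P) \<le> Ehat T E X" if "X \<in> LG T E 1 T" for X
    using LG_unif[of 1 X] that integral_le_Ehat[OF _ P] by blast
  then show "P \<in> Probs T E" using P by (auto simp: Probs_def dominated_def)
qed

lemma uniform_approx_diff:
  assumes X: "uniform_approx 2 X f" and Y: "uniform_approx 2 Y g"
  shows "uniform_approx 2 (\<lambda>n \<omega>. X n \<omega> - Y n \<omega>) (\<lambda>\<omega>. f \<omega> - g \<omega>)"
proof -
  have m: "f \<in> borel_measurable (path_borel T)" "g \<in> borel_measurable (path_borel T)" using uniform_approxD(1)[OF X] uniform_approxD(1)[OF Y] .
  have "\<exists>N. \<forall>n\<ge>N. \<forall>P\<in>dominated T E. (\<integral>\<^sup>+\<omega>. ennreal (\<bar>(X n \<omega> - Y n \<omega>) - (f \<omega> - g \<omega>)\<bar> ^ 2) \<partial>P) \<le> ennreal e" if e: "0 < e" for e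
  proof -
    obtain N1 where N1: "\<And>n P. n \<ge> N1 \<Longrightarrow> P \<in> dominated T E \<Longrightarrow> (\<integral>\<^sup>+\<omega>. ennreal (\<bar>X n \<omega> - f \<omega>\<bar> ^ 2) \<partial>P) \<le> ennreal (e / 4)"
      using uniform_approxD(3)[OF X, of "e / 4"] e by auto
    obtain N2 where N2: "\<And>n P. n \<ge> N2 \<Longrightarrow> P \<in> dominated T E \<Longrightarrow> (\<integral>\<^sup>+\<omega>. ennreal (\<bar>Y n \<omega> - g \<omega>\<bar> ^ 2) \<partial>P) \<le> ennreal (e / 4)"
      using uniform_approxD(3)[OF Y, of "e / 4"] e by auto
    have "(\<integral>\<^sup>+\<omega>. ennreal (\<bar>(X n \<omega> - Y n \<omega>) - (f \<omega> - g \<omega>)\<bar> ^ 2) \<partial>P) \<le> ennreal e"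
      if n: "n \<ge> max N1 N2" and P: "P \<in> dominated T E" for n P
    proof -
      have q: "\<bar>(a - b) - (c - d)\<bar> ^ 2 \<le> 2 * \<bar>a - c\<bar> ^ 2 + 2 * \<bar>b - d\<bar> ^ 2" for a b c d :: real
      proof -
        have "\<bar>x - z\<bar> ^ 2 \<le> 2 * \<bar>x\<bar> ^ 2 + 2 * \<bar>z\<bar> ^ 2" for x z :: real using abs_power_le[of 2 x z 0] by simp
        moreover have "(a - b) - (c - d) = (a - c) - (b - d)" by simp
        ultimately show ?thesis by (simp only:)
      qed
      have "(\<integral>\<^sup>+\<omega>. ennreal (\<bar>(X n \<omega> - Y n \<omega>) - (f \<omega> - g \<omega>)\<bar> ^ 2) \<partial>P) \<le>
         ennreal 2 * (\<integral>\<^sup>+\<omega>. ennreal (\<bar>X n \<omega> - f \<omega>\<bar> ^ 2) \<partial>P) + ennreal 2 * (\<integral>\<^sup>+\<omega>. ennreal (\<bar>Y n \<omega> - g \<omega>\<bar> ^ 2) \<partial>P)"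
        using Lip_measurable[OF T0 uniform_approxD(2)[OF X]] Lip_measurable[OF T0 uniform_approxD(2)[OF Y]] m
        by (intro nn_integral_le_combination q) (auto intro!: dominatedD(4)[OF P] borel_measurable_power borel_measurable_abs borel_measurable_diff)
      also have "\<dots> \<le> ennreal 2 * ennreal (e / 4) + ennreal 2 * ennreal (e / 4)"
        using n by (intro add_mono mult_left_mono N1 N2 P) auto
      also have "ennreal 2 * ennreal (e / 4) = ennreal (e / 2)" using ennreal_mult[of 2 "e / 4"] e by simp
      also have "ennreal (e / 2) + ennreal (e / 2) = ennreal e"
        using e by (simp add: ennreal_plus[symmetric] del: ennreal_plus)
      finally show ?thesis .
    qed
    then show ?thesis by blast
  qed
  then show ?thesis unfolding uniform_approx_def using m Lip_diff[OF T0 uniform_approxD(2)[OF X] uniform_approxD(2)[OF Y]] by auto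
qed

lemma uniform_approx_square:
  assumes X: "uniform_approx 2 X f"
  shows "uniform_approx 1 (\<lambda>n \<omega>. (X n \<omega>)\<^sup>2) (\<lambda>\<omega>. (f \<omega>)\<^sup>2)"
proof -
  have m: "f \<in> borel_measurable (path_borel T)" by (rule uniform_approxD(1)[OF X])
  obtain N0 where N0: "\<And>P. P \<in> dominated T E \<Longrightarrow> (\<integral>\<^sup>+\<omega>. ennreal (\<bar>X N0 \<omega> - f \<omega>\<bar> ^ 2) \<partial>P) \<le> ennreal 1"
    using uniform_approxD(3)[OF X, of 1] by auto
  have sqL: "(\<lambda>\<omega>. \<bar>X N0 \<omega>\<bar> ^ 2) \<in> Lip T" by (intro Lip_power Lip_abs T0 uniform_approxD(2)[OF X])
  define B where "B = 2 * \<bar>E (\<lambda>\<omega>. \<bar>X N0 \<omega>\<bar> ^ 2)\<bar> + 2"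
  have B: "0 < B" by (simp add: B_def)
  have fB: "(\<integral>\<^sup>+\<omega>. ennreal (\<bar>f \<omega>\<bar> ^ 2) \<partial>P) \<le> ennreal B" if P: "P \<in> dominated T E" for P
  proof -
    have q: "\<bar>b\<bar> ^ 2 \<le> 2 * \<bar>a\<bar> ^ 2 + 2 * \<bar>a - b\<bar> ^ 2" for a b :: real
      using abs_power_le[of 2 0 b a] by simp
    have "(\<integral>\<^sup>+\<omega>. ennreal (\<bar>f \<omega>\<bar> ^ 2) \<partial>P) \<le> ennreal 2 * (\<integral>\<^sup>+\<omega>. ennreal (\<bar>X N0 \<omega>\<bar> ^ 2) \<partial>P) + ennreal 2 * (\<integral>\<^sup>+\<omega>. ennreal (\<bar>X N0 \<omega> - f \<omega>\<bar> ^ 2) \<partial>P)"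
      using Lip_measurable[OF T0 uniform_approxD(2)[OF X]] m
      by (intro nn_integral_le_combination q) (auto intro!: dominatedD(4)[OF P] borel_measurable_power borel_measurable_abs borel_measurable_diff)
    also have "\<dots> \<le> ennreal 2 * ennreal \<bar>E (\<lambda>\<omega>. \<bar>X N0 \<omega>\<bar> ^ 2)\<bar> + ennreal 2 * ennreal 1"
      by (intro add_mono mult_left_mono N0 P order.trans[OF nn_integral_Lip_le[OF P sqL]] ennreal_leI) auto
    also have "\<dots> = ennreal B" by (simp add: B_def ennreal_mult)
    finally show ?thesis .
  qed
  have "\<exists>N. \<forall>n\<ge>N. \<forall>P\<in>dominated T E. (\<integral>\<^sup>+\<omega>. ennreal (\<bar>(X n \<omega>)\<^sup>2 - (f \<omega>)\<^sup>2\<bar> ^ 1) \<partial>P) \<le> ennreal e" if e: "0 < e" for e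
  proof -
    define d where "d = e / (2 * B)"
    have d: "0 < d" using e B by (simp add: d_def)
    define k where "k = 1 + 1 / d"
    have k: "0 < k" using d by (simp add: k_def add_pos_pos)
    obtain N where N: "\<And>n P. n \<ge> N \<Longrightarrow> P \<in> dominated T E \<Longrightarrow> (\<integral>\<^sup>+\<omega>. ennreal (\<bar>X n \<omega> - f \<omega>\<bar> ^ 2) \<partial>P) \<le> ennreal (e / (2 * k))"
      using uniform_approxD(3)[OF X, of "e / (2 * k)"] e k by auto
    have q: "\<bar>a\<^sup>2 - b\<^sup>2\<bar> ^ 1 \<le> k * \<bar>a - b\<bar> ^ 2 + d * \<bar>b\<bar> ^ 2" for a b :: real
    proof -
      have "0 \<le> (\<bar>a - b\<bar> / sqrt d - sqrt d * \<bar>b\<bar>)\<^sup>2" by simp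
      also have "\<dots> = (1 / d) * \<bar>a - b\<bar> ^ 2 + d * \<bar>b\<bar> ^ 2 - 2 * (\<bar>a - b\<bar> * \<bar>b\<bar>)"
        using d by (simp add: power2_diff power_divide power_mult_distrib)
      finally have y: "2 * (\<bar>a - b\<bar> * \<bar>b\<bar>) \<le> (1 / d) * \<bar>a - b\<bar> ^ 2 + d * \<bar>b\<bar> ^ 2" by simp
      have "a\<^sup>2 - b\<^sup>2 = (a - b)\<^sup>2 + 2 * ((a - b) * b)" by (simp add: power2_eq_square algebra_simps)
      then have "\<bar>a\<^sup>2 - b\<^sup>2\<bar> \<le> \<bar>(a - b)\<^sup>2\<bar> + \<bar>2 * ((a - b) * b)\<bar>" by (metis abs_triangle_ineq)
      also have "\<dots> = \<bar>a - b\<bar> ^ 2 + 2 * (\<bar>a - b\<bar> * \<bar>b\<bar>)" by (simp add: abs_mult)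
      also have "\<dots> \<le> k * \<bar>a - b\<bar> ^ 2 + d * \<bar>b\<bar> ^ 2" using y by (simp add: k_def algebra_simps)
      finally show ?thesis by simp
    qed
    have "(\<integral>\<^sup>+\<omega>. ennreal (\<bar>(X n \<omega>)\<^sup>2 - (f \<omega>)\<^sup>2\<bar> ^ 1) \<partial>P) \<le> ennreal e" if n: "n \<ge> N" and P: "P \<in> dominated T E" for n P
    proof -
      have "(\<integral>\<^sup>+\<omega>. ennreal (\<bar>(X n \<omega>)\<^sup>2 - (f \<omega>)\<^sup>2\<bar> ^ 1) \<partial>P) \<le>
         ennreal k * (\<integral>\<^sup>+\<omega>. ennreal (\<bar>X n \<omega> - f \<omega>\<bar> ^ 2) \<partial>P) + ennreal d * (\<integral>\<^sup>+\<omega>. ennreal (\<bar>f \<omega>\<bar> ^ 2) \<partial>P)"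
        using Lip_measurable[OF T0 uniform_approxD(2)[OF X]] m k d
        by (intro nn_integral_le_combination q) (auto intro!: dominatedD(4)[OF P] borel_measurable_power borel_measurable_abs borel_measurable_diff)
      also have "\<dots> \<le> ennreal k * ennreal (e / (2 * k)) + ennreal d * ennreal B"
        by (intro add_mono mult_left_mono N n P fB) auto
      also have "\<dots> = ennreal e" using e k d B
        by (simp add: ennreal_mult[symmetric] ennreal_plus[symmetric] d_def del: ennreal_plus)
      finally show ?thesis .
    qed
    then show ?thesis by blast
  qed
  then show ?thesis unfolding uniform_approx_def using m Lip_power[OF T0 uniform_approxD(2)[OF X]] by auto
qed

lemma uniform_approx_add:
  assumes X: "uniform_approx 1 X f" and Y: "uniform_approx 1 Y g"
  shows "uniform_approx 1 (\<lambda>n \<omega>. X n \<omega> + Y n \<omega>) (\<lambda>\<omega>. f \<omega> + g \<omega>)"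
proof -
  have m: "f \<in> borel_measurable (path_borel T)" "g \<in> borel_measurable (path_borel T)" using uniform_approxD(1)[OF X] uniform_approxD(1)[OF Y] .
  have "\<exists>N. \<forall>n\<ge>N. \<forall>P\<in>dominated T E. (\<integral>\<^sup>+\<omega>. ennreal (\<bar>(X n \<omega> + Y n \<omega>) - (f \<omega> + g \<omega>)\<bar> ^ 1) \<partial>P) \<le> ennreal e" if e: "0 < e" for e
  proof -
    obtain N1 where N1: "\<And>n P. n \<ge> N1 \<Longrightarrow> P \<in> dominated T E \<Longrightarrow> (\<integral>\<^sup>+\<omega>. ennreal (\<bar>X n \<omega> - f \<omega>\<bar> ^ 1) \<partial>P) \<le> ennreal (e / 2)"
      using uniform_approxD(3)[OF X, of "e / 2"] e by auto
    obtain N2 where N2: "\<And>n P. n \<ge> N2 \<Longrightarrow> P \<in> dominated T E \<Longrightarrow> (\<integral>\<^sup>+\<omega>. ennreal (\<bar>Y n \<omega> - g \<omega>\<bar> ^ 1) \<partial>P) \<le> ennreal (e / 2)"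
      using uniform_approxD(3)[OF Y, of "e / 2"] e by auto
    have "(\<integral>\<^sup>+\<omega>. ennreal (\<bar>(X n \<omega> + Y n \<omega>) - (f \<omega> + g \<omega>)\<bar> ^ 1) \<partial>P) \<le> ennreal e"
      if n: "n \<ge> max N1 N2" and P: "P \<in> dominated T E" for n P
    proof -
      have "(\<integral>\<^sup>+\<omega>. ennreal (\<bar>(X n \<omega> + Y n \<omega>) - (f \<omega> + g \<omega>)\<bar> ^ 1) \<partial>P) \<le>
         ennreal 1 * (\<integral>\<^sup>+\<omega>. ennreal (\<bar>X n \<omega> - f \<omega>\<bar> ^ 1) \<partial>P) + ennreal 1 * (\<integral>\<^sup>+\<omega>. ennreal (\<bar>Y n \<omega> - g \<omega>\<bar> ^ 1) \<partial>P)"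
        using Lip_measurable[OF T0 uniform_approxD(2)[OF X]] Lip_measurable[OF T0 uniform_approxD(2)[OF Y]] m
        by (intro nn_integral_le_combination) (auto intro!: dominatedD(4)[OF P] borel_measurable_abs borel_measurable_diff)
      also have "\<dots> \<le> ennreal 1 * ennreal (e / 2) + ennreal 1 * ennreal (e / 2)"
        using n by (intro add_mono mult_left_mono N1 N2 P) auto
      also have "\<dots> = ennreal e" using e by (simp add: ennreal_plus[symmetric] del: ennreal_plus)
      finally show ?thesis .
    qed
    then show ?thesis by blast
  qed
  then show ?thesis unfolding uniform_approx_def using m Lip_add[OF T0 uniform_approxD(2)[OF X] uniform_approxD(2)[OF Y]] by auto
qed

end

section \<open>The compact set of functionals and the selection\<close>

context moment_bound begin

text \<open>
  The dominated functionals, normalised to vanish outside \<open>Lip T\<close> so that they are determined by their values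
  on \<open>Lip T\<close>. The topology is that of pointwise convergence.
\<close>

definition functionals :: "(((real \<Rightarrow> real) \<Rightarrow> real) \<Rightarrow> real) set" where
  "functionals = {l. dominated_functional l \<and> (\<forall>X. X \<notin> Lip T \<longrightarrow> l X = 0)}"

lemma compact_functionals: "compact functionals"
proof -
  define S where "S X = (if X \<in> Lip T then {- E (\<lambda>\<omega>. - X \<omega>)..E X} else {0})" for X
  have ev: "continuous_on UNIV (\<lambda>l. l X)" for X :: "(real \<Rightarrow> real) \<Rightarrow> real"
    by (rule continuous_on_product_coordinates)
  have "compact {l. \<forall>X. l X \<in> S X}" by (rule compact_Pi) (auto simp: S_def)
  moreover have "closed {l. (l (\<lambda>\<omega>. X \<omega> + Y \<omega>) :: real) = l X + l Y}" for X Y :: "(real \<Rightarrow> real) \<Rightarrow> real"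
    by (intro closed_Collect_eq continuous_on_add ev)
  moreover have "closed {l. (l (\<lambda>\<omega>. c * X \<omega>) :: real) = c * l X}" for X :: "(real \<Rightarrow> real) \<Rightarrow> real" and c
    by (intro closed_Collect_eq continuous_on_mult continuous_on_const ev)
  ultimately have c: "compact ({l. \<forall>X. l X \<in> S X} \<inter>
     ((\<Inter>X\<in>Lip T. \<Inter>Y\<in>Lip T. {l. l (\<lambda>\<omega>. X \<omega> + Y \<omega>) = l X + l Y}) \<inter>
      (\<Inter>X\<in>Lip T. \<Inter>c. {l. l (\<lambda>\<omega>. c * X \<omega>) = c * l X})))" (is "compact ?C")
    by (intro compact_Int_closed closed_Int closed_INT ballI) auto
  have "functionals = ?C"
  proof (intro set_eqI iffI)
    fix l assume l: "l \<in> functionals"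
    then have d: "dominated_functional l" by (simp add: functionals_def)
    have "l X \<in> S X" for X
    proof (cases "X \<in> Lip T")
      case True
      have "(\<lambda>\<omega>. - X \<omega>) \<in> Lip T" using Lip_scale[OF T0 True, of "-1"] by simp
      from l_le[OF d this] l_le[OF d True] l_scale[OF d True, of "-1"] True
      show ?thesis by (simp add: S_def)
    next
      case False
      then show ?thesis using l by (simp add: S_def functionals_def)
    qed
    moreover have "l \<in> (\<Inter>X\<in>Lip T. \<Inter>Y\<in>Lip T. {l. l (\<lambda>\<omega>. X \<omega> + Y \<omega>) = l X + l Y})"
      by (intro INT_I CollectI l_add[OF d])
    moreover have "l \<in> (\<Inter>X\<in>Lip T. \<Inter>c. {l. l (\<lambda>\<omega>. c * X \<omega>) = c * l X})"
      by (intro INT_I CollectI l_scale[OF d])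
    ultimately show "l \<in> ?C" by (intro IntI CollectI allI)
  next
    fix l assume "l \<in> ?C"
    then have S: "\<And>X. l X \<in> S X"
      and a: "\<And>X Y. X \<in> Lip T \<Longrightarrow> Y \<in> Lip T \<Longrightarrow> l (\<lambda>\<omega>. X \<omega> + Y \<omega>) = l X + l Y"
      and s: "\<And>X c. X \<in> Lip T \<Longrightarrow> l (\<lambda>\<omega>. c * X \<omega>) = c * l X" by auto
    have "l X \<le> E X" if "X \<in> Lip T" for X using S[of X] that by (simp add: S_def)
    moreover have "l X = 0" if "X \<notin> Lip T" for X using S[of X] that by (simp add: S_def)
    ultimately show "l \<in> functionals"
      unfolding functionals_def dominated_functional_def linear_functional_def
      by (intro CollectI conjI ballI allI impI a s) simp_all
  qed
  then show ?thesis using c by simp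
qed

text \<open>
  A choice of a probability representing a functional, and the functional of a probability.
\<close>

definition rep_measure :: "(((real \<Rightarrow> real) \<Rightarrow> real) \<Rightarrow> real) \<Rightarrow> (real \<Rightarrow> real) measure" where
  "rep_measure l = (SOME P. P \<in> dominated T E \<and> (\<forall>X\<in>Lip T. (\<integral>\<omega>. X \<omega> \<partial>P) = l X))"

definition integral_functional :: "(real \<Rightarrow> real) measure \<Rightarrow> ((real \<Rightarrow> real) \<Rightarrow> real) \<Rightarrow> real" where
  "integral_functional P X = (if X \<in> Lip T then \<integral>\<omega>. X \<omega> \<partial>P else 0)"

lemma rep_measure:
  assumes "l \<in> functionals"
  shows "rep_measure l \<in> dominated T E" "X \<in> Lip T \<Longrightarrow> (\<integral>\<omega>. X \<omega> \<partial>rep_measure l) = l X"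
proof -
  have "\<exists>P. P \<in> dominated T E \<and> (\<forall>X\<in>Lip T. (\<integral>\<omega>. X \<omega> \<partial>P) = l X)"
    using functional_representation[of l] assms by (auto simp: functionals_def)
  from someI_ex[OF this] show "rep_measure l \<in> dominated T E" "X \<in> Lip T \<Longrightarrow> (\<integral>\<omega>. X \<omega> \<partial>rep_measure l) = l X"
    unfolding rep_measure_def by auto
qed

lemma integral_functional_in: 
  assumes P: "P \<in> dominated T E"
  shows "integral_functional P \<in> functionals"
proof -
  have i: "dominated_functional (\<lambda>X. \<integral>\<omega>. X \<omega> \<partial>P)" by (rule dominated_functional_integral[OF P])
  have "dominated_functional (integral_functional P)" unfolding dominated_functional_def linear_functional_def
  proof (intro conjI ballI allI)
    fix X Y assume XY: "X \<in> Lip T" "Y \<in> Lip T"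
    show "integral_functional P (\<lambda>w. X w + Y w) = integral_functional P X + integral_functional P Y"
      using l_add[OF i XY] XY Lip_add[OF T0 XY] by (simp add: integral_functional_def)
  next
    fix X and c :: real assume X: "X \<in> Lip T"
    show "integral_functional P (\<lambda>w. c * X w) = c * integral_functional P X"
      using l_scale[OF i X, of c] X Lip_scale[OF T0 X, of c] by (simp add: integral_functional_def)
    show "integral_functional P X \<le> E X" using l_le[OF i X] X by (simp add: integral_functional_def)
  qed
  then show ?thesis by (simp add: functionals_def integral_functional_def)
qed

lemma integral_determined:
  assumes P: "P \<in> dominated T E" and Q: "Q \<in> dominated T E" and u: "uniform_approx 1 X f"
    and eq: "\<And>Y. Y \<in> Lip T \<Longrightarrow> (\<integral>\<omega>. Y \<omega> \<partial>P) = (\<integral>\<omega>. Y \<omega> \<partial>Q)"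
  shows "(\<integral>\<omega>. f \<omega> \<partial>P) = (\<integral>\<omega>. f \<omega> \<partial>Q)"
proof -
  have "\<bar>(\<integral>\<omega>. f \<omega> \<partial>P) - (\<integral>\<omega>. f \<omega> \<partial>Q)\<bar> \<le> 0 + e" if e: "0 < e" for e
  proof -
    have e2: "0 < e / 2" using e by simp
    obtain N where "\<And>n P. n \<ge> N \<Longrightarrow> P \<in> dominated T E \<Longrightarrow> \<bar>(\<integral>\<omega>. X n \<omega> \<partial>P) - (\<integral>\<omega>. f \<omega> \<partial>P)\<bar> \<le> e / 2"
      using uniform_approx_integral_uniform[OF u e2] by blast
    from this[OF order_refl P] this[OF order_refl Q] eq[OF uniform_approxD(2)[OF u, of N]] show ?thesis by linarith
  qed
  then have "\<bar>(\<integral>\<omega>. f \<omega> \<partial>P) - (\<integral>\<omega>. f \<omega> \<partial>Q)\<bar> \<le> 0" by (rule field_le_epsilon)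
  then show ?thesis by simp
qed

lemma rep_measure_integral_functional:
  assumes P: "P \<in> dominated T E" and u: "uniform_approx 1 X f"
  shows "(\<integral>\<omega>. f \<omega> \<partial>rep_measure (integral_functional P)) = (\<integral>\<omega>. f \<omega> \<partial>P)"
  using rep_measure[OF integral_functional_in[OF P]] P
  by (intro integral_determined[OF _ P u]) (auto simp: integral_functional_def)

lemma continuous_integral:
  assumes u: "uniform_approx 1 X f"
  shows "continuous_on functionals (\<lambda>l. \<integral>\<omega>. f \<omega> \<partial>rep_measure l)"
proof (rule uniform_limit_theorem)
  show "uniform_limit functionals (\<lambda>n l. l (X n)) (\<lambda>l. \<integral>\<omega>. f \<omega> \<partial>rep_measure l) sequentially"
  proof (rule uniform_limitI)
    fix e :: real assume e: "0 < e"
    then have e2: "0 < e / 2" by simp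
    obtain N where N: "\<And>n P. n \<ge> N \<Longrightarrow> P \<in> dominated T E \<Longrightarrow> \<bar>(\<integral>\<omega>. X n \<omega> \<partial>P) - (\<integral>\<omega>. f \<omega> \<partial>P)\<bar> \<le> e / 2"
      using uniform_approx_integral_uniform[OF u e2] by blast
    have "dist (l (X n)) (\<integral>\<omega>. f \<omega> \<partial>rep_measure l) < e" if "n \<ge> N" "l \<in> functionals" for n l
      using N[OF that(1) rep_measure(1)[OF that(2)]] rep_measure(2)[OF that(2) uniform_approxD(2)[OF u], of n] e by (simp add: dist_real_def)
    then show "\<forall>\<^sub>F n in sequentially. \<forall>l\<in>functionals. dist (l (X n)) (\<integral>\<omega>. f \<omega> \<partial>rep_measure l) < e"
      unfolding eventually_sequentially by blast
  qed
  show "\<forall>\<^sub>F n in sequentially. continuous_on functionals (\<lambda>l. l (X n))"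
    by (intro always_eventually allI continuous_on_subset[OF continuous_on_product_coordinates] subset_UNIV)
qed simp

lemma joint_continuity:
  fixes u :: "real \<Rightarrow> 'b::topological_space \<Rightarrow> real"
  assumes c: "\<And>t. t \<in> I \<Longrightarrow> continuous_on S (u t)"
    and h: "\<And>s t x. s \<in> I \<Longrightarrow> t \<in> I \<Longrightarrow> x \<in> S \<Longrightarrow> \<bar>u t x - u s x\<bar> \<le> sqrt (C * \<bar>t - s\<bar>)"
  shows "continuous_on (I \<times> S) (\<lambda>(t, x). u t x)"
  unfolding continuous_on_def
proof
  fix p assume p: "p \<in> I \<times> S"
  then obtain t0 x0 where tx: "p = (t0, x0)" "t0 \<in> I" "x0 \<in> S" by blast
  define b where "b q = sqrt (C * \<bar>fst q - t0\<bar>) + \<bar>u t0 (snd q) - u t0 x0\<bar>" for q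
  have u0: "continuous_on (I \<times> S) (\<lambda>q. u t0 (snd q))"
  proof -
    have "continuous_on (I \<times> S) (u t0 \<circ> snd)"
      by (intro continuous_on_compose continuous_on_snd continuous_on_id continuous_on_subset[OF c[OF tx(2)]]) auto
    then show ?thesis by (simp add: o_def)
  qed
  have "continuous_on (I \<times> S) b" unfolding b_def by (intro continuous_intros u0)
  then have "(b \<longlongrightarrow> b p) (at p within I \<times> S)" using p unfolding continuous_on_def by blast
  then have b0: "(b \<longlongrightarrow> 0) (at p within I \<times> S)" by (simp add: b_def tx)
  have "((\<lambda>q. (case q of (t, x) \<Rightarrow> u t x) - u t0 x0) \<longlongrightarrow> 0) (at p within I \<times> S)"
  proof (rule Lim_null_comparison[OF _ b0])
    have "norm ((case q of (t, x) \<Rightarrow> u t x) - u t0 x0) \<le> b q" if q: "q \<in> I \<times> S" for q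
    proof -
      obtain t x where q': "q = (t, x)" "t \<in> I" "x \<in> S" using q by blast
      show ?thesis using h[OF tx(2) q'(2,3)] unfolding b_def q'(1) by simp
    qed
    then show "\<forall>\<^sub>F q in at p within I \<times> S. norm ((case q of (t, x) \<Rightarrow> u t x) - u t0 x0) \<le> b q"
      by (auto simp: eventually_at_filter)
  qed
  then show "((\<lambda>(t, x). u t x) \<longlongrightarrow> (case p of (t, x) \<Rightarrow> u t x)) (at p within I \<times> S)"
    by (simp add: tx LIM_zero_iff split_beta')
qed

text \<open>
  The Cauchy-Schwarz inequality applied to each of the two summands.
\<close>

lemma integral_holder:
  assumes X: "uniform_approx 2 X f" and Y: "uniform_approx 2 Y g" and X': "uniform_approx 2 X' f'" and Y': "uniform_approx 2 Y' g'"
    and le: "Ehat T E (\<lambda>\<omega>. \<bar>f \<omega> - f' \<omega>\<bar>\<^sup>2 + \<bar>g \<omega> - g' \<omega>\<bar>\<^sup>2) \<le> c" and P: "P \<in> dominated T E"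
  shows "\<bar>(\<integral>\<omega>. f \<omega> \<partial>P) - (\<integral>\<omega>. f' \<omega> \<partial>P)\<bar> \<le> sqrt c" "\<bar>(\<integral>\<omega>. g \<omega> \<partial>P) - (\<integral>\<omega>. g' \<omega> \<partial>P)\<bar> \<le> sqrt c"
proof -
  interpret prob_space P by (rule dominatedD[OF P])
  note i = uniform_approx_integrable[OF uniform_approx_2_imp_1 P]
  note sq = uniform_approx_square[OF uniform_approx_diff[OF X X']] uniform_approx_square[OF uniform_approx_diff[OF Y Y']]
  have isq: "integrable P (\<lambda>\<omega>. (f \<omega> - f' \<omega>)\<^sup>2)" "integrable P (\<lambda>\<omega>. (g \<omega> - g' \<omega>)\<^sup>2)"
    using uniform_approx_integrable[OF sq(1) P] uniform_approx_integrable[OF sq(2) P] .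
  have s: "(\<integral>\<omega>. (f \<omega> - f' \<omega>)\<^sup>2 + (g \<omega> - g' \<omega>)\<^sup>2 \<partial>P) \<le> c"
    using integral_le_Ehat[OF uniform_approx_add[OF sq] P] le by simp
  have nn: "0 \<le> (\<integral>\<omega>. (f \<omega> - f' \<omega>)\<^sup>2 \<partial>P)" "0 \<le> (\<integral>\<omega>. (g \<omega> - g' \<omega>)\<^sup>2 \<partial>P)" by (auto intro: integral_nonneg_AE)
  have jensen: "\<bar>\<integral>\<omega>. h \<omega> \<partial>P\<bar> \<le> sqrt c" if h: "integrable P h" "integrable P (\<lambda>\<omega>. (h \<omega>)\<^sup>2)" "(\<integral>\<omega>. (h \<omega>)\<^sup>2 \<partial>P) \<le> c" for h
  proof (rule real_le_rsqrt)
    have "0 \<le> variance h" by simp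
    also have "variance h = (\<integral>\<omega>. (h \<omega>)\<^sup>2 \<partial>P) - (\<integral>\<omega>. h \<omega> \<partial>P)\<^sup>2" by (rule variance_eq[OF h(1,2)])
    finally show "\<bar>\<integral>\<omega>. h \<omega> \<partial>P\<bar>\<^sup>2 \<le> c" using h(3) by simp
  qed
  have "(\<integral>\<omega>. (f \<omega> - f' \<omega>)\<^sup>2 \<partial>P) \<le> c" "(\<integral>\<omega>. (g \<omega> - g' \<omega>)\<^sup>2 \<partial>P) \<le> c"
  proof -
    have "(\<integral>\<omega>. (f \<omega> - f' \<omega>)\<^sup>2 \<partial>P) + (\<integral>\<omega>. (g \<omega> - g' \<omega>)\<^sup>2 \<partial>P) \<le> c" using s isq by simp
    then show "(\<integral>\<omega>. (f \<omega> - f' \<omega>)\<^sup>2 \<partial>P) \<le> c" "(\<integral>\<omega>. (g \<omega> - g' \<omega>)\<^sup>2 \<partial>P) \<le> c"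
      using nn by linarith+
  qed
  then show "\<bar>(\<integral>\<omega>. f \<omega> \<partial>P) - (\<integral>\<omega>. f' \<omega> \<partial>P)\<bar> \<le> sqrt c" "\<bar>(\<integral>\<omega>. g \<omega> \<partial>P) - (\<integral>\<omega>. g' \<omega> \<partial>P)\<bar> \<le> sqrt c"
    using jensen[of "\<lambda>\<omega>. f \<omega> - f' \<omega>"] jensen[of "\<lambda>\<omega>. g \<omega> - g' \<omega>"] isq i[OF X] i[OF X'] i[OF Y] i[OF Y'] by simp_all
qed

text \<open>
  Sets that are open for the bounded Lipschitz distance are traces of open sets of functionals; the
  constant \<open>50\<close> absorbs the factor \<open>25\<close> of \<open>finite_test_family\<close>.
\<close>

lemma BL_open_imp_weakly_open:
  assumes U: "U \<subseteq> dominated T E" "\<And>P. P \<in> U \<Longrightarrow> \<exists>r>0. \<forall>Q\<in>dominated T E. BL_dist T P Q < r \<longrightarrow> Q \<in> U"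
  shows "\<exists>W. open W \<and> (\<forall>Q\<in>dominated T E. integral_functional Q \<in> W \<longleftrightarrow> Q \<in> U)"
proof -
  have "\<exists>V. open V \<and> integral_functional P \<in> V \<and> (\<forall>Q\<in>dominated T E. integral_functional Q \<in> V \<longrightarrow> Q \<in> U)" if P: "P \<in> U" for P
  proof -
    have Pd: "P \<in> dominated T E" using P U by blast
    obtain r where r: "0 < r" "\<And>Q. Q \<in> dominated T E \<Longrightarrow> BL_dist T P Q < r \<Longrightarrow> Q \<in> U" using U(2)[OF P] by blast
    have e: "0 < r / 50" using r by simp
    obtain \<Psi> where \<Psi>: "finite \<Psi>" "\<Psi> \<subseteq> Lip T"
      "\<forall>P\<in>dominated T E. \<forall>Q\<in>dominated T E.
        (\<forall>X\<in>\<Psi>. \<bar>(\<integral>\<omega>. X \<omega> \<partial>P) - (\<integral>\<omega>. X \<omega> \<partial>Q)\<bar> \<le> r / 50) \<longrightarrow>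
        (\<forall>f. BL_unit T f \<longrightarrow> \<bar>(\<integral>\<omega>. f \<omega> \<partial>P) - (\<integral>\<omega>. f \<omega> \<partial>Q)\<bar> \<le> 25 * (r / 50))"
      using finite_test_family[OF e] by blast
    define V where "V = (\<Inter>X\<in>\<Psi>. {l. \<bar>integral_functional P X - l X\<bar> < r / 50})"
    have "open V" unfolding V_def
    proof (intro open_INT \<Psi>(1) ballI)
      fix X :: "(real \<Rightarrow> real) \<Rightarrow> real"
      have "continuous_on UNIV (\<lambda>l. l X)" by (rule continuous_on_product_coordinates)
      then show "open {l. \<bar>integral_functional P X - l X\<bar> < r / 50}" by (intro open_Collect_less continuous_intros)
    qed
    moreover have "integral_functional P \<in> V" using r by (simp add: V_def)
    moreover have "Q \<in> U" if Q: "Q \<in> dominated T E" "integral_functional Q \<in> V" for Q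
    proof (rule r(2)[OF Q(1)])
      have "\<bar>(\<integral>\<omega>. X \<omega> \<partial>P) - (\<integral>\<omega>. X \<omega> \<partial>Q)\<bar> \<le> r / 50" if X: "X \<in> \<Psi>" for X
      proof -
        have "X \<in> Lip T" using X \<Psi>(2) by blast
        moreover have "\<bar>integral_functional P X - integral_functional Q X\<bar> < r / 50" using Q(2) X unfolding V_def by blast
        ultimately show ?thesis by (simp add: integral_functional_def)
      qed
      then have "BL_dist T P Q \<le> 25 * (r / 50)" using \<Psi>(3) Pd Q(1) by (intro BL_dist_le) blast
      then show "BL_dist T P Q < r" using r by simp
    qed
    ultimately show ?thesis by blast
  qed
  then obtain V where V: "\<And>P. P \<in> U \<Longrightarrow> open (V P)" "\<And>P. P \<in> U \<Longrightarrow> integral_functional P \<in> V P"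
    "\<And>P Q. P \<in> U \<Longrightarrow> Q \<in> dominated T E \<Longrightarrow> integral_functional Q \<in> V P \<Longrightarrow> Q \<in> U" by metis
  show ?thesis
  proof (intro exI[of _ "\<Union>P\<in>U. V P"] conjI ballI)
    show "open (\<Union>P\<in>U. V P)" using V(1) by blast
    show "integral_functional Q \<in> (\<Union>P\<in>U. V P) \<longleftrightarrow> Q \<in> U" if "Q \<in> dominated T E" for Q using V(2,3) that by blast
  qed
qed

text \<open>
  Integrals do not depend on the choice of the representing probability, so maximising over functionals is
  the same as maximising over \<open>Probs T E\<close>.
\<close>

theorem measurable_argmax_selection:
  assumes \<xi>: "\<And>t. t \<in> {0..T} \<Longrightarrow> \<xi> t \<in> LG T E 2 T" and \<eta>: "\<And>t. t \<in> {0..T} \<Longrightarrow> \<eta> t \<in> LG T E 2 T"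
    and C: "\<And>t s. t \<in> {0..T} \<Longrightarrow> s \<in> {0..T} \<Longrightarrow>
           Ehat T E (\<lambda>\<omega>. \<bar>\<xi> t \<omega> - \<xi> s \<omega>\<bar>\<^sup>2 + \<bar>\<eta> t \<omega> - \<eta> s \<omega>\<bar>\<^sup>2) \<le> C * \<bar>t - s\<bar>"
  shows "\<exists>R. (\<forall>t\<in>{0..T}. R t \<in> Probs_at2 T E (\<xi> t) (\<eta> t)) \<and>
             R \<in> restrict_space borel {0..T} \<rightarrow>\<^sub>M Probs_borel T E"
proof -
  let ?I = "{0..T}"
  have "\<exists>X. uniform_approx 2 X (\<xi> t)" "\<exists>Y. uniform_approx 2 Y (\<eta> t)" if "t \<in> ?I" for t
    using LG_unif[OF _ \<xi>[OF that]] LG_unif[OF _ \<eta>[OF that]] by auto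
  then obtain X Y where X: "\<And>t. t \<in> ?I \<Longrightarrow> uniform_approx 2 (X t) (\<xi> t)" and Y: "\<And>t. t \<in> ?I \<Longrightarrow> uniform_approx 2 (Y t) (\<eta> t)" by metis
  note X1 = uniform_approx_2_imp_1[OF X] and Y1 = uniform_approx_2_imp_1[OF Y]
  define u where "u t l = (\<integral>\<omega>. \<xi> t \<omega> \<partial>rep_measure l)" for t l
  define v where "v t l = (\<integral>\<omega>. \<eta> t \<omega> \<partial>rep_measure l)" for t l
  have hu: "\<bar>u t l - u s l\<bar> \<le> sqrt (C * \<bar>t - s\<bar>)" if "s \<in> ?I" "t \<in> ?I" "l \<in> functionals" for s t l
    unfolding u_def using integral_holder(1)[OF X[OF that(2)] Y[OF that(2)] X[OF that(1)] Y[OF that(1)] C[OF that(2,1)] rep_measure(1)[OF that(3)]] .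
  have hv: "\<bar>v t l - v s l\<bar> \<le> sqrt (C * \<bar>t - s\<bar>)" if "s \<in> ?I" "t \<in> ?I" "l \<in> functionals" for s t l
    unfolding v_def using integral_holder(2)[OF X[OF that(2)] Y[OF that(2)] X[OF that(1)] Y[OF that(1)] C[OF that(2,1)] rep_measure(1)[OF that(3)]] .
  have cu: "continuous_on (?I \<times> functionals) (\<lambda>(t, l). u t l)"
    by (rule joint_continuity[OF _ hu]) (auto simp: u_def[abs_def] intro: continuous_integral[OF X1])
  have cv: "continuous_on (?I \<times> functionals) (\<lambda>(t, l). v t l)"
    by (rule joint_continuity[OF _ hv]) (auto simp: v_def[abs_def] intro: continuous_integral[OF Y1])
  obtain \<psi> :: "nat \<Rightarrow> (real \<Rightarrow> real) \<Rightarrow> real" where \<psi>: "\<And>k. \<psi> k \<in> Lip T"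
    "\<forall>P\<in>dominated T E. \<forall>Q\<in>dominated T E. (\<forall>k. (\<integral>\<omega>. \<psi> k \<omega> \<partial>P) = (\<integral>\<omega>. \<psi> k \<omega> \<partial>Q)) \<longrightarrow>
      (\<forall>X\<in>Lip T. (\<integral>\<omega>. X \<omega> \<partial>P) = (\<integral>\<omega>. X \<omega> \<partial>Q))" using countable_separating_family by blast
  have ne: "functionals \<noteq> {}" using dominated_nonempty integral_functional_in by blast
  have "\<exists>r. (\<forall>t\<in>?I. r t \<in> argmax_on (v t) (argmax_on (u t) functionals)) \<and>
    (\<forall>F. closed F \<longrightarrow> {t\<in>?I. r t \<in> F} \<in> sets borel)"
  proof (rule measurable_lexicographic_selection[OF compact_functionals ne compact_Icc cu cv, where \<psi>="\<lambda>k l. l (\<psi> k)"])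
    show "continuous_on functionals (\<lambda>l. l (\<psi> k))" for k
      by (rule continuous_on_subset[OF continuous_on_product_coordinates]) simp
    fix l l' assume l: "l \<in> functionals" "l' \<in> functionals" and eq: "\<And>k. l (\<psi> k) = l' (\<psi> k)"
    show "l = l'"
    proof
      fix Z
      show "l Z = l' Z"
      proof (cases "Z \<in> Lip T")
        case True
        have "(\<integral>\<omega>. \<psi> k \<omega> \<partial>rep_measure l) = (\<integral>\<omega>. \<psi> k \<omega> \<partial>rep_measure l')" for k
          using rep_measure(2)[OF l(1) \<psi>(1)] rep_measure(2)[OF l(2) \<psi>(1)] eq by simp
        then have "(\<integral>\<omega>. Z \<omega> \<partial>rep_measure l) = (\<integral>\<omega>. Z \<omega> \<partial>rep_measure l')"
          using \<psi>(2) rep_measure(1)[OF l(1)] rep_measure(1)[OF l(2)] True by blast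
        then show ?thesis using rep_measure(2)[OF l(1) True] rep_measure(2)[OF l(2) True] by simp
      next
        case False
        then show ?thesis using l by (simp add: functionals_def)
      qed
    qed
  qed
  then obtain r where r0: "(\<forall>t\<in>?I. r t \<in> argmax_on (v t) (argmax_on (u t) functionals)) \<and>
    (\<forall>F. closed F \<longrightarrow> {t\<in>?I. r t \<in> F} \<in> sets borel)" ..
  have r: "r t \<in> argmax_on (v t) (argmax_on (u t) functionals)" if "t \<in> ?I" for t
    using conjunct1[OF r0] that by (rule bspec)
  have rm: "{t\<in>?I. r t \<in> F} \<in> sets borel" if "closed F" for F
    using conjunct2[OF r0] that by (elim allE impE)
  have r1: "r t \<in> argmax_on (u t) functionals" if "t \<in> ?I" for t by (rule subsetD[OF argmax_on_subset r[OF that]])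
  have rf: "r t \<in> functionals" if "t \<in> ?I" for t by (rule subsetD[OF argmax_on_subset r1[OF that]])
  define R where "R t = rep_measure (r t)" for t
  have Rd: "R t \<in> dominated T E" if "t \<in> ?I" for t unfolding R_def by (rule rep_measure(1)[OF rf[OF that]])
  have integral_functional_R: "integral_functional (R t) = r t" if "t \<in> ?I" for t
  proof
    fix Z show "integral_functional (R t) Z = r t Z"
      using rep_measure(2)[OF rf[OF that], of Z] rf[OF that] by (simp add: integral_functional_def R_def functionals_def)
  qed
  have "R t \<in> Probs_at2 T E (\<xi> t) (\<eta> t)" if t: "t \<in> ?I" for t
  proof -
    have uf: "u t (integral_functional P) = (\<integral>\<omega>. \<xi> t \<omega> \<partial>P)" and vf: "v t (integral_functional P) = (\<integral>\<omega>. \<eta> t \<omega> \<partial>P)" if "P \<in> dominated T E" for P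
      unfolding u_def v_def using rep_measure_integral_functional[OF that X1[OF t]] rep_measure_integral_functional[OF that Y1[OF t]] .
    have max: "(\<integral>\<omega>. \<xi> t \<omega> \<partial>P) \<le> (\<integral>\<omega>. \<xi> t \<omega> \<partial>R t)" if P: "P \<in> dominated T E" for P
      using r1[OF t] integral_functional_in[OF P] uf[OF P] unfolding argmax_on_def by (auto simp: R_def u_def)
    have Eh: "Ehat T E (\<xi> t) = (\<integral>\<omega>. \<xi> t \<omega> \<partial>R t)"
      unfolding Ehat_eq[OF X1[OF t]] using Rd[OF t] max by (intro cSup_eq_maximum) auto
    have RP: "R t \<in> Probs_at T E (\<xi> t)" using Rd[OF t] Eh by (simp add: Probs_at_def Probs_eq)
    have max2: "(\<integral>\<omega>. \<eta> t \<omega> \<partial>P) \<le> (\<integral>\<omega>. \<eta> t \<omega> \<partial>R t)" if P: "P \<in> Probs_at T E (\<xi> t)" for P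
    proof -
      have Pd: "P \<in> dominated T E" and Pe: "(\<integral>\<omega>. \<xi> t \<omega> \<partial>P) = Ehat T E (\<xi> t)" using P by (auto simp: Probs_at_def Probs_eq)
      have "u t l \<le> u t (integral_functional P)" if "l \<in> functionals" for l
        using integral_le_Ehat[OF X1[OF t] rep_measure(1)[OF that]] uf[OF Pd] Pe by (simp add: u_def)
      then have "integral_functional P \<in> argmax_on (u t) functionals" using integral_functional_in[OF Pd] by (simp add: argmax_on_def)
      then have "v t (integral_functional P) \<le> v t (r t)" using r[OF t] by (simp add: argmax_on_def)
      then show ?thesis using vf[OF Pd] by (simp add: v_def R_def)
    qed
    have "Ehat_at T E (\<xi> t) (\<eta> t) = (\<integral>\<omega>. \<eta> t \<omega> \<partial>R t)"
      unfolding Ehat_at_def using RP max2 by (intro cSup_eq_maximum) auto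
    then show ?thesis using RP by (simp add: Probs_at2_def)
  qed
  moreover have "R \<in> restrict_space borel ?I \<rightarrow>\<^sub>M Probs_borel T E"
    unfolding Probs_borel_def metric_borel_def Probs_eq
  proof (rule measurable_measure_of)
    show "R \<in> space (restrict_space borel ?I) \<rightarrow> dominated T E" using Rd by (auto simp: space_restrict_space)
    fix U assume "U \<in> {U. U \<subseteq> dominated T E \<and> (\<forall>x\<in>U. \<exists>r>0. \<forall>y\<in>dominated T E. BL_dist T x y < r \<longrightarrow> y \<in> U)}"
    then have U: "U \<subseteq> dominated T E" "\<And>P. P \<in> U \<Longrightarrow> \<exists>r>0. \<forall>Q\<in>dominated T E. BL_dist T P Q < r \<longrightarrow> Q \<in> U" by auto
    obtain W where W: "open W" "\<forall>Q\<in>dominated T E. integral_functional Q \<in> W \<longleftrightarrow> Q \<in> U"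
      using BL_open_imp_weakly_open[OF U] by blast
    have "R t \<in> U \<longleftrightarrow> r t \<notin> - W" if "t \<in> ?I" for t using bspec[OF W(2) Rd[OF that]] integral_functional_R[OF that] by simp
    then have "R -` U \<inter> space (restrict_space borel ?I) = ?I - {t\<in>?I. r t \<in> - W}"
      by (auto simp: space_restrict_space)
    moreover have "?I - {t\<in>?I. r t \<in> - W} \<in> sets borel" by (intro sets.Diff rm closed_Compl W(1)) simp
    ultimately show "R -` U \<inter> space (restrict_space borel ?I) \<in> sets (restrict_space borel ?I)"
      by (subst sets_restrict_space_iff) auto
  qed auto
  ultimately show ?thesis by blast
qed

end

section \<open>The moment bound for the \<open>G\<close>-expectation\<close>

lemma power4_diff_le:
  fixes a b m :: real
  assumes m: "\<bar>a\<bar> \<le> m" "\<bar>b\<bar> \<le> m"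
  shows "\<bar>a ^ 4 - b ^ 4\<bar> \<le> 4 * m ^ 3 * \<bar>a - b\<bar>"
proof -
  have m0: "0 \<le> m" using m by linarith
  have "a ^ 4 - b ^ 4 = (a - b) * ((a + b) * (a\<^sup>2 + b\<^sup>2))"
    by (simp add: power2_eq_square power4_eq_xxxx algebra_simps)
  moreover have "\<bar>(a + b) * (a\<^sup>2 + b\<^sup>2)\<bar> \<le> (2 * m) * (2 * m\<^sup>2)"
  proof -
    have "\<bar>a + b\<bar> \<le> 2 * m" using m by linarith
    moreover have "a\<^sup>2 \<le> m\<^sup>2" "b\<^sup>2 \<le> m\<^sup>2" using m m0 by (auto simp: abs_le_square_iff[symmetric])
    then have "\<bar>a\<^sup>2 + b\<^sup>2\<bar> \<le> 2 * m\<^sup>2" by simp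
    ultimately show ?thesis unfolding abs_mult using m0 by (intro mult_mono) auto
  qed
  ultimately have "\<bar>a ^ 4 - b ^ 4\<bar> \<le> \<bar>a - b\<bar> * ((2 * m) * (2 * m\<^sup>2))"
    by (simp only: abs_mult) (intro mult_left_mono, auto)
  then show ?thesis by (simp add: power2_eq_square power3_eq_cube algebra_simps)
qed

lemma loc_lipschitz_power4: "loc_lipschitz 1 (\<lambda>x. x 0 ^ 4)"
  unfolding loc_lipschitz_def
proof (intro exI allI)
  fix x y :: "nat \<Rightarrow> real"
  define m where "m = max \<bar>x 0\<bar> \<bar>y 0\<bar>"
  have "\<bar>x 0 ^ 4 - y 0 ^ 4\<bar> \<le> 4 * m ^ 3 * \<bar>x 0 - y 0\<bar>" by (rule power4_diff_le) (auto simp: m_def)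
  also have "\<dots> \<le> 4 * (1 + \<bar>x 0\<bar> ^ 3 + \<bar>y 0\<bar> ^ 3) * \<bar>x 0 - y 0\<bar>"
    by (intro mult_right_mono mult_left_mono) (auto simp: m_def max_def)
  finally show "\<bar>x 0 ^ 4 - y 0 ^ 4\<bar> \<le> 4 * (1 + L2_set x {..<1} ^ 3 + L2_set y {..<1} ^ 3) * L2_set (\<lambda>i. x i - y i) {..<1}"
    by (simp add: L2_set_def lessThan_Suc)
qed

lemma clip_power4_lipschitz:
  assumes c: "0 \<le> c"
  shows "\<bar>clip c x ^ 4 - clip c y ^ 4\<bar> \<le> 4 * c ^ 3 * \<bar>x - y\<bar>"
proof -
  have "\<bar>clip c x ^ 4 - clip c y ^ 4\<bar> \<le> 4 * c ^ 3 * \<bar>clip c x - clip c y\<bar>"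
    by (rule power4_diff_le) (rule clip_bound[OF c])+
  also have "\<dots> \<le> 4 * c ^ 3 * \<bar>x - y\<bar>" using clip_lipschitz[of c x y] c by (intro mult_left_mono) auto
  finally show ?thesis .
qed

lemma coord_le_L2_set: "i < n \<Longrightarrow> \<bar>x i\<bar> \<le> L2_set x {..<n}" for i n :: nat
  using member_le_L2_set[OF finite_lessThan, of i n "\<lambda>i. \<bar>x i\<bar>"] by (simp add: L2_set_def)

lemma clip_power4_bdd_lipschitz:
  assumes c: "0 \<le> c" and i: "i < n"
  shows "bdd_lipschitz n (\<lambda>x. clip c (x i) ^ 4)"
  unfolding bdd_lipschitz_def
proof (intro conjI exI allI)
  show "\<bar>clip c (x i) ^ 4\<bar> \<le> c ^ 4" for x
    using power_mono[OF clip_bound[OF c, of "x i"] abs_ge_zero, of 4] by (simp add: power_abs)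
  fix x y :: "nat \<Rightarrow> real"
  have "\<bar>clip c (x i) ^ 4 - clip c (y i) ^ 4\<bar> \<le> 4 * c ^ 3 * \<bar>x i - y i\<bar>" by (rule clip_power4_lipschitz[OF c])
  also have "\<dots> \<le> 4 * c ^ 3 * L2_set (\<lambda>i. x i - y i) {..<n}"
    using coord_le_L2_set[OF i, of "\<lambda>i. x i - y i"] c by (intro mult_left_mono) auto
  finally show "\<bar>clip c (x i) ^ 4 - clip c (y i) ^ 4\<bar> \<le> 4 * c ^ 3 * L2_set (\<lambda>i. x i - y i) {..<n}" .
qed

lemma bdd_lipschitz_imp_loc_lipschitz:
  assumes "bdd_lipschitz n \<phi>"
  shows "loc_lipschitz n \<phi>"
proof -
  obtain L where L: "\<And>x y. \<bar>\<phi> x - \<phi> y\<bar> \<le> L * L2_set (\<lambda>i. x i - y i) {..<n}" using assms unfolding bdd_lipschitz_def by blast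
  show ?thesis unfolding loc_lipschitz_def
  proof (intro exI allI)
    fix x y :: "nat \<Rightarrow> real"
    have "L * L2_set (\<lambda>i. x i - y i) {..<n} \<le> \<bar>L\<bar> * 1 * L2_set (\<lambda>i. x i - y i) {..<n}" by (intro mult_right_mono) auto
    also have "\<dots> \<le> \<bar>L\<bar> * (1 + L2_set x {..<n} ^ 0 + L2_set y {..<n} ^ 0) * L2_set (\<lambda>i. x i - y i) {..<n}"
      by (intro mult_right_mono mult_left_mono) auto
    finally show "\<bar>\<phi> x - \<phi> y\<bar> \<le> \<bar>L\<bar> * (1 + L2_set x {..<n} ^ 0 + L2_set y {..<n} ^ 0) * L2_set (\<lambda>i. x i - y i) {..<n}"
      using L[of x y] by linarith
  qed
qed

text \<open>
  The fourth moment of \<open>\<zeta> 1\<close> is a real number since the fourth power is locally Lipschitz with polynomial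
  growth; the increment over \<open>[s, t]\<close> is the second coordinate along the grid \<open>s < t\<close>, hence distributed
  as \<open>sqrt (t - s) * \<zeta> 1\<close>.
\<close>

lemma G_expectation_moment_bound:
  assumes T: "0 < T" and G: "is_G_expectation T \<sigma>l \<sigma>u H E' \<zeta> E"
  shows "moment_bound T (E' (\<lambda>w. \<zeta> 1 w ^ 4)) E"
proof -
  have sp: "sublinear_space H E'" and z: "\<And>i. \<zeta> i \<in> H" and sE: "sublinear_on (Lip T) E"
    and EE: "\<And>n t \<phi>. time_grid T n t \<Longrightarrow> bdd_lipschitz n \<phi> \<Longrightarrow>
        E (\<lambda>\<omega>. \<phi> (increments t \<omega>)) = E' (\<lambda>w. \<phi> (\<lambda>i. sqrt (increments t (\<lambda>s. s) i) * \<zeta> i w))"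
    using G unfolding is_G_expectation_def G_normal_def by blast+
  have H: "(\<lambda>w. \<phi> (\<lambda>i. Z i w)) \<in> H" if "loc_lipschitz n \<phi>" "\<And>i. i < n \<Longrightarrow> Z i \<in> H" for n \<phi> Z
    using sp that unfolding sublinear_space_def by blast
  have "sublinear_on H E'" using sp by (simp add: sublinear_space_def)
  then have mono: "\<forall>X\<in>H. \<forall>Y\<in>H. (\<forall>w. X w \<le> Y w) \<longrightarrow> E' X \<le> E' Y" and const: "\<forall>c. E' (\<lambda>_. c) = c"
    and scale: "\<forall>X\<in>H. \<forall>c\<ge>0. E' (\<lambda>w. c * X w) = c * E' X"
    unfolding sublinear_on_def by - (elim conjE, assumption)+
  have z4: "(\<lambda>w. \<zeta> 1 w ^ 4) \<in> H" using H[OF loc_lipschitz_power4, of "\<lambda>_. \<zeta> 1"] z by simp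
  have c0: "(\<lambda>w. c) \<in> H" for c
  proof -
    \<comment> \<open>constants are functions of no variables\<close>
    have "loc_lipschitz 0 (\<lambda>_. c)" unfolding loc_lipschitz_def by (intro exI[of _ 0]) simp
    from H[OF this, of "\<lambda>_. \<zeta> 1"] show ?thesis by simp
  qed
  show ?thesis
  proof
    show "0 < T" "sublinear_on (Lip T) E" by fact+
    have "E' (\<lambda>_. 0) \<le> E' (\<lambda>w. \<zeta> 1 w ^ 4)" by (rule mono[rule_format, OF c0 z4]) simp
    then show "0 \<le> E' (\<lambda>w. \<zeta> 1 w ^ 4)" using const by simp
    have g: "time_grid T 1 (\<lambda>_. 0)" using T by (auto simp: time_grid_def strict_mono_on_def lessThan_Suc)
    have "E (\<lambda>\<omega>. clip 1 (increments (\<lambda>_. 0) \<omega> 0) ^ 4) = E' (\<lambda>w. clip 1 (sqrt (increments (\<lambda>_. 0) (\<lambda>s. s) 0) * \<zeta> 0 w) ^ 4)"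
      by (rule EE[OF g clip_power4_bdd_lipschitz]) auto
    then show "E (\<lambda>\<omega>. clip 1 (\<omega> 0) ^ 4) \<le> 0" using const by (simp add: clip_0)
    fix c s t assume c: "(0::real) \<le> c" and st: "0 \<le> s" "s < t" "t \<le> T"
    define g where "g i = (if i = 0 then s else t)" for i :: nat
    have grid: "time_grid T 2 g" using st by (auto simp: time_grid_def strict_mono_on_def g_def)
    have bl: "bdd_lipschitz 2 (\<lambda>x. clip c (x 1) ^ 4)" by (rule clip_power4_bdd_lipschitz[OF c]) simp
    have inc: "increments g \<omega> 1 = \<omega> t - \<omega> s" for \<omega> by (simp add: g_def)
    have "E (\<lambda>\<omega>. clip c (\<omega> t - \<omega> s) ^ 4) = E' (\<lambda>w. clip c (sqrt (t - s) * \<zeta> 1 w) ^ 4)"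
      using EE[OF grid bl] by (simp only: inc)
    also have "\<dots> \<le> E' (\<lambda>w. (t - s)\<^sup>2 * \<zeta> 1 w ^ 4)"
    proof (rule mono[rule_format])
      have sH: "(\<lambda>w. sqrt (t - s) * \<zeta> 1 w) \<in> H"
      proof -
        have "loc_lipschitz 1 (\<lambda>x. sqrt (t - s) * x 0)" unfolding loc_lipschitz_def
        proof (intro exI allI)
          fix x y :: "nat \<Rightarrow> real"
          have "\<bar>sqrt (t - s) * x 0 - sqrt (t - s) * y 0\<bar> = sqrt (t - s) * \<bar>x 0 - y 0\<bar>"
            using st by (simp add: abs_mult right_diff_distrib[symmetric])
          also have "\<dots> \<le> sqrt (t - s) * (3 * \<bar>x 0 - y 0\<bar>)" using st by (intro mult_left_mono) auto
          finally show "\<bar>sqrt (t - s) * x 0 - sqrt (t - s) * y 0\<bar> \<le>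
             sqrt (t - s) * (1 + L2_set x {..<1} ^ 0 + L2_set y {..<1} ^ 0) * L2_set (\<lambda>i. x i - y i) {..<1}"
            by (simp add: L2_set_def lessThan_Suc)
        qed
        from H[OF this, of "\<lambda>_. \<zeta> 1"] z show ?thesis by simp
      qed
      have "bdd_lipschitz 1 (\<lambda>x. clip c (x 0) ^ 4)" by (rule clip_power4_bdd_lipschitz[OF c]) simp
      from H[OF bdd_lipschitz_imp_loc_lipschitz[OF this], of "\<lambda>_ w. sqrt (t - s) * \<zeta> 1 w"] sH
      show "(\<lambda>w. clip c (sqrt (t - s) * \<zeta> 1 w) ^ 4) \<in> H" by simp
      have eq: "(sqrt (t - s) * x) ^ 4 = (t - s)\<^sup>2 * x ^ 4" for x
      proof -
        have "sqrt (t - s) ^ 4 = (sqrt (t - s) ^ 2) ^ 2" by (simp only: power_mult[symmetric]) simp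
        then show ?thesis using st by (simp add: power_mult_distrib)
      qed
      from H[OF loc_lipschitz_power4, of "\<lambda>_ w. sqrt (t - s) * \<zeta> 1 w"] sH
      show "(\<lambda>w. (t - s)\<^sup>2 * \<zeta> 1 w ^ 4) \<in> H" by (simp add: eq)
      fix w
      have "\<bar>clip c (sqrt (t - s) * \<zeta> 1 w)\<bar> ^ 4 \<le> \<bar>sqrt (t - s) * \<zeta> 1 w\<bar> ^ 4"
        using c by (intro power_mono) (auto simp: abs_clip)
      then show "clip c (sqrt (t - s) * \<zeta> 1 w) ^ 4 \<le> (t - s)\<^sup>2 * \<zeta> 1 w ^ 4" by (simp add: power_even_abs eq)
    qed
    also have "\<dots> = (t - s)\<^sup>2 * E' (\<lambda>w. \<zeta> 1 w ^ 4)" by (rule scale[rule_format, OF z4]) simp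
    finally show "E (\<lambda>\<omega>. clip c (\<omega> t - \<omega> s) ^ 4) \<le> E' (\<lambda>w. \<zeta> 1 w ^ 4) * (t - s)\<^sup>2" by (simp add: mult.commute)
  qed
qed

theorem theorem6p10:
  fixes T \<sigma>l \<sigma>u C :: real
    and H :: "('w \<Rightarrow> real) set"
    and E' :: "('w \<Rightarrow> real) \<Rightarrow> real"
    and \<zeta> :: "nat \<Rightarrow> 'w \<Rightarrow> real"
    and E :: "((real \<Rightarrow> real) \<Rightarrow> real) \<Rightarrow> real"
    and \<xi> \<eta> :: "real \<Rightarrow> (real \<Rightarrow> real) \<Rightarrow> real"
  assumes "0 < T" and "0 < \<sigma>l\<^sup>2" and "\<sigma>l\<^sup>2 \<le> \<sigma>u\<^sup>2"
    and "is_G_expectation T \<sigma>l \<sigma>u H E' \<zeta> E"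
    and "\<xi> \<in> MG2 T E" and "\<eta> \<in> MG2 T E"
    and "\<And>t. t \<in> {0..T} \<Longrightarrow> \<xi> t \<in> LG T E 2 T"
    and "\<And>t. t \<in> {0..T} \<Longrightarrow> \<eta> t \<in> LG T E 2 T"
    and "0 \<le> C"
    and "\<And>t s. t \<in> {0..T} \<Longrightarrow> s \<in> {0..T} \<Longrightarrow>
           Ehat T E (\<lambda>\<omega>. \<bar>\<xi> t \<omega> - \<xi> s \<omega>\<bar>\<^sup>2 + \<bar>\<eta> t \<omega> - \<eta> s \<omega>\<bar>\<^sup>2) \<le> C * \<bar>t - s\<bar>"
  shows "\<exists>R. (\<forall>t\<in>{0..T}. R t \<in> Probs_at2 T E (\<xi> t) (\<eta> t)) \<and>
             R \<in> restrict_space borel {0..T} \<rightarrow>\<^sub>M Probs_borel T E"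
proof -
  interpret moment_bound T "E' (\<lambda>w. \<zeta> 1 w ^ 4)" E
    by (rule G_expectation_moment_bound[OF assms(1,4)])
  show ?thesis by (rule measurable_argmax_selection[OF assms(7,8,10)])
qed

end
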